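(* Let $\square=[-1,1]\times[-1,1]\subset\mathbb C$ (i.e. $\{s+it: s,t\in[-1,1]\}$) and $\overline{\mathbb D}=\{\zeta\in\mathbb C: |\zeta|\le1\}$. The minimal noncommutative square $\square^{\rm min}$ and the minimal noncommutative disc $\overline{\mathbb D}^{\rm min}$ have Smith-Ward geometry.
   Context: $\mathbb B$ is the C$^*$-algebra of bounded linear operators on $\ell^2(\mathbb N)$ and $\mathbb K$ is the ideal of compact operators. For an element $x$ of a unital C$^*$-algebra, $\mathcal O_x=\mathrm{Span}\{1,x,x^*\}$. The matrix range is $W(x)=\bigsqcup_n W_n(x)$, $W_n(x)=\{\phi(x) : \phi:\mathrm C^*(\mathcal O_x)\to M_n(\mathbb C)\text{ unital completely positive}\}$. For $x\in\mathbb B$, the essential matrix range $W_{\rm e}(x)=\bigsqcup_n W_{n,{\rm e}}(x)$ is defined in the same way but using only those $\phi$ that vanish on every compact operator in $\mathrm C^*(\mathcal O_x)$; it equals the matrix range of the image of $x$ in $\mathbb B/\mathbb K$. For a compact convex set $K\subseteq\mathbb C$, $K^{\rm min}=\bigsqcup_nK_n^{\rm min}$, where $K_n^{\rm min}$ is the set of matrices $a\in M_n(\mathbb C)$ for which there are positive $h_1,\dots,h_m\in M_n(\mathbb C)$ and $\lambda_1,\dots,\lambda_m\in K$ with $\sum_jh_j=1_n$ and $a=\sum_j\lambda_jh_j$. An operator $x\in\mathbb B$ has the Smith-Ward property if $W_{\rm e}(x)=W(x+k)$ for some $k\in\mathbb K$. A compact matrix convex set in $\mathbb C$ is a graded set $K_{\rm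 nc}=\bigsqcup_n K_n$, $K_n\subseteq M_n(\mathbb C)$ compact, such that $\sum_{j=1}^m\gamma_j^*a_j\gamma_j\in K_n$ whenever $a_j\in K_{n_j}$ and $\gamma_j:\mathbb C^n\to\mathbb C^{n_j}$ are linear with $\sum_j\gamma_j^*\gamma_j=1_n$. It has Smith-Ward geometry if every $x\in\mathbb B$ with $W_{\rm e}(x)=K_{\rm nc}$ has the Smith-Ward property. *)

theory Defs
  imports
    "HOL-Analysis.Analysis"
    "HOL-Library.Nonpos_Ints"
    "Jordan_Normal_Form.Schur_Decomposition"
begin

section \<open>The Hilbert space of square-summable complex sequences\<close>

typedef ell2 = "{f :: nat \<Rightarrow> complex. summable (\<lambda>n. (cmod (f n))\<^sup>2)}"
  morphisms ell2_nth Abs_ell2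
  by (rule exI[of _ "\<lambda>_. 0"]) simp

setup_lifting type_definition_ell2

lemma ell2_eqI: "(\<And>n. ell2_nth u n = ell2_nth v n) \<Longrightarrow> u = v"
  by (simp add: ell2_nth_inject[symmetric] ext)

lemma ell2_summable: "summable (\<lambda>n. (cmod (ell2_nth u n))\<^sup>2)"
  using ell2_nth[of u] by simp

lemma cmod_mult_le_squares: "cmod a * cmod b \<le> (cmod a)\<^sup>2 + (cmod b)\<^sup>2"
proof -
  have "0 \<le> (cmod a - cmod b)\<^sup>2" by simp
  then have "2 * (cmod a * cmod b) \<le> (cmod a)\<^sup>2 + (cmod b)\<^sup>2"
    by (simp add: power2_diff)
  moreover have "0 \<le> cmod a * cmod b" by simp
  ultimately show ?thesis by linarith
qed

lemma square_summable_add: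
  assumes "summable (\<lambda>n. (cmod (f n))\<^sup>2)" "summable (\<lambda>n. (cmod (g n))\<^sup>2)"
  shows "summable (\<lambda>n. (cmod (f n + g n))\<^sup>2)"
proof (rule summable_comparison_test')
  show "summable (\<lambda>n. 3 * ((cmod (f n))\<^sup>2 + (cmod (g n))\<^sup>2))"
    by (intro summable_mult summable_add assms)
  fix n
  have "(cmod (f n + g n))\<^sup>2 \<le> (cmod (f n) + cmod (g n))\<^sup>2"
    by (intro power_mono norm_triangle_ineq) simp
  also have "\<dots> \<le> 3 * ((cmod (f n))\<^sup>2 + (cmod (g n))\<^sup>2)"
    using cmod_mult_le_squares[of "f n" "g n"] by (simp add: power2_sum)
  finally show "norm ((cmod (f n + g n))\<^sup>2) \<le> 3 * ((cmod (f n))\<^sup>2 + (cmod (g n))\<^sup>2)"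
    by simp
qed

lemma ell2_summable_prod: "summable (\<lambda>n. ell2_nth u n * cnj (ell2_nth v n))"
proof (rule summable_comparison_test')
  show "summable (\<lambda>n. (cmod (ell2_nth u n))\<^sup>2 + (cmod (ell2_nth v n))\<^sup>2)"
    by (intro summable_add ell2_summable)
qed (simp add: norm_mult cmod_mult_le_squares)

lift_definition scaleC_ell2 :: "complex \<Rightarrow> ell2 \<Rightarrow> ell2" is "\<lambda>c f n. c * f n"
  by (simp add: norm_mult power_mult_distrib summable_mult)

text \<open>The complex inner product is linear in the first argument.\<close>

definition cinner :: "ell2 \<Rightarrow> ell2 \<Rightarrow> complex" where
  "cinner u v = (\<Sum>n. ell2_nth u n * cnj (ell2_nth v n))"

instantiation ell2 :: real_inner
begin

lift_definition zero_ell2 :: ell2 is "\<lambda>_. 0" by simp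
lift_definition plus_ell2 :: "ell2 \<Rightarrow> ell2 \<Rightarrow> ell2" is "\<lambda>f g n. f n + g n"
  by (rule square_summable_add)
lift_definition uminus_ell2 :: "ell2 \<Rightarrow> ell2" is "\<lambda>f n. - f n" by simp
lift_definition minus_ell2 :: "ell2 \<Rightarrow> ell2 \<Rightarrow> ell2" is "\<lambda>f g n. f n - g n"
  subgoal for f g using square_summable_add[of f "\<lambda>n. - g n"] by simp
  done
lift_definition scaleR_ell2 :: "real \<Rightarrow> ell2 \<Rightarrow> ell2" is "\<lambda>r f n. of_real r * f n"
  by (simp add: norm_mult power_mult_distrib summable_mult)

definition "inner u v = Re (cinner u v)" for u v :: ell2
definition "norm u = sqrt (inner u u)" for u :: ell2
definition "dist u v = norm (u - v)" for u v :: ell2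
definition "sgn u = inverse (norm u) *\<^sub>R u" for u :: ell2
definition [code del]:
  "(uniformity :: (ell2 \<times> ell2) filter) = (INF e\<in>{0<..}. principal {(x, y). dist x y < e})"
definition [code del]:
  "open (U :: ell2 set) \<longleftrightarrow> (\<forall>x\<in>U. eventually (\<lambda>(x', y). x' = x \<longrightarrow> y \<in> U) uniformity)"

instance
proof
  fix u v w :: ell2 and r s :: real
  show "u + v + w = u + (v + w)" by (transfer, simp add: add.assoc)
  show "u + v = v + u" by (transfer, simp add: add.commute)
  show "0 + u = u" by (transfer, simp)
  show "- u + u = 0" by (transfer, simp)
  show "u - v = u + - v" by (transfer, simp)
  show "r *\<^sub>R (u + v) = r *\<^sub>R u + r *\<^sub>R v" by (transfer, simp add: algebra_simps)
  show "(r + s) *\<^sub>R u = r *\<^sub>R u + s *\<^sub>R u" by (transfer, simp add: algebra_simps)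
  show "r *\<^sub>R s *\<^sub>R u = (r * s) *\<^sub>R u" by (transfer, simp add: algebra_simps)
  show "1 *\<^sub>R u = u" by (transfer, simp)
  show "sgn u = inverse (norm u) *\<^sub>R u" by (simp add: sgn_ell2_def)
  show "dist u v = norm (u - v)" by (simp add: dist_ell2_def)
  show "(uniformity :: (ell2 \<times> ell2) filter) = (INF e\<in>{0<..}. principal {(x, y). dist x y < e})"
    by (rule uniformity_ell2_def)
  show "open U \<longleftrightarrow> (\<forall>x\<in>U. eventually (\<lambda>(x', y). x' = x \<longrightarrow> y \<in> U) uniformity)" for U :: "ell2 set"
    by (rule open_ell2_def)
  have re: "inner a b = (\<Sum>n. Re (ell2_nth a n * cnj (ell2_nth b n)))" for a b
    unfolding inner_ell2_def cinner_def by (rule Re_suminf[OF ell2_summable_prod])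
  have sre: "summable (\<lambda>n. Re (ell2_nth a n * cnj (ell2_nth b n)))" for a b
    by (rule summable_Re[OF ell2_summable_prod])
  show "inner u v = inner v u"
    unfolding re by (rule suminf_cong) (simp add: algebra_simps)
  show "inner (u + v) w = inner u w + inner v w"
    unfolding re suminf_add[OF sre sre]
    by (rule suminf_cong) (simp add: plus_ell2.rep_eq algebra_simps)
  show "inner (r *\<^sub>R u) v = r * inner u v"
    unfolding re suminf_mult[OF sre, symmetric]
    by (rule suminf_cong) (simp add: scaleR_ell2.rep_eq algebra_simps)
  have sq: "inner u u = (\<Sum>n. (cmod (ell2_nth u n))\<^sup>2)"
    unfolding re by (rule suminf_cong) (simp only: complex_mult_cnj cmod_power2 Re_complex_of_real)
  show "0 \<le> inner u u"
    unfolding sq by (rule suminf_nonneg[OF ell2_summable]) simp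
  show "inner u u = 0 \<longleftrightarrow> u = 0"
    unfolding sq suminf_eq_zero_iff[OF ell2_summable, OF zero_le_power2]
    by (auto intro!: ell2_eqI simp: zero_ell2.rep_eq)
  show "norm u = sqrt (inner u u)" by (rule norm_ell2_def)
qed

end

lemma norm_ell2_sq: "(norm u)\<^sup>2 = (\<Sum>n. (cmod (ell2_nth u n))\<^sup>2)"
proof -
  have "inner u u = (\<Sum>n. Re (ell2_nth u n * cnj (ell2_nth u n)))"
    unfolding inner_ell2_def cinner_def by (rule Re_suminf[OF ell2_summable_prod])
  also have "\<dots> = (\<Sum>n. (cmod (ell2_nth u n))\<^sup>2)"
    by (rule suminf_cong) (simp only: complex_mult_cnj cmod_power2 Re_complex_of_real)
  finally show ?thesis by (simp add: power2_norm_eq_inner)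
qed

lemma norm_scaleC_ell2: "norm (scaleC_ell2 c u) = cmod c * norm u"
proof -
  have "(norm (scaleC_ell2 c u))\<^sup>2 = (cmod c * norm u)\<^sup>2"
    by (simp add: norm_ell2_sq scaleC_ell2.rep_eq norm_mult power_mult_distrib
        suminf_mult[OF ell2_summable])
  then show ?thesis by simp
qed

lemma scaleC_ell2_add: "scaleC_ell2 c (u + v) = scaleC_ell2 c u + scaleC_ell2 c v"
  by (rule ell2_eqI) (simp add: scaleC_ell2.rep_eq plus_ell2.rep_eq algebra_simps)

lemma scaleC_ell2_scaleC: "scaleC_ell2 c (scaleC_ell2 d u) = scaleC_ell2 (c * d) u"
  by (rule ell2_eqI) (simp add: scaleC_ell2.rep_eq algebra_simps)

lemma scaleC_ell2_of_real: "scaleC_ell2 (of_real r) u = r *\<^sub>R u"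
  by (rule ell2_eqI) (simp add: scaleC_ell2.rep_eq scaleR_ell2.rep_eq)

lemma scaleC_ell2_scaleR: "scaleC_ell2 c (r *\<^sub>R u) = r *\<^sub>R scaleC_ell2 c u"
  by (simp flip: scaleC_ell2_of_real add: scaleC_ell2_scaleC mult.commute)

lemma bounded_linear_scaleC_ell2: "bounded_linear (scaleC_ell2 c)"
  by (rule bounded_linear_intro[of _ "cmod c"])
    (simp_all add: scaleC_ell2_add scaleC_ell2_scaleR norm_scaleC_ell2 mult.commute)

section \<open>The algebra of bounded operators\<close>

typedef bop =
  "{f :: ell2 \<Rightarrow> ell2. bounded_linear f \<and> (\<forall>c u. f (scaleC_ell2 c u) = scaleC_ell2 c (f u))}"
  morphisms bop_apply Abs_bop
  by (rule exI[of _ "\<lambda>u. u"]) (simp add: bounded_linear_ident)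

setup_lifting type_definition_bop

lemma bop_bounded_linear: "bounded_linear (bop_apply x)"
  using bop_apply[of x] by simp

lemma bop_eqI: "(\<And>u. bop_apply x u = bop_apply y u) \<Longrightarrow> x = y"
  by (simp add: bop_apply_inject[symmetric] ext)

lift_definition scaleC_bop :: "complex \<Rightarrow> bop \<Rightarrow> bop" is "\<lambda>c f u. scaleC_ell2 c (f u)"
  by (auto simp: scaleC_ell2_scaleC mult.commute
      intro: bounded_linear_compose[OF bounded_linear_scaleC_ell2])

text \<open>The norm is the operator norm, the product is composition.\<close>

instantiation bop :: real_normed_algebra_1
begin

lift_definition zero_bop :: bop is "\<lambda>_. 0"
  by (auto intro!: ell2_eqI simp: scaleC_ell2.rep_eq zero_ell2.rep_eq)
lift_definition one_bop :: bop is "\<lambda>u. u" by (simp add: bounded_linear_ident)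
lift_definition plus_bop :: "bop \<Rightarrow> bop \<Rightarrow> bop" is "\<lambda>f g u. f u + g u"
  by (auto intro: bounded_linear_add simp: scaleC_ell2_add)
lift_definition uminus_bop :: "bop \<Rightarrow> bop" is "\<lambda>f u. - f u"
  by (auto intro!: bounded_linear_minus ell2_eqI simp: scaleC_ell2.rep_eq uminus_ell2.rep_eq)
lift_definition minus_bop :: "bop \<Rightarrow> bop \<Rightarrow> bop" is "\<lambda>f g u. f u - g u"
  by (auto intro!: bounded_linear_sub ell2_eqI
      simp: scaleC_ell2.rep_eq minus_ell2.rep_eq right_diff_distrib)
lift_definition times_bop :: "bop \<Rightarrow> bop \<Rightarrow> bop" is "\<lambda>f g u. f (g u)"
  by (auto intro: bounded_linear_compose)
lift_definition scaleR_bop :: "real \<Rightarrow> bop \<Rightarrow> bop" is "\<lambda>r f u. r *\<^sub>R f u"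
  by (auto simp: scaleC_ell2_scaleR intro: bounded_linear_compose[OF bounded_linear_scaleR_right])

lift_definition norm_bop :: "bop \<Rightarrow> real" is onorm .
definition "dist x y = norm (x - y)" for x y :: bop
definition "sgn x = inverse (norm x) *\<^sub>R x" for x :: bop
definition [code del]:
  "(uniformity :: (bop \<times> bop) filter) = (INF e\<in>{0<..}. principal {(x, y). dist x y < e})"
definition [code del]:
  "open (U :: bop set) \<longleftrightarrow> (\<forall>x\<in>U. eventually (\<lambda>(x', y). x' = x \<longrightarrow> y \<in> U) uniformity)"

instance
proof
  fix x y z :: bop and r s :: real
  note rep = plus_bop.rep_eq minus_bop.rep_eq uminus_bop.rep_eq zero_bop.rep_eq
    times_bop.rep_eq scaleR_bop.rep_eq one_bop.rep_eq
  interpret X: bounded_linear "bop_apply x" by (rule bop_bounded_linear)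
  show "x + y + z = x + (y + z)" by (rule bop_eqI) (simp add: rep)
  show "x + y = y + x" by (rule bop_eqI) (simp add: rep)
  show "0 + x = x" by (rule bop_eqI) (simp add: rep)
  show "- x + x = 0" by (rule bop_eqI) (simp add: rep)
  show "x - y = x + - y" by (rule bop_eqI) (simp add: rep)
  show "r *\<^sub>R (x + y) = r *\<^sub>R x + r *\<^sub>R y"
    by (rule bop_eqI) (simp add: rep scaleR_add_right)
  show "(r + s) *\<^sub>R x = r *\<^sub>R x + s *\<^sub>R x"
    by (rule bop_eqI) (simp add: rep scaleR_add_left)
  show "r *\<^sub>R s *\<^sub>R x = (r * s) *\<^sub>R x" by (rule bop_eqI) (simp add: rep)
  show "1 *\<^sub>R x = x" by (rule bop_eqI) (simp add: rep)
  show "x * y * z = x * (y * z)" by (rule bop_eqI) (simp add: rep)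
  show "(x + y) * z = x * z + y * z" by (rule bop_eqI) (simp add: rep)
  show "x * (y + z) = x * y + x * z" by (rule bop_eqI) (simp add: rep X.add)
  show "r *\<^sub>R x * y = r *\<^sub>R (x * y)" by (rule bop_eqI) (simp add: rep)
  show "x * r *\<^sub>R y = r *\<^sub>R (x * y)" by (rule bop_eqI) (simp add: rep X.scaleR)
  show "1 * x = x" by (rule bop_eqI) (simp add: rep)
  show "x * 1 = x" by (rule bop_eqI) (simp add: rep)
  define e where "e = Abs_ell2 (\<lambda>n. if n = 0 then 1 else 0)"
  have "ell2_nth e = (\<lambda>n. if n = 0 then 1 else 0)"
    unfolding e_def
    by (rule Abs_ell2_inverse) (auto intro!: summable_finite[of "{0}"] split: if_splits)
  then have e: "e \<noteq> 0" by (metis zero_ell2.rep_eq zero_neq_one)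
  show "(0 :: bop) \<noteq> 1" by (metis e zero_bop.rep_eq one_bop.rep_eq)
  show "sgn x = inverse (norm x) *\<^sub>R x" by (simp add: sgn_bop_def)
  show "dist x y = norm (x - y)" by (simp add: dist_bop_def)
  show "(uniformity :: (bop \<times> bop) filter) = (INF e\<in>{0<..}. principal {(x, y). dist x y < e})"
    by (rule uniformity_bop_def)
  show "open U \<longleftrightarrow> (\<forall>x\<in>U. eventually (\<lambda>(x', y). x' = x \<longrightarrow> y \<in> U) uniformity)" for U :: "bop set"
    by (rule open_bop_def)
  show "norm x = 0 \<longleftrightarrow> x = 0"
    by (auto simp: norm_bop.rep_eq onorm_eq_0[OF bop_bounded_linear] zero_bop.rep_eq intro: bop_eqI)
  show "norm (x + y) \<le> norm x + norm y"
    by (simp add: norm_bop.rep_eq plus_bop.rep_eq onorm_triangle bop_bounded_linear)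
  show "norm (r *\<^sub>R x) = \<bar>r\<bar> * norm x"
    by (simp add: norm_bop.rep_eq scaleR_bop.rep_eq onorm_scaleR bop_bounded_linear)
  show "norm (x * y) \<le> norm x * norm y"
    using onorm_compose[OF bop_bounded_linear[of x] bop_bounded_linear[of y]]
    by (simp add: norm_bop.rep_eq times_bop.rep_eq o_def)
  show "norm (1 :: bop) = 1"
  proof (rule antisym)
    show "norm (1 :: bop) \<le> 1"
      unfolding norm_bop.rep_eq one_bop.rep_eq by (rule onorm_bound) simp_all
    have "norm e \<le> norm (1 :: bop) * norm e"
      using onorm[OF bop_bounded_linear[of 1], of e] by (simp add: norm_bop.rep_eq one_bop.rep_eq)
    then show "1 \<le> norm (1 :: bop)" using e by simp
  qed
qed

end

text \<open>The description below denotes the adjoint, which exists uniquely by the Riesz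
  representation theorem.\<close>

definition adj :: "bop \<Rightarrow> bop" where
  "adj x = (THE y. \<forall>u v. cinner (bop_apply x u) v = cinner u (bop_apply y v))"

definition compact_op :: "bop \<Rightarrow> bool" where
  "compact_op k \<longleftrightarrow> compact (closure (bop_apply k ` cball 0 1))"

definition cstar_subalgebra :: "bop set \<Rightarrow> bool" where
  "cstar_subalgebra A \<longleftrightarrow> closed A \<and> 1 \<in> A \<and>
    (\<forall>a\<in>A. \<forall>b\<in>A. a + b \<in> A \<and> a * b \<in> A) \<and>
    (\<forall>c. \<forall>a\<in>A. scaleC_bop c a \<in> A) \<and> (\<forall>a\<in>A. adj a \<in> A)"

definition opsys :: "bop \<Rightarrow> bop set" where
  "opsys x = {scaleC_bop \<alpha> 1 + scaleC_bop \<beta> x + scaleC_bop \<gamma> (adj x) | \<alpha> \<beta> \<gamma>. True}"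

definition cstar :: "bop \<Rightarrow> bop set" where
  "cstar x = cstar_subalgebra hull opsys x"

section \<open>Unital completely positive maps into matrix algebras\<close>

text \<open>A block matrix \<open>(a i j)\<close> with \<open>i, j < k\<close> and entries in \<open>B(H)\<close> (respectively in the
  \<open>n \<times> n\<close> matrices) is positive iff it is a positive operator on the \<open>k\<close>-fold direct sum of
  \<open>H\<close> (respectively of the complex \<open>n\<close>-space) with itself.\<close>

definition block_positive_bop :: "nat \<Rightarrow> (nat \<Rightarrow> nat \<Rightarrow> bop) \<Rightarrow> bool" where
  "block_positive_bop k a \<longleftrightarrow>
    (\<forall>\<xi>. (\<Sum>i<k. \<Sum>j<k. cinner (bop_apply (a i j) (\<xi> j)) (\<xi> i)) \<in> \<real>\<^sub>\<ge>\<^sub>0)"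

definition block_positive_mat :: "nat \<Rightarrow> nat \<Rightarrow> (nat \<Rightarrow> nat \<Rightarrow> complex mat) \<Rightarrow> bool" where
  "block_positive_mat n k b \<longleftrightarrow>
    (\<forall>\<eta>. (\<forall>i<k. \<eta> i \<in> carrier_vec n) \<longrightarrow>
      (\<Sum>i<k. \<Sum>j<k. (b i j *\<^sub>v \<eta> j) \<bullet>c \<eta> i) \<in> \<real>\<^sub>\<ge>\<^sub>0)"

definition ucp_map :: "nat \<Rightarrow> bop set \<Rightarrow> (bop \<Rightarrow> complex mat) \<Rightarrow> bool" where
  "ucp_map n A \<phi> \<longleftrightarrow>
    (\<forall>a\<in>A. \<phi> a \<in> carrier_mat n n) \<and>
    (\<forall>a\<in>A. \<forall>b\<in>A. \<phi> (a + b) = \<phi> a + \<phi> b) \<and>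
    (\<forall>c. \<forall>a\<in>A. \<phi> (scaleC_bop c a) = c \<cdot>\<^sub>m \<phi> a) \<and>
    \<phi> 1 = 1\<^sub>m n \<and>
    (\<forall>k a. (\<forall>i<k. \<forall>j<k. a i j \<in> A) \<and> block_positive_bop k a
      \<longrightarrow> block_positive_mat n k (\<lambda>i j. \<phi> (a i j)))"

section \<open>Matrix ranges\<close>

text \<open>A graded set (one set of \<open>n \<times> n\<close> matrices for each \<open>n \<ge> 1\<close>) is represented by
  the union of its levels: matrices carry their dimension, so this union is disjoint and level
  \<open>n\<close> of \<open>S\<close> is \<open>S \<inter> carrier_mat n n\<close>.\<close>

definition matrix_range_level :: "nat \<Rightarrow> bop \<Rightarrow> complex mat set" where
  "matrix_range_level n x = {\<phi> x | \<phi>. ucp_map n (cstar x) \<phi>}"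

definition matrix_range :: "bop \<Rightarrow> complex mat set" where
  "matrix_range x = (\<Union>n\<in>{1..}. matrix_range_level n x)"

definition ess_matrix_range_level :: "nat \<Rightarrow> bop \<Rightarrow> complex mat set" where
  "ess_matrix_range_level n x =
    {\<phi> x | \<phi>. ucp_map n (cstar x) \<phi> \<and> (\<forall>k\<in>cstar x. compact_op k \<longrightarrow> \<phi> k = 0\<^sub>m n n)}"

definition ess_matrix_range :: "bop \<Rightarrow> complex mat set" where
  "ess_matrix_range x = (\<Union>n\<in>{1..}. ess_matrix_range_level n x)"

definition smith_ward_property :: "bop \<Rightarrow> bool" where
  "smith_ward_property x \<longleftrightarrow> (\<exists>k. compact_op k \<and> ess_matrix_range x = matrix_range (x + k))"

section \<open>Compact matrix convex sets\<close>

text \<open>The sum of \<open>f 0, \<dots>, f (m - 1)\<close> for \<open>n \<times> n\<close> matrices \<open>f j\<close>; the type of matrices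
  of all dimensions has no zero, so the generic \<^const>\<open>sum\<close> does not apply.\<close>

definition msum :: "nat \<Rightarrow> nat \<Rightarrow> (nat \<Rightarrow> complex mat) \<Rightarrow> complex mat" where
  "msum n m f = Matrix.mat n n (\<lambda>ij. \<Sum>j<m. f j $$ ij)"

text \<open>Compactness in the \<open>n \<times> n\<close> matrices, via the embedding by entries (extended by zero)
  into a space of functions with the product topology.\<close>

definition compact_mats :: "nat \<Rightarrow> complex mat set \<Rightarrow> bool" where
  "compact_mats n S \<longleftrightarrow>
    compact ((\<lambda>a ij. if ij \<in> {..<n} \<times> {..<n} then a $$ ij else 0) ` S)"

definition compact_matrix_convex :: "complex mat set \<Rightarrow> bool" where
  "compact_matrix_convex S \<longleftrightarrow>
    S \<subseteq> (\<Union>n\<in>{1..}. carrier_mat n n) \<and>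
    (\<forall>n\<ge>1. compact_mats n (S \<inter> carrier_mat n n)) \<and>
    (\<forall>n\<ge>1. \<forall>m d a \<gamma>.
      (\<forall>j<m. d j \<ge> 1 \<and> a j \<in> S \<inter> carrier_mat (d j) (d j) \<and> \<gamma> j \<in> carrier_mat (d j) n) \<and>
      msum n m (\<lambda>j. mat_adjoint (\<gamma> j) * \<gamma> j) = 1\<^sub>m n
      \<longrightarrow> msum n m (\<lambda>j. mat_adjoint (\<gamma> j) * a j * \<gamma> j) \<in> S)"

text \<open>Smith-Ward geometry is a property of compact matrix convex sets, so being one is part of
  the predicate.\<close>

definition smith_ward_geometry :: "complex mat set \<Rightarrow> bool" where
  "smith_ward_geometry S \<longleftrightarrow> compact_matrix_convex S \<and>
    (\<forall>x. ess_matrix_range x = S \<longrightarrow> smith_ward_property x)"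

definition positive_mat :: "nat \<Rightarrow> complex mat \<Rightarrow> bool" where
  "positive_mat n h \<longleftrightarrow> h \<in> carrier_mat n n \<and> (\<forall>v\<in>carrier_vec n. (h *\<^sub>v v) \<bullet>c v \<in> \<real>\<^sub>\<ge>\<^sub>0)"

definition min_level :: "nat \<Rightarrow> complex set \<Rightarrow> complex mat set" where
  "min_level n K = {a \<in> carrier_mat n n. \<exists>m h l.
    (\<forall>j<m. positive_mat n (h j) \<and> l j \<in> K) \<and>
    msum n m h = 1\<^sub>m n \<and> a = msum n m (\<lambda>j. l j \<cdot>\<^sub>m h j)}"

definition min_set :: "complex set \<Rightarrow> complex mat set" where
  "min_set K = (\<Union>n\<in>{1..}. min_level n K)"

end

theory Submission
  imports Defs
begin

text \<open>Let \<open>K\<close> be the square or the disc. A matrix \<open>a\<close> lies in the minimal matrix convex set over \<open>K\<close>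
  iff certain combinations \<open>p a + cnj q a\<^sup>*\<close> are contractions. For the disc this is the single
  condition that \<open>a\<close> is a contraction, and the decomposition of \<open>a\<close> comes from the Poisson kernel.
  For the square put \<open>u = (Re a + Im a) / 2\<close> and \<open>v = (Re a - Im a) / 2\<close>; the conditions are that
  \<open>u + \<omega> v\<close> is a contraction whenever \<open>\<omega>\<close> is unimodular. They make the block Jacobi matrix with unit
  diagonal and off-diagonal entries \<open>u, v, u, v, \<dots>\<close> positive, and successive Schur complements split
  it into \<open>2 \<times> 2\<close> blocks, from which the decomposition is read off up to an error that tends to \<open>0\<close> with
  the length of the chain.

  If the essential matrix range of \<open>x\<close> is the minimal set over \<open>K\<close>, then \<open>x\<close> satisfies these
  conditions up to \<open>\<epsilon>\<close> far out along the basis. Gluing \<open>x\<close> there to a scaled copy of \<open>x\<close> near the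
  origin, along a partition that almost commutes with \<open>x\<close>, improves the constant by a small compact
  perturbation; iterating gives a compact \<open>k\<close> such that \<open>x + k\<close> satisfies the conditions exactly, so
  its matrix range is contained in the minimal set. Conversely, the points of \<open>K\<close> of maximal modulus
  are values at \<open>x\<close> of states that kill the compact operators, and \<open>K\<close> is their convex hull.
  Therefore every \<open>\<Sum>\<^sub>j l\<^sub>j h\<^sub>j\<close> in the minimal set is the value at \<open>x + k\<close> of a unital completely
  positive map \<open>b \<mapsto> \<Sum>\<^sub>j f\<^sub>j(b) h\<^sub>j\<close>.\<close>

section \<open>Positive kernels\<close>

text \<open>The obstacle is that one compact \<open>k\<close> has to serve every level n at once.
  For these two sets, membership at any level is decided by quadratic inequalities in two vectors,
  so only 2 by 2 compressions have to be controlled and no estimate depends on n. Gluing works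
  because a test is a quadratic form: with \<open>f * f + g * g = 1\<close>, the test of
  \<open>r *\<^sub>R (f * y * f) + g * y * g\<close> at (u, v) is exactly r times the test of y at
  (f u, f v) plus its test at (g u, g v), without cross terms. The cost is the distance from f y f +
  g y g to y, a commutator estimate; as f and g do not depend on the test, infinitely many tests are
  treated together. Halving the excess e of the constant costs a perturbation of norm at most
  \<open>e * (norm y + 1)\<close>, so the increments are summable. A second obstacle: the maps of
  the essential matrix range live on \<open>cstar x\<close> and cannot be applied to
  \<open>x + k\<close>. For the converse inclusion they only serve to find vectors in the tails on
  which x has prescribed values; states on all operators then arise as cluster points of vector
  states.\<close>

definition frm :: "'i set \<Rightarrow> ('i \<Rightarrow> 'i \<Rightarrow> complex) \<Rightarrow> ('i \<Rightarrow> complex) \<Rightarrow> ('i \<Rightarrow> complex) \<Rightarrow> complex" where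
  "frm A K x y = (\<Sum>i\<in>A. \<Sum>j\<in>A. K i j * x j * cnj (y i))"

text \<open>Over the complex numbers a real-valued form is hermitian, so the symmetry of
  \<open>K\<close> is a consequence (\<open>psd_hermitian\<close>) and not a second clause.\<close>

definition psd :: "'i set \<Rightarrow> ('i \<Rightarrow> 'i \<Rightarrow> complex) \<Rightarrow> bool" where
  "psd A K \<longleftrightarrow> (\<forall>x. frm A K x x \<in> \<real>\<^sub>\<ge>\<^sub>0)"

lemma frm_add_left: "frm A K (\<lambda>i. x i + x' i) y = frm A K x y + frm A K x' y"
  by (simp add: frm_def algebra_simps sum.distrib)

lemma frm_add_right: "frm A K x (\<lambda>i. y i + y' i) = frm A K x y + frm A K x y'"
  by (simp add: frm_def algebra_simps sum.distrib)

lemma frm_scale_left: "frm A K (\<lambda>i. c * x i) y = c * frm A K x y"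
  by (simp add: frm_def sum_distrib_left ac_simps)

lemma frm_scale_right: "frm A K x (\<lambda>i. c * y i) = cnj c * frm A K x y"
  by (simp add: frm_def sum_distrib_left ac_simps)

lemma frm_cong:
  assumes "\<And>i j. i \<in> A \<Longrightarrow> j \<in> A \<Longrightarrow> K i j = K' i j" "\<And>i. i \<in> A \<Longrightarrow> x i = x' i" "\<And>i. i \<in> A \<Longrightarrow> y i = y' i"
  shows "frm A K x y = frm A K' x' y'"
  unfolding frm_def using assms by (intro sum.cong) auto

lemma psd_cong: "(\<And>i j. i \<in> A \<Longrightarrow> j \<in> A \<Longrightarrow> K i j = K' i j) \<Longrightarrow> psd A K \<longleftrightarrow> psd A K'"
proof -
  assume "\<And>i j. i \<in> A \<Longrightarrow> j \<in> A \<Longrightarrow> K i j = K' i j"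
  then have "frm A K x x = frm A K' x x" for x by (intro frm_cong) auto
  then show ?thesis by (simp add: psd_def)
qed

lemma frm_kernel_add: "frm A (\<lambda>i j. K i j + L i j) x y = frm A K x y + frm A L x y"
  by (simp add: frm_def algebra_simps sum.distrib)

lemma frm_kernel_scale: "frm A (\<lambda>i j. c * K i j) x y = c * frm A K x y"
  by (simp add: frm_def sum_distrib_left ac_simps)

lemma frm_kernel_sum: "frm A (\<lambda>i j. \<Sum>t\<in>T. K t i j) x y = (\<Sum>t\<in>T. frm A (K t) x y)"
proof (induction T rule: infinite_finite_induct)
  case (insert t T)
  then show ?case using frm_kernel_add[of A "K t"] by simp
qed (simp_all add: frm_def)

lemma frm_kernel_adj: "frm A (\<lambda>i j. cnj (K j i)) x y = cnj (frm A K y x)"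
proof -
  have "frm A (\<lambda>i j. cnj (K j i)) x y = (\<Sum>j\<in>A. \<Sum>i\<in>A. cnj (K j i) * x j * cnj (y i))"
    unfolding frm_def by (rule sum.swap)
  then show ?thesis by (simp add: frm_def cnj_sum ac_simps)
qed

lemma frm_id:
  assumes "finite A"
  shows "frm A (\<lambda>i j. if i = j then 1 else 0) x y = (\<Sum>i\<in>A. x i * cnj (y i))"
  unfolding frm_def
proof (rule sum.cong[OF refl])
  fix i assume "i \<in> A"
  have "(\<Sum>j\<in>A. (if i = j then 1 else 0) * x j * cnj (y i)) = (\<Sum>j\<in>A. if i = j then x j * cnj (y i) else 0)"
    by (rule sum.cong) auto
  then show "(\<Sum>j\<in>A. (if i = j then 1 else 0) * x j * cnj (y i)) = x i * cnj (y i)"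
    using assms \<open>i \<in> A\<close> by simp
qed

lemma frm_unit_left:
  assumes "finite A" "r \<in> A"
  shows "frm A K (\<lambda>i. if i = r then 1 else 0) y = (\<Sum>i\<in>A. K i r * cnj (y i))"
  unfolding frm_def
proof (rule sum.cong[OF refl])
  fix i assume "i \<in> A"
  have "(\<Sum>j\<in>A. K i j * (if j = r then 1 else 0) * cnj (y i)) = (\<Sum>j\<in>A. if j = r then K i j * cnj (y i) else 0)"
    by (rule sum.cong) auto
  then show "(\<Sum>j\<in>A. K i j * (if j = r then 1 else 0) * cnj (y i)) = K i r * cnj (y i)"
    using assms by simp
qed

lemma frm_unit_right:
  assumes "finite A" "r \<in> A"
  shows "frm A K x (\<lambda>i. if i = r then 1 else 0) = (\<Sum>j\<in>A. K r j * x j)"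
proof -
  have "frm A K x (\<lambda>i. if i = r then 1 else 0) = (\<Sum>i\<in>A. if i = r then (\<Sum>j\<in>A. K i j * x j) else 0)"
    unfolding frm_def by (rule sum.cong) auto
  then show ?thesis using assms by simp
qed

lemma frm_unit:
  assumes "finite A" "r \<in> A" "s \<in> A"
  shows "frm A K (\<lambda>i. if i = r then 1 else 0) (\<lambda>i. if i = s then 1 else 0) = K s r"
proof -
  have "(\<Sum>i\<in>A. K i r * cnj (if i = s then 1 else 0)) = (\<Sum>i\<in>A. if i = s then K i r else 0)"
    by (rule sum.cong) auto
  then show ?thesis using assms by (simp add: frm_unit_left)
qed

lemma psdD: "psd A K \<Longrightarrow> 0 \<le> Re (frm A K x x)" "psd A K \<Longrightarrow> Im (frm A K x x) = 0"
  unfolding psd_def complex_nonneg_Reals_iff by auto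

lemma psd_add: "psd A K \<Longrightarrow> psd A L \<Longrightarrow> psd A (\<lambda>i j. K i j + L i j)"
  by (simp add: psd_def frm_kernel_add complex_nonneg_Reals_iff)

lemma psd_scale: "psd A K \<Longrightarrow> 0 \<le> r \<Longrightarrow> psd A (\<lambda>i j. of_real r * K i j)"
  by (simp add: psd_def frm_kernel_scale complex_nonneg_Reals_iff)

lemma psd_sum: "(\<And>t. t \<in> T \<Longrightarrow> psd A (K t)) \<Longrightarrow> psd A (\<lambda>i j. \<Sum>t\<in>T. K t i j)"
proof (induction T rule: infinite_finite_induct)
  case (insert t T)
  then show ?case using psd_add[of A "K t"] by simp
qed (simp_all add: psd_def frm_def)

text \<open>Polarization: the form is real at \<open>x + y\<close> and at
  \<open>\<i> * x + y\<close>, which settles the imaginary and the real parts.\<close>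

lemma frm_hermitian:
  assumes "psd A K" shows "frm A K y x = cnj (frm A K x y)"
proof -
  have 1: "Im (frm A K (\<lambda>i. c * x i + y i) (\<lambda>i. c * x i + y i)) = 0" for c
    by (rule psdD(2)[OF assms])
  have "Im (c * frm A K x y) + Im (cnj c * frm A K y x) = 0" for c
    using 1[of c] psdD(2)[OF assms, of x] psdD(2)[OF assms, of y]
    by (simp add: frm_add_left frm_add_right frm_scale_left frm_scale_right algebra_simps)
  from this[of 1] this[of \<i>] show ?thesis by (intro complex_eqI) simp_all
qed

lemma psd_hermitian:
  assumes "psd A K" "finite A" "i \<in> A" "j \<in> A" shows "K j i = cnj (K i j)"
  using frm_hermitian[OF assms(1), of "\<lambda>k. if k = i then 1 else 0" "\<lambda>k. if k = j then 1 else 0"]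
    frm_unit[of A] assms(2-4) by simp

text \<open>Positivity at \<open>c * x - y\<close>. The additive form, with a multiplier
  \<open>c\<close> from the unit disc, avoids square roots and is the shape in which the tests are
  stated.\<close>

lemma psd_Cauchy_Schwarz:
  assumes "psd A K" "cmod c \<le> 1"
  shows "2 * Re (c * frm A K x y) \<le> Re (frm A K x x) + Re (frm A K y y)"
proof -
  have "0 \<le> Re (frm A K (\<lambda>i. c * x i + (- 1) * y i) (\<lambda>i. c * x i + (- 1) * y i))"
    by (rule psdD(1)[OF assms(1)])
  also have "frm A K (\<lambda>i. c * x i + (- 1) * y i) (\<lambda>i. c * x i + (- 1) * y i)
      = of_real ((cmod c)\<^sup>2) * frm A K x x + frm A K y y - c * frm A K x y - cnj c * frm A K y x"
    unfolding complex_norm_square frm_add_left frm_add_right frm_scale_left frm_scale_right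
    by (simp add: algebra_simps)
  also have "Re \<dots> = (cmod c)\<^sup>2 * Re (frm A K x x) + Re (frm A K y y) - 2 * Re (c * frm A K x y)"
    by (simp add: frm_hermitian[OF assms(1), of y x])
  finally have "2 * Re (c * frm A K x y) \<le> (cmod c)\<^sup>2 * Re (frm A K x x) + Re (frm A K y y)" by simp
  also have "\<dots> \<le> 1 * Re (frm A K x x) + Re (frm A K y y)"
    by (intro add_right_mono mult_right_mono psdD(1)[OF assms(1)])
      (use assms(2) in \<open>simp add: power_le_one\<close>)
  finally show ?thesis by simp
qed

lemma psd_entry_bound:
  assumes "psd A K" "finite A" "i \<in> A" "j \<in> A"
  shows "2 * cmod (K i j) \<le> Re (K i i) + Re (K j j)"
proof (cases "K i j = 0")
  case True
  then show ?thesis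
    using psdD(1)[OF assms(1), of "\<lambda>k. if k = i then 1 else 0"]
      psdD(1)[OF assms(1), of "\<lambda>k. if k = j then 1 else 0"] frm_unit[OF assms(2)] assms(3,4) by simp
next
  case False
  define c where "c = cnj (sgn (K i j))"
  have "cmod c = 1" using False by (simp add: c_def norm_sgn)
  have "c * K i j = of_real (cmod (K i j))"
    using False complex_norm_square[of "K i j"]
    by (simp add: c_def sgn_div_norm divide_simps scaleR_conv_of_real power2_eq_square mult.commute)
  then show ?thesis
    using psd_Cauchy_Schwarz[OF assms(1), of c "\<lambda>k. if k = j then 1 else 0" "\<lambda>k. if k = i then 1 else 0"]
      frm_unit[OF assms(2)] assms(3,4) \<open>cmod c = 1\<close> by simp
qed

lemma psd_zero_row:
  assumes "psd A K" "finite A" "r \<in> A" "q \<in> A" "K r r = 0"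
  shows "K q r = 0" "K r q = 0"
proof -
  let ?e = "\<lambda>s i. if i = s then 1 else (0 :: complex)"
  show "K q r = 0"
  proof (rule ccontr)
    assume nz: "K q r \<noteq> 0"
    \<comment> \<open>Since \<open>K r r = 0\<close>, the form at \<open>?e q + c * ?e r\<close> is
      affine in \<open>c\<close>; this choice makes it \<open>- Re (K q q) - 2\<close>, which is
      negative.\<close>
    define c where "c = - (of_real (Re (K q q)) + 1) / K q r"
    have "0 \<le> Re (frm A K (\<lambda>i. ?e q i + c * ?e r i) (\<lambda>i. ?e q i + c * ?e r i))"
      by (rule psdD(1)[OF assms(1)])
    also have "\<dots> = Re (K q q + c * K q r + cnj c * K r q)"
      using assms by (simp add: frm_add_left frm_add_right frm_scale_left frm_scale_right frm_unit
          del: mult_cancel_left1)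
    also have "\<dots> = Re (K q q) + 2 * Re (c * K q r)"
      using psd_hermitian[OF assms(1,2), of q r] assms(3,4) by simp
    also have "c * K q r = - (of_real (Re (K q q)) + 1)" using nz by (simp add: c_def)
    finally have "Re (K q q) \<le> - 2" by simp
    moreover have "0 \<le> Re (K q q)"
      using psdD(1)[OF assms(1), of "?e q"] assms by (simp add: frm_unit)
    ultimately show False by simp
  qed
  then show "K r q = 0" using psd_hermitian[OF assms(1,2), of q r] assms(3,4) by simp
qed

text \<open>One Cholesky step with pivot \<open>r\<close>, that is, completing the square in the
  coordinate \<open>r\<close>. A zero pivot needs no separate definition: row and column
  \<open>r\<close> then vanish, and division by zero makes the correction and \<open>w\<close> equal
  to 0.\<close>

lemma psd_eliminate_one:
  fixes K :: "'i \<Rightarrow> 'i \<Rightarrow> complex"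
  assumes K: "psd A K" and fin: "finite A" and r: "r \<in> A"
    and K'_def: "K' = (\<lambda>p q. K p q - K p r * K r q / K r r)"
    and w_def: "w = (\<lambda>p. K p r / of_real (sqrt (Re (K r r))))"
  shows "\<exists>c. frm A K (\<lambda>p. if p = r then z p + c else z p) (\<lambda>p. if p = r then z p + c else z p) = frm A K' z z"
    and "p \<in> A \<Longrightarrow> K' p r = 0 \<and> K' r p = 0"
    and "p \<in> A \<Longrightarrow> q \<in> A \<Longrightarrow> K p q = K' p q + w p * cnj (w q)"
proof -
  let ?e = "\<lambda>i. if i = r then 1 else (0 :: complex)"
  have krr: "K r r = of_real (Re (K r r))" "0 \<le> Re (K r r)"
    using psdD[OF K, of ?e] frm_unit[OF fin r r, of K] by (simp_all add: complex_eq_iff)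
  show "K' p r = 0 \<and> K' r p = 0" if "p \<in> A"
    using psd_zero_row[OF K fin r that] by (auto simp: K'_def)
  show "K p q = K' p q + w p * cnj (w q)" if "p \<in> A" "q \<in> A"
  proof -
    have "w p * cnj (w q) = K p r * K r q / of_real (sqrt (Re (K r r)) * sqrt (Re (K r r)))"
      using psd_hermitian[OF K fin that(2) r] by (simp add: w_def del: real_sqrt_mult_self)
    moreover have "complex_of_real (sqrt (Re (K r r)) * sqrt (Re (K r r))) = K r r"
    proof -
      have "sqrt (Re (K r r)) * sqrt (Re (K r r)) = Re (K r r)" using krr(2) by simp
      then show ?thesis using krr(1)[symmetric] by (rule ssubst)
    qed
    ultimately show ?thesis by (simp add: K'_def del: of_real_mult)
  qed
  define S where "S = (\<Sum>q\<in>A. K r q * z q)"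
  \<comment> \<open>The minimiser of the form in the coordinate \<open>r\<close>.\<close>
  define c where "c = - S / K r r"
  have S2: "(\<Sum>p\<in>A. K p r * cnj (z p)) = cnj S"
    unfolding S_def cnj_sum
  proof (rule sum.cong[OF refl])
    fix p assume "p \<in> A"
    then have "K p r = cnj (K r p)" by (rule psd_hermitian[OF K fin r])
    then show "K p r * cnj (z p) = cnj (K r p * z p)" by simp
  qed
  have "frm A (\<lambda>p q. K p r * K r q / K r r) z z
      = (\<Sum>p\<in>A. \<Sum>q\<in>A. (K p r * cnj (z p)) * (K r q * z q)) / K r r"
    unfolding frm_def sum_divide_distrib by (intro sum.cong refl) simp
  also have "\<dots> = (\<Sum>p\<in>A. K p r * cnj (z p)) * (\<Sum>q\<in>A. K r q * z q) / K r r"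
    by (simp add: sum_product)
  also have "\<dots> = cnj S * S / K r r" by (simp add: S2 S_def)
  finally have E: "frm A (\<lambda>p q. K p r * K r q / K r r) z z = cnj S * S / K r r" .
  have "frm A K z z = frm A (\<lambda>p q. K' p q + K p r * K r q / K r r) z z"
    by (rule frm_cong) (simp_all add: K'_def)
  then have "frm A K' z z = frm A K z z - cnj S * S / K r r"
    unfolding frm_kernel_add E by simp
  moreover have "frm A K (\<lambda>p. z p + c * ?e p) (\<lambda>p. z p + c * ?e p) = frm A K z z - cnj S * S / K r r"
  proof -
    have "frm A K (\<lambda>p. z p + c * ?e p) (\<lambda>p. z p + c * ?e p)
        = frm A K z z + c * cnj S + cnj c * S + c * cnj c * K r r"
      unfolding frm_add_left frm_add_right frm_scale_left frm_scale_right
        frm_unit[OF fin r r] frm_unit_left[OF fin r] frm_unit_right[OF fin r] S2 S_def[symmetric]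
      by (simp add: algebra_simps)
    also have "\<dots> = frm A K z z - cnj S * S / K r r"
    proof (cases "K r r = 0")
      case True
      then have "S = 0" unfolding S_def using psd_zero_row[OF K fin r] by (intro sum.neutral) auto
      then show ?thesis by (simp add: c_def)
    next
      case False
      have "cnj (K r r) = K r r" using krr(1) by (metis complex_cnj_complex_of_real)
      then have "cnj c = - cnj S / K r r" by (simp add: c_def)
      then show ?thesis using False by (simp add: c_def field_simps)
    qed
    finally show ?thesis .
  qed
  moreover have "(\<lambda>p. z p + c * ?e p) = (\<lambda>p. if p = r then z p + c else z p)" by auto
  ultimately show "\<exists>c. frm A K (\<lambda>p. if p = r then z p + c else z p) (\<lambda>p. if p = r then z p + c else z p) = frm A K' z z"
    by auto
qed

text \<open>Partial Cholesky elimination: the remainder \<open>K'\<close> is the Schur complement of the block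
  indexed by \<open>B\<close>, characterised here as a minimum so that no inverses are needed.\<close>

lemma psd_eliminate:
  fixes K :: "'i \<Rightarrow> 'i \<Rightarrow> complex"
  assumes K: "psd A K" and fin: "finite A" and B: "B \<subseteq> A"
  shows "\<exists>K' w. psd A K' \<and> (\<forall>p\<in>B. \<forall>q\<in>A. K' p q = 0 \<and> K' q p = 0) \<and>
    (\<forall>p\<in>A. \<forall>q\<in>A. K p q = K' p q + (\<Sum>r\<in>B. w r p * cnj (w r q))) \<and>
    (\<forall>z. \<exists>z'. (\<forall>p. p \<notin> B \<longrightarrow> z' p = z p) \<and> frm A K z' z' = frm A K' z z)"
proof -
  have "finite B" using B fin finite_subset by blast
  then show ?thesis
    using B
  proof (induction B rule: finite_induct)
    case empty
    show ?case
    proof (rule exI[of _ K], rule exI[of _ "\<lambda>_ _. 0"], intro conjI)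
      show "\<forall>z. \<exists>z'. (\<forall>p. p \<notin> {} \<longrightarrow> z' p = z p) \<and> frm A K z' z' = frm A K z z"
      proof
        fix z show "\<exists>z'. (\<forall>p. p \<notin> {} \<longrightarrow> z' p = z p) \<and> frm A K z' z' = frm A K z z"
          by (rule exI[of _ z]) (intro conjI allI impI refl)
      qed
    qed (use K in simp_all)
  next
    case (insert r B)
    have "B \<subseteq> A" using insert.prems by simp
    from insert.IH[OF this] obtain K' w where IH: "psd A K'" "\<forall>p\<in>B. \<forall>q\<in>A. K' p q = 0 \<and> K' q p = 0"
      "\<forall>p\<in>A. \<forall>q\<in>A. K p q = K' p q + (\<Sum>r\<in>B. w r p * cnj (w r q))"
      "\<forall>z. \<exists>z'. (\<forall>p. p \<notin> B \<longrightarrow> z' p = z p) \<and> frm A K z' z' = frm A K' z z" by (elim exE conjE)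
    have r: "r \<in> A" using insert.prems by simp
    define K'' where "K'' = (\<lambda>p q. K' p q - K' p r * K' r q / K' r r)"
    define v where "v = (\<lambda>p. K' p r / of_real (sqrt (Re (K' r r))))"
    note one = psd_eliminate_one[OF IH(1) fin r K''_def v_def]
    have min: "\<exists>z'. (\<forall>p. p \<notin> insert r B \<longrightarrow> z' p = z p) \<and> frm A K z' z' = frm A K'' z z" for z
    proof -
      obtain c where c: "frm A K' (\<lambda>p. if p = r then z p + c else z p)
          (\<lambda>p. if p = r then z p + c else z p) = frm A K'' z z" using one(1)[of z] by (elim exE)
      obtain z' where z': "\<forall>p. p \<notin> B \<longrightarrow> z' p = (if p = r then z p + c else z p)"
        "frm A K z' z' = frm A K'' z z"
        using IH(4)[rule_format, of "\<lambda>p. if p = r then z p + c else z p"] unfolding c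
        by (elim exE conjE)
      show ?thesis by (intro exI[of _ z'] conjI z'(2)) (simp add: z'(1))
    qed
    have "psd A K''"
      unfolding psd_def
    proof
      fix z
      obtain z' where "frm A K z' z' = frm A K'' z z" using min[of z] by (elim exE conjE)
      moreover have "frm A K z' z' \<in> \<real>\<^sub>\<ge>\<^sub>0" using K by (simp add: psd_def)
      ultimately show "frm A K'' z z \<in> \<real>\<^sub>\<ge>\<^sub>0" by simp
    qed
    moreover have "\<forall>p\<in>insert r B. \<forall>q\<in>A. K'' p q = 0 \<and> K'' q p = 0"
    proof (intro ballI)
      fix p q assume p: "p \<in> insert r B" and q: "q \<in> A"
      show "K'' p q = 0 \<and> K'' q p = 0"
      proof (cases "p = r")
        case True
        then show ?thesis using one(2)[OF q] by simp
      next
        case False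
        then have "p \<in> B" using p by simp
        then show ?thesis using IH(2) q r by (simp add: K''_def)
      qed
    qed
    moreover have "\<forall>p\<in>A. \<forall>q\<in>A. K p q = K'' p q + (\<Sum>s\<in>insert r B. (w(r := v)) s p * cnj ((w(r := v)) s q))"
    proof (intro ballI)
      fix p q assume p: "p \<in> A" and q: "q \<in> A"
      have "(\<Sum>s\<in>B. (w(r := v)) s p * cnj ((w(r := v)) s q)) = (\<Sum>s\<in>B. w s p * cnj (w s q))"
        by (rule sum.cong[OF refl]) (use insert.hyps in auto)
      then show "K p q = K'' p q + (\<Sum>s\<in>insert r B. (w(r := v)) s p * cnj ((w(r := v)) s q))"
        using insert.hyps one(3)[OF p q] IH(3)[rule_format, OF p q] by (simp only: sum.insert) simp
    qed
    ultimately show ?case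
      using min by - (rule exI[of _ K''], rule exI[of _ "w(r := v)"], intro conjI allI)
  qed
qed

text \<open>Eliminating the whole index set leaves the remainder 0.\<close>

lemma psd_Gram:
  assumes "psd A K" "finite A"
  obtains w where "\<And>p q. p \<in> A \<Longrightarrow> q \<in> A \<Longrightarrow> K p q = (\<Sum>r\<in>A. w r p * cnj (w r q))"
proof -
  from psd_eliminate[OF assms order_refl] obtain K' w where
    "\<forall>p\<in>A. \<forall>q\<in>A. K' p q = 0 \<and> K' q p = 0"
    "\<forall>p\<in>A. \<forall>q\<in>A. K p q = K' p q + (\<Sum>r\<in>A. w r p * cnj (w r q))"
    by (elim exE conjE)
  then show ?thesis by (intro that[of w]) simp
qed

section \<open>Roots of unity, cluster points, linear dependence\<close>

definition wroot :: "nat \<Rightarrow> nat \<Rightarrow> complex" where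
  "wroot N j = cis (2 * pi * real j / real N)"

lemma norm_wroot [simp]: "cmod (wroot N j) = 1"
  by (simp add: wroot_def)

lemma wroot_orthogonal:
  assumes "a < N" "b < N"
  shows "(\<Sum>j<N. wroot N j ^ a * cnj (wroot N j) ^ b) = (if a = b then of_nat N else 0)"
proof -
  define z where "z = cis (2 * pi * (real a - real b) / real N)"
  have eq: "wroot N j ^ a * cnj (wroot N j) ^ b = z ^ j" for j
  proof -
    have "wroot N j ^ a * cnj (wroot N j) ^ b = cis (real a * (2 * pi * real j / N) + real b * - (2 * pi * real j / N))"
      by (simp only: wroot_def cis_cnj Complex.DeMoivre cis_mult)
    also have "real a * (2 * pi * real j / N) + real b * - (2 * pi * real j / N)
        = real j * (2 * pi * (real a - real b) / real N)"
      using assms by (simp add: field_simps)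
    finally show ?thesis by (simp only: z_def Complex.DeMoivre)
  qed
  show ?thesis
  proof (cases "a = b")
    case True
    then have "z = 1" by (simp add: z_def)
    then show ?thesis unfolding eq using True by simp
  next
    case False
    have "z \<noteq> 1"
    proof
      assume "z = 1"
      then have "cos (2 * pi * (real a - real b) / real N) = 1" by (simp add: z_def complex_eq_iff)
      then obtain i :: int where "2 * pi * (real a - real b) / real N = of_int i * 2 * pi"
        using cos_one_2pi_int by blast
      then have "(2 * pi) * ((real a - real b) / real N) = (2 * pi) * of_int i"
        by (simp add: mult.commute)
      then have "(real a - real b) / real N = of_int i"
        using pi_neq_zero by (simp only: mult_cancel_left) simp
      then have ab: "real a - real b = of_int i * real N"
        using assms by (simp add: field_simps)
      have "\<bar>real a - real b\<bar> < real N" using assms by linarith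
      then have "\<bar>of_int i :: real\<bar> < 1" using assms by (simp add: ab abs_mult)
      then have "i = 0" by linarith
      with ab False show False by simp
    qed
    moreover have "z ^ N = 1"
    proof -
      have "z ^ N = cis (real N * (2 * pi * (real a - real b) / real N))" by (simp only: z_def Complex.DeMoivre)
      also have "real N * (2 * pi * (real a - real b) / real N) = 2 * pi * of_int (int a - int b)"
        using assms by simp
      finally show ?thesis using cis_multiple_2pi[of "of_int (int a - int b)"] by simp
    qed
    ultimately show ?thesis using False by (simp add: eq geometric_sum)
  qed
qed

text \<open>Tychonoff's theorem replaces the passage to a subsequence, so the index set may be uncountable.\<close>

lemma bounded_family_cluster:
  fixes f :: "nat \<Rightarrow> 'i \<Rightarrow> complex"
  assumes "\<And>m i. cmod (f m i) \<le> B i"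
  obtains F L where "F \<noteq> bot" "F \<le> sequentially" "\<And>i. ((\<lambda>m. f m i) \<longlongrightarrow> L i) F"
proof -
  define C :: "('i \<Rightarrow> complex) set" where "C = PiE UNIV (\<lambda>i. cball 0 (B i))"
  have "compactin (product_topology (\<lambda>i::'i. euclidean :: complex topology) UNIV) C"
    unfolding C_def by (subst compactin_PiE) auto
  then have "compact C" by (simp add: euclidean_product_topology)
  moreover have "eventually (\<lambda>g. g \<in> C) (filtermap f sequentially)"
    using assms by (simp add: eventually_filtermap C_def PiE_iff)
  moreover have "filtermap f sequentially \<noteq> bot" by (simp add: filtermap_bot_iff)
  ultimately obtain L where L: "inf (nhds L) (filtermap f sequentially) \<noteq> bot"
    unfolding compact_filter by blast
  \<comment> \<open>The trace on the indices of the neighbourhoods of the cluster point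
    \<open>L\<close>. Along it \<open>f\<close> converges to \<open>L\<close> by construction, and
    it is a proper filter because \<open>L\<close> is a cluster point.\<close>
  define F where "F = inf sequentially (filtercomap f (nhds L))"
  have "F \<noteq> bot"
  proof
    assume "F = bot"
    then have "eventually (\<lambda>_. False) F" by simp
    then obtain P Q where P: "eventually P sequentially" and Q: "eventually Q (filtercomap f (nhds L))"
      and PQ: "\<forall>m. P m \<and> Q m \<longrightarrow> False"
      unfolding F_def eventually_inf by auto
    from Q obtain R where R: "eventually R (nhds L)" "\<forall>m. R (f m) \<longrightarrow> Q m"
      unfolding eventually_filtercomap by blast
    have "eventually (\<lambda>g. \<not> R g) (filtermap f sequentially)"
      unfolding eventually_filtermap using P by eventually_elim (use PQ R in blast)
    with R(1) have "eventually (\<lambda>_. False) (inf (nhds L) (filtermap f sequentially))"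
      unfolding eventually_inf by blast
    with L show False by (simp add: trivial_limit_def)
  qed
  moreover have "F \<le> sequentially" by (simp add: F_def)
  moreover have "((\<lambda>m. f m i) \<longlongrightarrow> L i) F" for i
  proof -
    have L: "filterlim f (nhds L) F"
      unfolding F_def by (rule filterlim_mono[OF filterlim_filtercomap]) auto
    have "open ((\<lambda>g :: 'i \<Rightarrow> complex. g i) -` S)" if "open S" for S
      using that by (intro open_vimage continuous_on_product_coordinates)
    then show ?thesis
      using topological_tendstoD[OF L] by (intro topological_tendstoI) force
  qed
  ultimately show ?thesis using that by blast
qed

lemma linear_dependence:
  fixes f :: "'j \<Rightarrow> 'i \<Rightarrow> real"
  assumes "finite I" "finite J" "card I < card J"
  shows "\<exists>c. (\<exists>j\<in>J. c j \<noteq> 0) \<and> (\<forall>i\<in>I. (\<Sum>j\<in>J. c j * f j i) = 0)"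
  using assms
proof (induction I arbitrary: J f rule: finite_induct)
  case empty
  then have "J \<noteq> {}" by auto
  then show ?case by (intro exI[of _ "\<lambda>_. 1"]) auto
next
  case (insert i I)
  show ?case
  proof (cases "\<forall>j\<in>J. f j i = 0")
    case True
    have "card I < card J" using insert by simp
    then obtain c where "\<exists>j\<in>J. c j \<noteq> 0" "\<forall>i\<in>I. (\<Sum>j\<in>J. c j * f j i) = 0"
      using insert.IH[of J f] insert.prems by auto
    with True show ?thesis by (intro exI[of _ c]) simp
  next
    case False
    then obtain k where k: "k \<in> J" "f k i \<noteq> 0" by auto
    \<comment> \<open>Gaussian elimination of the coordinate \<open>i\<close> with pivot
      \<open>f k i\<close>; the coefficient at \<open>k\<close> in \<open>c'\<close> is then
      forced.\<close>
    define g where "g j i' = f j i' - f j i / f k i * f k i'" for j i'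
    have "card I < card (J - {k})" using insert k by simp
    then obtain c where c: "\<exists>j\<in>J-{k}. c j \<noteq> 0" "\<forall>i'\<in>I. (\<Sum>j\<in>J-{k}. c j * g j i') = 0"
      using insert.IH[of "J - {k}" g] insert.prems by auto
    define c' where "c' j = (if j = k then - (\<Sum>j\<in>J-{k}. c j * (f j i / f k i)) else c j)" for j
    have sum: "(\<Sum>j\<in>J. c' j * f j i') = (\<Sum>j\<in>J-{k}. c j * g j i')" for i'
    proof -
      have "(\<Sum>j\<in>J. c' j * f j i') = c' k * f k i' + (\<Sum>j\<in>J-{k}. c' j * f j i')"
        using k insert.prems by (simp add: sum.remove)
      also have "(\<Sum>j\<in>J-{k}. c' j * f j i') = (\<Sum>j\<in>J-{k}. c j * f j i')"
        by (rule sum.cong) (auto simp: c'_def)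
      also have "c' k * f k i' = - (\<Sum>j\<in>J-{k}. c j * (f j i / f k i) * f k i')"
        by (simp add: c'_def sum_distrib_right)
      finally show ?thesis
        by (simp add: g_def sum_subtractf right_diff_distrib mult.assoc)
    qed
    have "(\<Sum>j\<in>J. c' j * f j i) = 0" using k by (simp add: sum g_def)
    moreover have "\<exists>j\<in>J. c' j \<noteq> 0" using c(1) by (auto simp: c'_def)
    ultimately show ?thesis using c(2) sum by auto
  qed
qed

section \<open>Minimal convex combinations\<close>

abbreviation unitk :: "'i \<Rightarrow> 'i \<Rightarrow> complex" where
  "unitk \<equiv> (\<lambda>i j. if i = j then 1 else 0)"

definition kmin :: "nat \<Rightarrow> complex set \<Rightarrow> (nat \<Rightarrow> nat \<Rightarrow> complex) \<Rightarrow> bool" where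
  "kmin n K a \<longleftrightarrow> (\<exists>(J :: nat set) h l. finite J \<and> (\<forall>j\<in>J. psd {..<n} (h j) \<and> l j \<in> K) \<and>
    (\<forall>i<n. \<forall>k<n. (\<Sum>j\<in>J. h j i k) = unitk i k \<and> (\<Sum>j\<in>J. l j * h j i k) = a i k))"

lemma frm_tendsto:
  assumes "\<And>i j. i \<in> A \<Longrightarrow> j \<in> A \<Longrightarrow> ((\<lambda>m. K m i j) \<longlongrightarrow> L i j) F"
  shows "((\<lambda>m. frm A (K m) x y) \<longlongrightarrow> frm A L x y) F"
  unfolding frm_def by (intro tendsto_sum tendsto_mult tendsto_const assms)

lemma psd_tendsto:
  assumes "\<And>i j. i \<in> A \<Longrightarrow> j \<in> A \<Longrightarrow> ((\<lambda>m. K m i j) \<longlongrightarrow> L i j) F" "F \<noteq> bot" "\<And>m. psd A (K m)"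
  shows "psd A L"
  unfolding psd_def
proof
  fix x
  show "frm A L x x \<in> \<real>\<^sub>\<ge>\<^sub>0"
    by (rule Lim_in_closed_set[OF closed_nonneg_Reals_complex _ assms(2) frm_tendsto[OF assms(1)]])
      (use assms(3) in \<open>auto simp: psd_def\<close>)
qed

text \<open>Caratheodory's argument: a linear dependence among the weighted terms lets one term be removed.\<close>

lemma kmin_card_le:
  assumes "kmin n K a"
  obtains J :: "nat set" and h l where "finite J" "card J \<le> 4 * n * n"
    "\<And>j. j \<in> J \<Longrightarrow> psd {..<n} (h j)" "\<And>j. j \<in> J \<Longrightarrow> l j \<in> K"
    "\<And>i k. i < n \<Longrightarrow> k < n \<Longrightarrow> (\<Sum>j\<in>J. h j i k) = unitk i k"
    "\<And>i k. i < n \<Longrightarrow> k < n \<Longrightarrow> (\<Sum>j\<in>J. l j * h j i k) = a i k"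
proof -
  define P where "P = (\<lambda>(J :: nat set, h, l). finite J \<and> (\<forall>j\<in>J. psd {..<n} (h j) \<and> l j \<in> K) \<and>
    (\<forall>i<n. \<forall>k<n. (\<Sum>j\<in>J. h j i k) = unitk i k \<and> (\<Sum>j\<in>J. l j * h j i k) = a i k))"
  obtain x0 where "P x0" using assms unfolding kmin_def P_def by auto
  then obtain x where x: "P x" "\<And>y. P y \<Longrightarrow> card (fst x) \<le> card (fst y)"
    using ex_has_least_nat[of P x0 "\<lambda>y. card (fst y)"] by blast
  obtain J h l where xJ: "x = (J, h, l)" by (cases x)
  have J: "finite J" "\<And>j. j \<in> J \<Longrightarrow> psd {..<n} (h j)" "\<And>j. j \<in> J \<Longrightarrow> l j \<in> K"
    "\<And>i k. i < n \<Longrightarrow> k < n \<Longrightarrow> (\<Sum>j\<in>J. h j i k) = unitk i k"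
    "\<And>i k. i < n \<Longrightarrow> k < n \<Longrightarrow> (\<Sum>j\<in>J. l j * h j i k) = a i k"
    using x(1) unfolding P_def xJ by auto
  have "card J \<le> 4 * n * n"
  proof (rule ccontr)
    assume "\<not> card J \<le> 4 * n * n"
    \<comment> \<open>The coordinates are the real and imaginary parts of the entries of
      \<open>h j\<close> and of \<open>l j * h j\<close>, which is where the bound
      \<open>4 * n * n\<close> comes from.\<close>
    define I where "I = {..<n} \<times> {..<n} \<times> {..<4::nat}"
    define f where "f j t = (case t of (i, k, b :: nat) \<Rightarrow> if b = 0 then Re (h j i k) else if b = 1 then Im (h j i k)
      else if b = 2 then Re (l j * h j i k) else Im (l j * h j i k))" for j t
    have "finite I" by (simp add: I_def)
    moreover have "card I < card J"
      using \<open>\<not> card J \<le> 4 * n * n\<close> by (simp add: I_def card_cartesian_product)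
    ultimately obtain c0 where c0: "\<exists>j\<in>J. c0 j \<noteq> 0" "\<forall>t\<in>I. (\<Sum>j\<in>J. c0 j * f j t) = 0"
      using linear_dependence[of I J f] J(1) by blast
    obtain c where c: "\<exists>j\<in>J. c j > 0" "\<And>t. t \<in> I \<Longrightarrow> (\<Sum>j\<in>J. c j * f j t) = 0"
    proof (cases "\<exists>j\<in>J. c0 j > 0")
      case True
      then show ?thesis using that[of c0] c0 by blast
    next
      case False
      then have "\<exists>j\<in>J. - c0 j > 0" using c0(1) by force
      moreover have "(\<Sum>j\<in>J. - c0 j * f j t) = 0" if "t \<in> I" for t
        using c0(2) that by (simp add: sum_negf)
      ultimately show ?thesis using that[of "\<lambda>j. - c0 j"] by blast
    qed
    \<comment> \<open>Subtracting the dependence divided by its largest coefficient keeps every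
      factor \<open>1 - c j / M\<close> nonnegative and annihilates the term at which the maximum is
      attained.\<close>
    define M where "M = Max (c ` J)"
    have "c ` J \<noteq> {}" "finite (c ` J)" using c(1) J(1) by auto
    then have "M \<in> c ` J" unfolding M_def by (intro Max_in)
    then obtain j0 where j0: "j0 \<in> J" "c j0 = M" by auto
    have cM: "c j \<le> M" if "j \<in> J" for j unfolding M_def using that J(1) by simp
    have M: "0 < M" using c(1) cM by force
    have z: "(\<Sum>j\<in>J. of_real (c j) * h j i k) = 0" "(\<Sum>j\<in>J. of_real (c j) * (l j * h j i k)) = 0"
      if "i < n" "k < n" for i k
      using c(2)[of "(i, k, 0)"] c(2)[of "(i, k, 1)"] c(2)[of "(i, k, 2)"] c(2)[of "(i, k, 3)"] that
      by (simp_all add: I_def f_def complex_eq_iff sum_distrib_left)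
    define h' where "h' j = (\<lambda>i k. of_real (1 - c j / M) * h j i k)" for j
    have h'0: "h' j0 i k = 0" for i k using M j0 by (simp add: h'_def)
    have "P (J - {j0}, h', l)"
      unfolding P_def prod.case
    proof (intro conjI ballI allI impI)
      show "finite (J - {j0})" using J(1) by simp
      fix j assume j: "j \<in> J - {j0}"
      then show "l j \<in> K" using J(3) by simp
      have "0 \<le> 1 - c j / M" using cM[of j] j M by simp
      then show "psd {..<n} (h' j)" unfolding h'_def using J(2) j by (intro psd_scale) auto
    next
      fix i k assume ik: "i < n" "k < n"
      have "(\<Sum>j\<in>J - {j0}. h' j i k) = (\<Sum>j\<in>J. h' j i k)"
        using J(1) j0 h'0 by (simp add: sum_diff1)
      also have "\<dots> = (\<Sum>j\<in>J. h j i k) - (\<Sum>j\<in>J. of_real (c j) * h j i k) / of_real M"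
        by (simp add: h'_def left_diff_distrib sum_subtractf sum_divide_distrib)
      finally show "(\<Sum>j\<in>J - {j0}. h' j i k) = unitk i k" using z[OF ik] J(4)[OF ik] by simp
      have "(\<Sum>j\<in>J - {j0}. l j * h' j i k) = (\<Sum>j\<in>J. l j * h' j i k)"
        using J(1) j0 h'0 by (simp add: sum_diff1)
      also have "\<dots> = (\<Sum>j\<in>J. l j * h j i k) - (\<Sum>j\<in>J. of_real (c j) * (l j * h j i k)) / of_real M"
        by (simp add: h'_def algebra_simps sum_subtractf sum_divide_distrib)
      finally show "(\<Sum>j\<in>J - {j0}. l j * h' j i k) = a i k" using z[OF ik] J(5)[OF ik] by simp
    qed
    from x(2)[OF this] have "card J \<le> card (J - {j0})" by (simp add: xJ)
    then show False using j0 J(1) by (metis card_Diff1_less not_le)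
  qed
  with J show ?thesis using that by blast
qed

text \<open>All decompositions get the same length, so that a sequence of them can converge term by
  term. A padding term has weight 0 but still carries a value in \<open>K\<close>, hence the
  hypothesis that \<open>K\<close> is nonempty.\<close>

lemma kmin_padded:
  assumes "kmin n K a" "K \<noteq> {}"
  obtains h l where
    "\<And>j. psd {..<n} (h j)" "\<And>j. l j \<in> K"
    "\<And>i k. i < n \<Longrightarrow> k < n \<Longrightarrow> (\<Sum>j<4 * n * n. h j i k) = unitk i k"
    "\<And>i k. i < n \<Longrightarrow> k < n \<Longrightarrow> (\<Sum>j<4 * n * n. l j * h j i k) = a i k"
proof -
  obtain J h l where J: "finite (J :: nat set)" "card J \<le> 4 * n * n"
    "\<And>j. j \<in> J \<Longrightarrow> psd {..<n} (h j)" "\<And>j. j \<in> J \<Longrightarrow> l j \<in> K"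
    "\<And>i k. i < n \<Longrightarrow> k < n \<Longrightarrow> (\<Sum>j\<in>J. h j i k) = unitk i k"
    "\<And>i k. i < n \<Longrightarrow> k < n \<Longrightarrow> (\<Sum>j\<in>J. l j * h j i k) = a i k"
    by (rule kmin_card_le[OF assms(1)]) (rule that)
  obtain z where z: "z \<in> K" using assms(2) by blast
  obtain f where f: "bij_betw f {..<card J} J"
    using ex_bij_betw_nat_finite[OF J(1)] by (auto simp: atLeast0LessThan)
  then have fJ: "f j \<in> J" if "j < card J" for j using that by (auto dest: bij_betwE)
  define h' where "h' j = (if j < card J then h (f j) else (\<lambda>_ _. 0))" for j
  define l' where "l' j = (if j < card J then l (f j) else z)" for j
  have sum: "(\<Sum>j<4 * n * n. g j * h' j i k) = (\<Sum>j<card J. g j * h (f j) i k)" for g i k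
    using J(2) by (intro sum.mono_neutral_cong_right) (auto simp: h'_def)
  show ?thesis
  proof (rule that[of h' l'])
    show "psd {..<n} (h' j)" for j using J(3) fJ by (simp add: h'_def psd_def frm_def)
    show "l' j \<in> K" for j using J(4) fJ z by (simp add: l'_def)
    fix i k assume ik: "i < n" "k < n"
    show "(\<Sum>j<4 * n * n. h' j i k) = unitk i k"
      using sum[of "\<lambda>_. 1" i k] sum.reindex_bij_betw[OF f, of "\<lambda>j. h j i k"] J(5)[OF ik] by simp
    have "(\<Sum>j<4 * n * n. l' j * h' j i k) = (\<Sum>j<card J. l (f j) * h (f j) i k)"
      unfolding sum by (rule sum.cong) (auto simp: l'_def)
    then show "(\<Sum>j<4 * n * n. l' j * h' j i k) = a i k"
      using sum.reindex_bij_betw[OF f, of "\<lambda>j. l j * h j i k"] J(6)[OF ik] by simp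
  qed
qed

text \<open>Nearby matrices have decompositions of a common length. Their weights are positive and
  add up to the unit, so their entries are bounded by 1, and their values stay in the compact
  \<open>K\<close>; a cluster point decomposes \<open>a\<close>.\<close>

lemma kmin_limit:
  assumes K: "compact K" "K \<noteq> {}"
    and lim: "\<And>e. 0 < e \<Longrightarrow> \<exists>a'. kmin n K a' \<and> (\<forall>i<n. \<forall>k<n. cmod (a' i k - a i k) \<le> e)"
  shows "kmin n K a"
proof -
  define D where "D = 4 * n * n"
  have "\<exists>a'. kmin n K a' \<and> (\<forall>i<n. \<forall>k<n. cmod (a' i k - a i k) \<le> 1 / Suc m)" for m
    using lim[of "1 / Suc m"] by simp
  then obtain a' where a': "\<And>m. kmin n K (a' m)"
    "\<And>m i k. i < n \<Longrightarrow> k < n \<Longrightarrow> cmod (a' m i k - a i k) \<le> 1 / Suc m" by metis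
  define Q where "Q m x \<longleftrightarrow> (\<forall>j. psd {..<n} (fst x j)) \<and> (\<forall>j. snd x j \<in> K) \<and>
    (\<forall>i<n. \<forall>k<n. (\<Sum>j<D. fst x j i k) = unitk i k \<and> (\<Sum>j<D. snd x j * fst x j i k) = a' m i k)" for m x
  have "\<exists>x. Q m x" for m
  proof -
    obtain h l where "\<And>j. psd {..<n} (h j)" "\<And>j. l j \<in> K"
      "\<And>i k. i < n \<Longrightarrow> k < n \<Longrightarrow> (\<Sum>j<D. h j i k) = unitk i k"
      "\<And>i k. i < n \<Longrightarrow> k < n \<Longrightarrow> (\<Sum>j<D. l j * h j i k) = a' m i k"
      by (rule kmin_padded[OF a'(1)[of m] K(2), folded D_def]) (rule that)
    then show ?thesis by (intro exI[of _ "(h, l)"]) (simp add: Q_def)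
  qed
  then obtain X where X: "\<And>m. Q m (X m)" using choice[of Q] by blast
  define h where "h m = fst (X m)" for m
  define l where "l m = snd (X m)" for m
  have h: "psd {..<n} (h m j)" and l: "l m j \<in> K"
    and hl: "\<forall>i<n. \<forall>k<n. (\<Sum>j<D. h m j i k) = unitk i k \<and> (\<Sum>j<D. l m j * h m j i k) = a' m i k" for m j
    using X[of m] by (simp_all add: Q_def h_def l_def)
  obtain B where B: "\<And>z. z \<in> K \<Longrightarrow> cmod z \<le> B" using compact_imp_bounded[OF K(1)] by (auto simp: bounded_iff)
  have diag: "0 \<le> Re (h m j i i)" if "i < n" for m j i
    using psdD(1)[OF h, where x = "\<lambda>k. if k = i then 1 else 0"] that by (simp add: frm_unit)
  have diag1: "Re (h m j i i) \<le> 1" if "i < n" "j < D" for m j i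
  proof -
    have "Re (h m j i i) \<le> (\<Sum>j<D. Re (h m j i i))"
      using that diag by (intro member_le_sum) auto
    also have "\<dots> = Re (\<Sum>j<D. h m j i i)" by simp
    also have "\<dots> = 1" using hl[of m] that by simp
    finally show ?thesis .
  qed
  have hb: "cmod (h m j i k) \<le> 1" if "i < n" "k < n" "j < D" for m j i k
    using psd_entry_bound[OF h[of m j], of i k] diag1[of i j m] diag1[of k j m] that by simp
  \<comment> \<open>Weights and values are packed into one bounded family, so that a single filter
    makes all of them converge.\<close>
  define f where "f m t = (case t of Inl (j, i, k) \<Rightarrow> if j < D \<and> i < n \<and> k < n then h m j i k else 0
    | Inr j \<Rightarrow> l m j)" for m t
  have "cmod (f m t) \<le> (case t of Inl _ \<Rightarrow> 1 | Inr _ \<Rightarrow> B)" for m t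
    using hb B l by (auto simp: f_def split: sum.splits)
  then obtain F L where F: "F \<noteq> bot" "F \<le> sequentially" "\<And>t. ((\<lambda>m. f m t) \<longlongrightarrow> L t) F"
    by (rule bounded_family_cluster[of f]) (rule that)
  define h0 where "h0 j i k = L (Inl (j, i, k))" for j i k
  define l0 where "l0 j = L (Inr j)" for j
  have h0: "((\<lambda>m. h m j i k) \<longlongrightarrow> h0 j i k) F" if "j < D" "i < n" "k < n" for j i k
    using F(3)[of "Inl (j, i, k)"] that by (simp add: f_def h0_def)
  have l0: "((\<lambda>m. l m j) \<longlongrightarrow> l0 j) F" for j
    using F(3)[of "Inr j"] by (simp add: f_def l0_def)
  have "kmin n K a"
    unfolding kmin_def
  proof (intro exI[of _ "{..<D}"] exI[of _ h0] exI[of _ l0] conjI ballI allI impI)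
    fix j assume j: "j \<in> {..<D}"
    show "psd {..<n} (h0 j)" by (rule psd_tendsto[OF _ F(1), where K = "\<lambda>m. h m j"]) (use h0 j h in auto)
    show "l0 j \<in> K"
      by (rule Lim_in_closed_set[OF compact_imp_closed[OF K(1)] _ F(1) l0]) (simp add: l)
  next
    fix i k assume ik: "i < n" "k < n"
    have "((\<lambda>m. \<Sum>j<D. h m j i k) \<longlongrightarrow> (\<Sum>j<D. h0 j i k)) F"
      by (intro tendsto_sum h0) (use ik in auto)
    then show "(\<Sum>j<D. h0 j i k) = unitk i k"
      using hl ik by (auto dest: tendsto_unique[OF F(1) tendsto_const])
    have "((\<lambda>m. \<Sum>j<D. l m j * h m j i k) \<longlongrightarrow> (\<Sum>j<D. l0 j * h0 j i k)) F"
      by (intro tendsto_sum tendsto_mult h0 l0) (use ik in auto)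
    moreover have "(\<Sum>j<D. l m j * h m j i k) = a' m i k" for m using hl ik by auto
    ultimately have 1: "((\<lambda>m. a' m i k) \<longlongrightarrow> (\<Sum>j<D. l0 j * h0 j i k)) F" by simp
    have "(\<lambda>m. a' m i k - a i k) \<longlonglongrightarrow> 0"
    proof (rule Lim_null_comparison)
      show "\<forall>\<^sub>F m in sequentially. norm (a' m i k - a i k) \<le> 1 / Suc m" using a'(2)[OF ik] by simp
      show "(\<lambda>m. 1 / real (Suc m)) \<longlonglongrightarrow> 0" using LIMSEQ_inverse_real_of_nat by (simp add: inverse_eq_divide)
    qed
    then have "(\<lambda>m. a' m i k) \<longlonglongrightarrow> a i k" by (simp add: LIM_zero_iff)
    then have "((\<lambda>m. a' m i k) \<longlongrightarrow> a i k) F" using F(2) tendsto_mono by blast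
    with 1 show "(\<Sum>j<D. l0 j * h0 j i k) = a i k" using tendsto_unique[OF F(1)] by blast
  qed simp
  then show ?thesis .
qed

text \<open>A test \<open>(p, q)\<close> requires \<open>p a + cnj q a\<^sup>*\<close> to be a contraction; the inequality below says
  so without mentioning the adjoint.\<close>

definition passes_mat :: "(complex \<times> complex) set \<Rightarrow> nat \<Rightarrow> (nat \<Rightarrow> nat \<Rightarrow> complex) \<Rightarrow> bool" where
  "passes_mat T n a \<longleftrightarrow> (\<forall>(p, q)\<in>T. \<forall>x y. 0 \<le> Re (frm {..<n} unitk x x) + Re (frm {..<n} unitk y y)
    + 2 * Re (p * frm {..<n} a x y + q * frm {..<n} a y x))"

lemma frm_sum_left: "frm A K (\<lambda>i. \<Sum>k\<in>S. x k i) y = (\<Sum>k\<in>S. frm A K (x k) y)"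
proof (induction S rule: infinite_finite_induct)
  case (insert k S)
  then show ?case using frm_add_left[of A K "x k"] by simp
qed (simp_all add: frm_def)

lemma frm_sum_right: "frm A K x (\<lambda>i. \<Sum>k\<in>S. y k i) = (\<Sum>k\<in>S. frm A K x (y k))"
proof (induction S rule: infinite_finite_induct)
  case (insert k S)
  then show ?case using frm_add_right[of A K x "y k"] by simp
qed (simp_all add: frm_def)

lemma frm_double_sum:
  "frm A K (\<lambda>i. \<Sum>k\<in>S. c k * x k i) (\<lambda>i. \<Sum>l\<in>T. d l * y l i)
    = (\<Sum>k\<in>S. \<Sum>l\<in>T. c k * cnj (d l) * frm A K (x k) (y l))"
  by (simp add: frm_sum_left frm_sum_right frm_scale_left frm_scale_right sum_distrib_left ac_simps)

lemma sum_wroot_double: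
  assumes "\<And>k. k < m \<Longrightarrow> \<alpha> k < N" "\<And>k. k < m \<Longrightarrow> \<beta> k < N"
  shows "(\<Sum>j<N. \<Sum>k<m. \<Sum>l<m. wroot N j ^ \<alpha> k * cnj (wroot N j) ^ \<beta> l * g k l)
    = of_nat N * (\<Sum>k<m. \<Sum>l<m. if \<alpha> k = \<beta> l then g k l else 0)"
proof -
  have "(\<Sum>j<N. \<Sum>k<m. \<Sum>l<m. wroot N j ^ \<alpha> k * cnj (wroot N j) ^ \<beta> l * g k l)
      = (\<Sum>k<m. \<Sum>j<N. \<Sum>l<m. wroot N j ^ \<alpha> k * cnj (wroot N j) ^ \<beta> l * g k l)"
    by (rule sum.swap)
  also have "\<dots> = (\<Sum>k<m. \<Sum>l<m. \<Sum>j<N. wroot N j ^ \<alpha> k * cnj (wroot N j) ^ \<beta> l * g k l)"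
    by (intro sum.cong refl sum.swap)
  also have "\<dots> = (\<Sum>k<m. \<Sum>l<m. of_nat N * (if \<alpha> k = \<beta> l then g k l else 0))"
  proof (intro sum.cong refl)
    fix k l assume "k \<in> {..<m}" "l \<in> {..<m}"
    then have "(\<Sum>j<N. wroot N j ^ \<alpha> k * cnj (wroot N j) ^ \<beta> l) = (if \<alpha> k = \<beta> l then of_nat N else 0)"
      using assms by (intro wroot_orthogonal) auto
    then show "(\<Sum>j<N. wroot N j ^ \<alpha> k * cnj (wroot N j) ^ \<beta> l * g k l) = of_nat N * (if \<alpha> k = \<beta> l then g k l else 0)"
      by (simp flip: sum_distrib_right)
  qed
  also have "\<dots> = of_nat N * (\<Sum>k<m. \<Sum>l<m. if \<alpha> k = \<beta> l then g k l else 0)"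
    by (simp add: sum_distrib_left)
  finally show ?thesis .
qed

text \<open>Fourier series turn the condition that \<open>u + \<omega> v\<close> is a contraction for all unimodular
  \<open>\<omega>\<close> into positivity of \<open>1 + J\<close>, where \<open>J\<close> is the Jacobi matrix with off-diagonal entries
  \<open>u, v, u, v, \<dots>\<close>.\<close>

lemma alternating_chain_nonneg:
  fixes a b :: "nat \<Rightarrow> nat \<Rightarrow> complex"
  assumes uv: "\<And>\<omega> x y. cmod \<omega> = 1 \<Longrightarrow>
    0 \<le> Re (frm A I x x) + Re (frm A I y y) + 2 * Re (frm A u x y + \<omega> * frm A v x y)"
  shows "0 \<le> (\<Sum>k<m. Re (frm A I (a k) (a k)) + Re (frm A I (b k) (b k)))
    + 2 * (\<Sum>k<m. Re (frm A u (a k) (b k))) + 2 * (\<Sum>k<m-1. Re (frm A v (a (Suc k)) (b k)))"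
proof -
  \<comment> \<open>One root more than there are terms: the factor \<open>w j\<close> raises
    exponents up to \<open>m\<close>, and orthogonality requires them to stay below
    \<open>N\<close>.\<close>
  define N where "N = Suc m"
  define w where "w = wroot N"
  have w: "cmod (w j) = 1" for j by (simp add: w_def)
  \<comment> \<open>\<open>e\<close> and \<open>f\<close> are trigonometric polynomials with vector
    coefficients. Averaging over the roots pairs \<open>a k\<close> with \<open>b k\<close> in the
    plain form, and \<open>a (Suc k)\<close> with \<open>b k\<close> in the form multiplied by
    \<open>w j\<close>.\<close>
  define e where "e j = (\<lambda>i. \<Sum>k<m. cnj (w j) ^ k * a k i)" for j
  define f where "f j = (\<lambda>i. \<Sum>k<m. cnj (w j) ^ k * b k i)" for j
  have form: "frm A K (e j) (e j) = (\<Sum>k<m. \<Sum>l<m. w j ^ l * cnj (w j) ^ k * frm A K (a k) (a l))"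
    "frm A K (f j) (f j) = (\<Sum>k<m. \<Sum>l<m. w j ^ l * cnj (w j) ^ k * frm A K (b k) (b l))"
    "frm A K (e j) (f j) = (\<Sum>k<m. \<Sum>l<m. w j ^ l * cnj (w j) ^ k * frm A K (a k) (b l))" for K j
    unfolding e_def f_def frm_double_sum by (simp_all add: ac_simps)
  have sw: "(\<Sum>j<N. \<Sum>k<m. \<Sum>l<m. w j ^ l * cnj (w j) ^ k * g k l) = of_nat N * (\<Sum>k<m. g k k)" for g
  proof -
    have "(\<Sum>j<N. \<Sum>k<m. \<Sum>l<m. w j ^ l * cnj (w j) ^ k * g k l)
        = (\<Sum>j<N. \<Sum>l<m. \<Sum>k<m. w j ^ l * cnj (w j) ^ k * g k l)"
      by (intro sum.cong refl sum.swap)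
    also have "\<dots> = of_nat N * (\<Sum>l<m. \<Sum>k<m. if l = k then g k l else 0)"
      unfolding w_def by (rule sum_wroot_double) (auto simp: N_def)
    finally show ?thesis by simp
  qed
  have sv: "(\<Sum>j<N. w j * (\<Sum>k<m. \<Sum>l<m. w j ^ l * cnj (w j) ^ k * g k l)) = of_nat N * (\<Sum>l<m-1. g (Suc l) l)" for g
  proof -
    have "(\<Sum>j<N. w j * (\<Sum>k<m. \<Sum>l<m. w j ^ l * cnj (w j) ^ k * g k l))
        = (\<Sum>j<N. \<Sum>k<m. \<Sum>l<m. w j ^ Suc l * cnj (w j) ^ k * g k l)"
      by (simp add: sum_distrib_left mult.assoc)
    also have "\<dots> = (\<Sum>j<N. \<Sum>l<m. \<Sum>k<m. w j ^ Suc l * cnj (w j) ^ k * g k l)"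
      by (intro sum.cong refl sum.swap)
    also have "\<dots> = of_nat N * (\<Sum>l<m. \<Sum>k<m. if Suc l = k then g k l else 0)"
      unfolding w_def by (rule sum_wroot_double) (auto simp: N_def)
    also have "(\<Sum>l<m. \<Sum>k<m. if Suc l = k then g k l else 0) = (\<Sum>l<m. if l < m - 1 then g (Suc l) l else 0)"
      by (rule sum.cong) auto
    also have "\<dots> = (\<Sum>l<m-1. g (Suc l) l)"
      by (rule sum.mono_neutral_cong_right) auto
    finally show ?thesis .
  qed
  have "0 \<le> (\<Sum>j<N. Re (frm A I (e j) (e j)) + Re (frm A I (f j) (f j))
      + 2 * Re (frm A u (e j) (f j) + w j * frm A v (e j) (f j)))"
    by (intro sum_nonneg uv w)
  also have "\<dots> = Re ((\<Sum>j<N. frm A I (e j) (e j)) + (\<Sum>j<N. frm A I (f j) (f j))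
      + 2 * ((\<Sum>j<N. frm A u (e j) (f j)) + (\<Sum>j<N. w j * frm A v (e j) (f j))))"
    by (simp add: sum.distrib sum_distrib_left)
  also have "\<dots> = real N * ((\<Sum>k<m. Re (frm A I (a k) (a k)) + Re (frm A I (b k) (b k)))
    + 2 * (\<Sum>k<m. Re (frm A u (a k) (b k))) + 2 * (\<Sum>k<m-1. Re (frm A v (a (Suc k)) (b k))))"
    unfolding form sw sv by (simp add: sum.distrib algebra_simps)
  finally show ?thesis by (simp add: N_def zero_le_mult_iff)
qed

section \<open>Chains of Schur complements\<close>

definition blk :: "('i \<Rightarrow> 'i \<Rightarrow> complex) \<Rightarrow> ('i \<Rightarrow> 'i \<Rightarrow> complex) \<Rightarrow> ('i \<Rightarrow> 'i \<Rightarrow> complex)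
    \<Rightarrow> 'i + 'i \<Rightarrow> 'i + 'i \<Rightarrow> complex" where
  "blk P w C s t = (case s of Inl i \<Rightarrow> (case t of Inl j \<Rightarrow> P i j | Inr j \<Rightarrow> w i j)
    | Inr i \<Rightarrow> (case t of Inl j \<Rightarrow> cnj (w j i) | Inr j \<Rightarrow> C i j))"

lemma blk_simps [simp]:
  "blk P w C (Inl i) (Inl j) = P i j" "blk P w C (Inl i) (Inr j) = w i j"
  "blk P w C (Inr i) (Inl j) = cnj (w j i)" "blk P w C (Inr i) (Inr j) = C i j"
  by (simp_all add: blk_def)

lemma frm_Plus:
  assumes "finite A"
  shows "frm (A <+> A) K z z =
    frm A (\<lambda>i j. K (Inl i) (Inl j)) (z \<circ> Inl) (z \<circ> Inl) + frm A (\<lambda>i j. K (Inl i) (Inr j)) (z \<circ> Inr) (z \<circ> Inl)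
    + frm A (\<lambda>i j. K (Inr i) (Inl j)) (z \<circ> Inl) (z \<circ> Inr) + frm A (\<lambda>i j. K (Inr i) (Inr j)) (z \<circ> Inr) (z \<circ> Inr)"
  unfolding frm_def by (simp add: sum.Plus assms sum.distrib)

lemma frm_blk:
  assumes "finite A"
  shows "frm (A <+> A) (blk P w C) z z = frm A P (z \<circ> Inl) (z \<circ> Inl)
    + (frm A w (z \<circ> Inr) (z \<circ> Inl) + cnj (frm A w (z \<circ> Inr) (z \<circ> Inl))) + frm A C (z \<circ> Inr) (z \<circ> Inr)"
  unfolding frm_Plus[OF assms] by (simp add: frm_kernel_adj)

lemma psd_blkI:
  assumes "finite A" "psd A P" "psd A C"
    "\<And>x y. 0 \<le> Re (frm A P x x) + 2 * Re (frm A w y x) + Re (frm A C y y)"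
  shows "psd (A <+> A) (blk P w C)"
  unfolding psd_def frm_blk[OF assms(1)]
  using assms(4) psdD(2)[OF assms(2)] psdD(2)[OF assms(3)]
  by (simp add: complex_nonneg_Reals_iff)

lemma psd_blkD:
  assumes "finite A" "psd (A <+> A) (blk P w C)"
  shows "0 \<le> Re (frm A P x x) + 2 * Re (frm A w y x) + Re (frm A C y y)" "psd A C"
proof -
  have *: "frm (A <+> A) (blk P w C) (case_sum x y) (case_sum x y) =
    frm A P x x + (frm A w y x + cnj (frm A w y x)) + frm A C y y" for x y
    unfolding frm_blk[OF assms(1)] by (simp add: o_def)
  show "0 \<le> Re (frm A P x x) + 2 * Re (frm A w y x) + Re (frm A C y y)"
    using psdD(1)[OF assms(2), of "case_sum x y"] by (simp add: *)
  show "psd A C"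
    unfolding psd_def
  proof
    fix y
    have "frm (A <+> A) (blk P w C) (case_sum (\<lambda>_. 0) y) (case_sum (\<lambda>_. 0) y) = frm A C y y"
      unfolding * by (simp add: frm_def)
    then show "frm A C y y \<in> \<real>\<^sub>\<ge>\<^sub>0" using assms(2) unfolding psd_def by metis
  qed
qed

lemma psd_rank_one: "psd A (\<lambda>p q. w p * cnj (w q))"
  unfolding psd_def
proof
  fix x
  have "frm A (\<lambda>p q. w p * cnj (w q)) x x = (\<Sum>p\<in>A. w p * cnj (x p)) * (\<Sum>q\<in>A. x q * cnj (w q))"
    unfolding frm_def sum_product by (intro sum.cong refl) simp
  also have "(\<Sum>q\<in>A. x q * cnj (w q)) = cnj (\<Sum>p\<in>A. w p * cnj (x p))"
    by (simp add: mult.commute)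
  also have "(\<Sum>p\<in>A. w p * cnj (x p)) * cnj (\<Sum>p\<in>A. w p * cnj (x p))
      = of_real ((cmod (\<Sum>p\<in>A. w p * cnj (x p)))\<^sup>2)"
    by (simp only: complex_norm_square)
  finally show "frm A (\<lambda>p q. w p * cnj (w q)) x x \<in> \<real>\<^sub>\<ge>\<^sub>0" by simp
qed

text \<open>For invertible \<open>P\<close> the kernel \<open>R\<close> is the adjoint of
  \<open>w\<close> times the inverse of \<open>P\<close> times \<open>w\<close>. It is the least
  lower corner that keeps the block positive: by the last clause the completed form reaches 0 above
  every \<open>x\<close>, and this clause replaces the inverse.\<close>

lemma Schur_complement:
  fixes P w C :: "'i \<Rightarrow> 'i \<Rightarrow> complex"
  assumes A: "finite A" and K: "psd (A <+> A) (blk P w C)"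
  shows "\<exists>R. psd (A <+> A) (blk P w R) \<and> psd A (\<lambda>i j. C i j - R i j) \<and>
    (\<forall>x. \<exists>y. Re (frm A P y y) + 2 * Re (frm A w x y) + Re (frm A R x x) = 0)"
proof -
  have "finite (A <+> A)" "Inl ` A \<subseteq> A <+> A" using A by auto
  from psd_eliminate[OF K this] obtain K' and v :: "'i + 'i \<Rightarrow> 'i + 'i \<Rightarrow> complex" where K': "psd (A <+> A) K'"
    "\<forall>p\<in>Inl ` A. \<forall>q\<in>A <+> A. K' p q = 0 \<and> K' q p = 0"
    "\<forall>p\<in>A <+> A. \<forall>q\<in>A <+> A. blk P w C p q = K' p q + (\<Sum>r\<in>Inl ` A. v r p * cnj (v r q))"
    "\<forall>z. \<exists>z'. (\<forall>p. p \<notin> Inl ` A \<longrightarrow> z' p = z p) \<and> frm (A <+> A) (blk P w C) z' z' = frm (A <+> A) K' z z"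
    by (elim exE conjE)
  define Q where "Q = (\<lambda>i j. K' (Inr i) (Inr j))"
  define R where "R = (\<lambda>i j. C i j - Q i j)"
  have K'z: "frm (A <+> A) K' z z = frm A Q (z \<circ> Inr) (z \<circ> Inr)" for z
  proof -
    have "frm A (\<lambda>i j. K' (Inl i) (Inl j)) x y = frm A (\<lambda>i j. 0) x y"
      "frm A (\<lambda>i j. K' (Inl i) (Inr j)) x y = frm A (\<lambda>i j. 0) x y"
      "frm A (\<lambda>i j. K' (Inr i) (Inl j)) x y = frm A (\<lambda>i j. 0) x y" for x y
      by (rule frm_cong; use K'(2) in force)+
    moreover have "frm A (\<lambda>i j. 0) x y = 0" for x y by (simp add: frm_def)
    ultimately show ?thesis unfolding frm_Plus[OF A] by (simp add: Q_def)
  qed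
  have "psd A Q"
    unfolding psd_def
  proof
    fix x
    have "frm A Q x x = frm (A <+> A) K' (case_sum (\<lambda>_. 0) x) (case_sum (\<lambda>_. 0) x)"
      unfolding K'z by (simp add: o_def)
    then show "frm A Q x x \<in> \<real>\<^sub>\<ge>\<^sub>0" using K'(1) by (simp add: psd_def)
  qed
  have "psd (A <+> A) (blk P w R) \<longleftrightarrow> psd (A <+> A) (\<lambda>p q. \<Sum>r\<in>Inl ` A. v r p * cnj (v r q))"
  proof (rule psd_cong)
    fix p q assume pq: "p \<in> A <+> A" "q \<in> A <+> A"
    have "blk P w R p q = blk P w C p q - K' p q"
      using K'(2) pq by (auto simp: R_def Q_def InlI InrI)
    then show "blk P w R p q = (\<Sum>r\<in>Inl ` A. v r p * cnj (v r q))" using K'(3) pq by simp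
  qed
  moreover have "psd (A <+> A) (\<lambda>p q. \<Sum>r\<in>Inl ` A. v r p * cnj (v r q))"
    by (intro psd_sum psd_rank_one)
  ultimately have "psd (A <+> A) (blk P w R)" by simp
  moreover have "psd A (\<lambda>i j. C i j - R i j)" using \<open>psd A Q\<close> by (simp add: R_def)
  moreover have "\<exists>y. Re (frm A P y y) + 2 * Re (frm A w x y) + Re (frm A R x x) = 0" for x
  proof -
    obtain z' where z': "\<forall>p. p \<notin> Inl ` A \<longrightarrow> z' p = case_sum (\<lambda>_. 0) x p"
      "frm (A <+> A) (blk P w C) z' z' = frm (A <+> A) K' (case_sum (\<lambda>_. 0) x) (case_sum (\<lambda>_. 0) x)"
      using K'(4)[rule_format, of "case_sum (\<lambda>_. 0) x"] by (elim exE conjE)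
    have "z' \<circ> Inr = x" using z'(1) by (auto simp: fun_eq_iff image_iff)
    moreover have "frm A C x x = frm A R x x + frm A Q x x"
      unfolding frm_kernel_add[symmetric] by (rule frm_cong) (auto simp: R_def)
    ultimately have "Re (frm A P (z' \<circ> Inl) (z' \<circ> Inl)) + 2 * Re (frm A w x (z' \<circ> Inl)) + Re (frm A R x x) = 0"
      using arg_cong[OF z'(2), of Re] unfolding K'z frm_blk[OF A] by (simp add: o_def)
    then show ?thesis by blast
  qed
  ultimately show ?thesis by (intro exI[of _ R] conjI allI)
qed

text \<open>Induction on the length. Minimising over the first vector with the Schur complement
  \<open>S\<close> of \<open>P\<close> leaves a shorter chain that starts with \<open>I - S\<close>.
  Every inner \<open>I\<close> is thus split into \<open>R k\<close>, spent on the link to its left,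
  and \<open>Q (Suc k)\<close>, kept for the link to its right.\<close>

lemma chain_decomposition:
  fixes w :: "nat \<Rightarrow> 'i \<Rightarrow> 'i \<Rightarrow> complex"
  assumes "finite A" "psd A I" "psd A P"
    "\<And>\<xi>. 0 \<le> Re (frm A P (\<xi> 0) (\<xi> 0)) + (\<Sum>k<m. Re (frm A I (\<xi> (Suc k)) (\<xi> (Suc k))))
      + 2 * (\<Sum>k<m. Re (frm A (w k) (\<xi> (Suc k)) (\<xi> k)))"
  shows "\<exists>Q R. Q 0 = P \<and> (\<forall>k<m. psd (A <+> A) (blk (Q k) (w k) (R k))) \<and>
    (\<forall>k<m. Q (Suc k) = (\<lambda>i j. I i j - R k i j)) \<and> (\<forall>k\<le>m. psd A (Q k))"
  using assms
  proof (induction m arbitrary: P w)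
    case 0
    show ?case by (rule exI[of _ "\<lambda>_. P"], rule exI[of _ "\<lambda>_. P"]) (simp add: "0.prems"(3))
  next
    case (Suc m)
    note A = Suc.prems(1) and I = Suc.prems(2) and P = Suc.prems(3) and chain = Suc.prems(4)
    have "psd (A <+> A) (blk P (w 0) I)"
    proof (rule psd_blkI[OF A P I])
      fix x y :: "'i \<Rightarrow> complex"
      define \<xi> where "\<xi> = (\<lambda>k :: nat. if k = 0 then x else if k = 1 then y else (\<lambda>_. 0 :: complex))"
      have z: "frm A K (\<lambda>_. 0) v = 0" for K v by (simp add: frm_def)
      have "(\<Sum>k<Suc m. Re (frm A I (\<xi> (Suc k)) (\<xi> (Suc k)))) = Re (frm A I y y)"
        "(\<Sum>k<Suc m. Re (frm A (w k) (\<xi> (Suc k)) (\<xi> k))) = Re (frm A (w 0) y x)"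
        unfolding sum.lessThan_Suc_shift by (simp_all add: \<xi>_def z)
      then show "0 \<le> Re (frm A P x x) + 2 * Re (frm A (w 0) y x) + Re (frm A I y y)"
        using chain[of \<xi>] by (simp add: \<xi>_def)
    qed
    from Schur_complement[OF A this] obtain S where S: "psd (A <+> A) (blk P (w 0) S)"
      "psd A (\<lambda>i j. I i j - S i j)"
      "\<forall>x. \<exists>y. Re (frm A P y y) + 2 * Re (frm A (w 0) x y) + Re (frm A S x x) = 0"
      by (elim exE conjE)
    have "0 \<le> Re (frm A (\<lambda>i j. I i j - S i j) (\<xi> 0) (\<xi> 0)) + (\<Sum>k<m. Re (frm A I (\<xi> (Suc k)) (\<xi> (Suc k))))
      + 2 * (\<Sum>k<m. Re (frm A (w (Suc k)) (\<xi> (Suc k)) (\<xi> k)))" for \<xi>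
    proof -
      \<comment> \<open>The minimiser over \<open>\<xi> 0\<close>. Prepended to
        \<open>\<xi>\<close>, it turns the inequality for the long chain into the one for the short
        chain.\<close>
      obtain y where y: "Re (frm A P y y) + 2 * Re (frm A (w 0) (\<xi> 0) y) + Re (frm A S (\<xi> 0) (\<xi> 0)) = 0"
        using S(3)[rule_format, of "\<xi> 0"] by (elim exE)
      have "frm A I (\<xi> 0) (\<xi> 0) = frm A (\<lambda>i j. I i j - S i j) (\<xi> 0) (\<xi> 0) + frm A S (\<xi> 0) (\<xi> 0)"
        unfolding frm_kernel_add[symmetric] by (rule frm_cong) auto
      then show ?thesis
        using chain[of "case_nat y \<xi>"] y unfolding sum.lessThan_Suc_shift by simp
    qed
    from Suc.IH[of "\<lambda>i j. I i j - S i j" "\<lambda>k. w (Suc k)", OF A I S(2) this] obtain Q R where QR: "Q 0 = (\<lambda>i j. I i j - S i j)"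
      "\<forall>k<m. psd (A <+> A) (blk (Q k) (w (Suc k)) (R k))"
      "\<forall>k<m. Q (Suc k) = (\<lambda>i j. I i j - R k i j)" "\<forall>k\<le>m. psd A (Q k)"
      by (elim exE conjE)
    show ?case
    proof (rule exI[of _ "case_nat P Q"], rule exI[of _ "case_nat S R"], intro conjI allI impI)
      fix k
      show "psd (A <+> A) (blk (case_nat P Q k) (w k) (case_nat S R k))" if "k < Suc m"
        using QR S that by (cases k) auto
      show "case_nat P Q (Suc k) = (\<lambda>i j. I i j - case_nat S R k i j)" if "k < Suc m"
        using QR that by (cases k) auto
      show "psd A (case_nat P Q k)" if "k \<le> Suc m"
        using QR P that by (cases k) auto
    qed simp
  qed

section \<open>The square\<close>

text \<open>With \<open>u = (Re a + Im a) / 2\<close> and \<open>v = (Re a - Im a) / 2\<close> the tests say that \<open>u + \<omega> v\<close> is a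
  contraction for all unimodular \<open>\<omega>\<close>.\<close>

definition square_tests :: "(complex \<times> complex) set" where
  "square_tests = {(((1 - \<i>) + \<omega> * (1 + \<i>)) / 4, cnj (((1 + \<i>) + \<omega> * (1 - \<i>)) / 4)) | \<omega>. cmod \<omega> = 1}"

lemma frm_hermitian_kernel:
  assumes "\<And>i j. K j i = cnj (K i j)" shows "frm A K y x = cnj (frm A K x y)"
proof -
  have "frm A K y x = frm A (\<lambda>i j. cnj (K j i)) y x"
    by (rule frm_cong) (rule assms refl)+
  then show ?thesis unfolding frm_kernel_adj .
qed

lemma frm_unitk_self: "finite A \<Longrightarrow> frm A unitk x x = of_real (\<Sum>i\<in>A. (cmod (x i))\<^sup>2)"
  unfolding frm_id of_real_sum by (intro sum.cong refl complex_norm_square[symmetric])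

lemma psd_unitk: "finite A \<Longrightarrow> psd A unitk"
  unfolding psd_def by (simp add: frm_unitk_self sum_nonneg del: of_real_sum)

text \<open>The block form restricted to the vectors \<open>(x, s * x)\<close>; as \<open>w\<close>
  is hermitian, both corners contribute the same cross term.\<close>

lemma psd_diag_pair:
  assumes A: "finite A" and psd: "psd (A <+> A) (blk P w R)" "psd A P"
    and w: "\<And>i j. w j i = cnj (w i j)" and s: "s = 1 \<or> s = -1"
  shows "psd A (\<lambda>i j. P i j + R i j + 2 * of_real s * w i j)"
proof -
  have eq: "frm A (\<lambda>i j. P i j + R i j + 2 * of_real s * w i j) x x
      = frm A P x x + frm A R x x + of_real (2 * s) * frm A w x x" for x
    by (simp add: frm_kernel_add frm_kernel_scale)
  show ?thesis
    unfolding psd_def complex_nonneg_Reals_iff eq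
  proof (intro allI conjI)
    fix x
    have "frm A w (\<lambda>i. of_real s * x i) x = of_real s * frm A w x x"
      by (rule frm_scale_left)
    moreover have "frm A R (\<lambda>i. of_real s * x i) (\<lambda>i. of_real s * x i) = frm A R x x"
      using s by (auto simp: frm_scale_left frm_scale_right)
    ultimately have "0 \<le> Re (frm A P x x) + 2 * Re (of_real s * frm A w x x) + Re (frm A R x x)"
      using psd_blkD(1)[OF A psd(1), of x "\<lambda>i. of_real s * x i"] by simp
    then show "0 \<le> Re (frm A P x x + frm A R x x + of_real (2 * s) * frm A w x x)" by simp
    have "Im (frm A w x x) = 0"
      using arg_cong[OF frm_hermitian_kernel[of w A x x, OF w], of Im] by simp
    then show "Im (frm A P x x + frm A R x x + of_real (2 * s) * frm A w x x) = 0"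
      using psdD(2)[OF psd(2)] psdD(2)[OF psd_blkD(2)[OF A psd(1)]] by simp
  qed
qed

text \<open>The blocks \<open>(Q k, w k, R k)\<close> of the chain give positive matrices \<open>Q k + R k + 2 w k\<close> and
  \<open>Q k + R k - 2 w k\<close>. Summed over even and over odd \<open>k\<close> they are the weights of the four corners, and
  the boundary term \<open>Q (2 m)\<close> is the weight of \<open>0\<close>, which makes the factor \<open>2 m / (2 m + 1)\<close> appear.\<close>

lemma kmin_square_of_chain:
  fixes u v :: "nat \<Rightarrow> nat \<Rightarrow> complex"
  assumes K: "Complex 1 1 \<in> K" "Complex 1 (-1) \<in> K" "Complex (-1) 1 \<in> K" "Complex (-1) (-1) \<in> K" "0 \<in> K"
    and u: "\<And>i j. u j i = cnj (u i j)" and v: "\<And>i j. v j i = cnj (v i j)"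
    and uv: "\<And>\<omega> x y. cmod \<omega> = 1 \<Longrightarrow>
      0 \<le> Re (frm {..<n} unitk x x) + Re (frm {..<n} unitk y y) + 2 * Re (frm {..<n} u x y + \<omega> * frm {..<n} v x y)"
    and m: "0 < (m :: nat)"
  shows "kmin n K (\<lambda>i j. of_real (2 * real m / (2 * real m + 1)) * (Complex 1 1 * u i j + Complex 1 (-1) * v i j))"
proof -
  let ?A = "{..<n}"
  define w where "w k = (if even k then u else v)" for k :: nat
  have wh: "w k j i = cnj (w k i j)" for k i j using u[of j i] v[of j i] by (simp add: w_def)
  have I: "psd ?A unitk" by (rule psd_unitk) simp
  have chain: "0 \<le> Re (frm ?A unitk (\<xi> 0) (\<xi> 0)) + (\<Sum>k<2*m. Re (frm ?A unitk (\<xi> (Suc k)) (\<xi> (Suc k))))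
      + 2 * (\<Sum>k<2*m. Re (frm ?A (w k) (\<xi> (Suc k)) (\<xi> k)))" for \<xi> :: "nat \<Rightarrow> nat \<Rightarrow> complex"
  proof -
    let ?z = "\<lambda>_. 0 :: complex"
    \<comment> \<open>Even and odd vertices of the chain. There are \<open>2 * m + 1\<close>
      vertices, one short of \<open>Suc m\<close> pairs, so the last odd vector is set to 0.\<close>
    define a where "a k = \<xi> (2 * k)" for k
    define b where "b k = (if k < m then \<xi> (Suc (2 * k)) else ?z)" for k
    have ru: "Re (frm ?A u (\<xi> (2*k)) (\<xi> (Suc (2*k)))) = Re (frm ?A u (\<xi> (Suc (2*k))) (\<xi> (2*k)))" for k
      by (subst frm_hermitian_kernel[of u, OF u]) simp
    have z: "frm ?A K ?z y = 0" "frm ?A K y ?z = 0" for K y by (simp_all add: frm_def)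
    have sum2: "(\<Sum>k<2*j. g k) = (\<Sum>k<j. g (2*k) + g (Suc (2*k)))" for g :: "nat \<Rightarrow> real" and j
      by (induction j) auto
    have "0 \<le> (\<Sum>k<Suc m. Re (frm ?A unitk (a k) (a k)) + Re (frm ?A unitk (b k) (b k)))
      + 2 * (\<Sum>k<Suc m. Re (frm ?A u (a k) (b k))) + 2 * (\<Sum>k<Suc m-1. Re (frm ?A v (a (Suc k)) (b k)))"
      by (rule alternating_chain_nonneg[OF uv])
    also have "(\<Sum>k<Suc m. Re (frm ?A unitk (a k) (a k)) + Re (frm ?A unitk (b k) (b k)))
        = (\<Sum>k<Suc m. Re (frm ?A unitk (a k) (a k))) + (\<Sum>k<m. Re (frm ?A unitk (b k) (b k)))"
      by (simp add: sum.distrib b_def z)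
    also have "(\<Sum>k<Suc m. Re (frm ?A unitk (a k) (a k)))
        = Re (frm ?A unitk (\<xi> 0) (\<xi> 0)) + (\<Sum>k<m. Re (frm ?A unitk (a (Suc k)) (a (Suc k))))"
      unfolding sum.lessThan_Suc_shift by (simp add: a_def)
    also have "(\<Sum>k<Suc m. Re (frm ?A u (a k) (b k))) = (\<Sum>k<m. Re (frm ?A (w (2*k)) (\<xi> (Suc (2*k))) (\<xi> (2*k))))"
      by (simp add: b_def z a_def w_def ru)
    also have "(\<Sum>k<Suc m-1. Re (frm ?A v (a (Suc k)) (b k)))
        = (\<Sum>k<m. Re (frm ?A (w (Suc (2*k))) (\<xi> (Suc (Suc (2*k)))) (\<xi> (Suc (2*k)))))"
      by (simp add: b_def a_def w_def)
    finally show ?thesis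
      unfolding sum2 by (simp add: a_def b_def sum.distrib)
  qed
  from chain_decomposition[OF finite_lessThan I I chain] obtain Q R where QR': "Q 0 = unitk"
    "\<forall>k<2*m. psd (?A <+> ?A) (blk (Q k) (w k) (R k))"
    "\<forall>k<2*m. Q (Suc k) = (\<lambda>i j. unitk i j - R k i j)" "\<forall>k\<le>2*m. psd ?A (Q k)"
    by (elim exE conjE)
  note QR = QR'(1) QR'(2,3,4)[rule_format]
  \<comment> \<open>The parity of \<open>j\<close> selects the links that carry \<open>u\<close> or
    \<open>v\<close>, and \<open>s j\<close> the sign. Hence j = 0, 1, 2, 3 stand for the corners 1
    + i, 1 - i, -1 - i, -1 + i, in the order of \<open>l\<close>.\<close>
  define s where "s = (\<lambda>j :: nat. if j < 2 then 1 else - 1 :: real)"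
  define h0 where "h0 j = (\<lambda>i i'. \<Sum>k<m. Q (2*k + j mod 2) i i' + R (2*k + j mod 2) i i' + 2 * of_real (s j) * w (2*k + j mod 2) i i')" for j
  \<comment> \<open>The four corner sums add up to twice the sum of all \<open>Q k + R k\<close>;
    with \<open>Q (2 * m)\<close> counted twice as well, the total is \<open>2 * (2 * m + 1)\<close>
    times the unit.\<close>
  define c where "c = 1 / (2 * (2 * real m + 1))"
  have c: "0 \<le> c" by (simp add: c_def)
  have c1: "of_real (2 * c) * (2 * of_nat m + 1) = (1 :: complex)"
  proof -
    have "2 * c * (2 * real m + 1) = 1" by (simp add: c_def field_simps)
    then have "complex_of_real (2 * c * (2 * real m + 1)) = 1" by simp
    then show ?thesis by simp
  qed
  have c2: "2 * real m / (2 * real m + 1) = c * (4 * real m)" by (simp add: c_def field_simps)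
  define h where "h j = (if j < 4 then (\<lambda>i i'. of_real c * h0 j i i')
    else (\<lambda>i i'. of_real (2 * c) * Q (2 * m) i i'))" for j
  define l where "l j = (if j = 0 then Complex 1 1 else if j = 1 then Complex 1 (-1)
    else if j = 2 then Complex (-1) (-1) else if j = 3 then Complex (-1) 1 else 0)" for j :: nat
  have h0: "psd ?A (h0 j)" for j
    unfolding h0_def
  proof (rule psd_sum)
    fix k assume "k \<in> {..<m}"
    then have lt: "2 * k + j mod 2 < 2 * m" by (cases "even j") auto
    show "psd ?A (\<lambda>i i'. Q (2*k + j mod 2) i i' + R (2*k + j mod 2) i i' + 2 * of_real (s j) * w (2*k + j mod 2) i i')"
      by (rule psd_diag_pair[OF _ QR(2)[OF lt] QR(4)[OF less_imp_le[OF lt]] wh]) (auto simp: s_def)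
  qed
  have five: "{..<5::nat} = {0, 1, 2, 3, 4}" by auto
  \<comment> \<open>The sum telescopes, because \<open>Q 0\<close> is the unit and so is
    \<open>R k + Q (Suc k)\<close>.\<close>
  have tot: "(\<Sum>k<p. Q k i i' + R k i i') + Q p i i' = of_nat p * unitk i i' + unitk i i'" if "p \<le> 2 * m" for p i i'
    using that
  proof (induction p)
    case (Suc p)
    define d :: complex where "d = unitk i i'"
    have "R p i i' + Q (Suc p) i i' = d" using QR(3)[of p] Suc.prems by (simp add: d_def)
    moreover have "(\<Sum>k<p. Q k i i' + R k i i') + Q p i i' = of_nat p * d + d"
      using Suc by (simp add: d_def)
    moreover have "(\<Sum>k<Suc p. Q k i i' + R k i i') + Q (Suc p) i i'
        = ((\<Sum>k<p. Q k i i' + R k i i') + Q p i i') + (R p i i' + Q (Suc p) i i')"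
      by (simp add: add.assoc)
    ultimately show ?case unfolding d_def[symmetric] by (simp add: algebra_simps)
  qed (simp add: QR(1))
  have even_odd: "(\<Sum>k<m. g (2*k)) + (\<Sum>k<m. g (Suc (2*k))) = (\<Sum>k<2*m. g k)" for g :: "nat \<Rightarrow> complex"
    by (induction m) (auto simp: algebra_simps)
  have h01: "h0 0 i i' + h0 1 i i' + h0 2 i i' + h0 3 i i' = 2 * (\<Sum>k<2*m. Q k i i' + R k i i')" for i i'
    unfolding even_odd[symmetric] by (simp add: h0_def s_def sum.distrib sum_subtractf sum_negf algebra_simps)
  have sums: "(\<Sum>j\<in>{..<5}. h j i i') = unitk i i'" for i i'
  proof -
    have "(\<Sum>j\<in>{..<5}. h j i i') = of_real c * (h0 0 i i' + h0 1 i i' + h0 2 i i' + h0 3 i i')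
        + of_real (2 * c) * Q (2 * m) i i'"
      unfolding five by (simp add: h_def algebra_simps)
    also have "\<dots> = of_real (2 * c) * ((\<Sum>k<2*m. Q k i i' + R k i i') + Q (2 * m) i i')"
      unfolding h01 by (simp add: algebra_simps)
    also have "(\<Sum>k<2*m. Q k i i' + R k i i') + Q (2 * m) i i' = (2 * of_nat m + 1) * unitk i i'"
      using tot[of "2 * m" i i'] by (simp add: algebra_simps)
    also have "of_real (2 * c) * ((2 * of_nat m + 1) * unitk i i') = unitk i i'"
      by (simp only: mult.assoc[symmetric] c1) simp
    finally show ?thesis .
  qed
  have d: "h0 0 i i' - h0 2 i i' = 4 * of_nat m * u i i'" "h0 1 i i' - h0 3 i i' = 4 * of_nat m * v i i'" for i i'
    by (simp_all add: h0_def s_def w_def sum.distrib sum_subtractf sum_negf algebra_simps)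
  show ?thesis
    unfolding kmin_def
  proof (intro exI[of _ "{..<5}"] exI[of _ h] exI[of _ l] conjI ballI allI impI)
    fix j :: nat assume "j \<in> {..<5}"
    show "l j \<in> K" using K by (simp add: l_def)
    show "psd ?A (h j)"
      using psd_scale[OF h0 c, of j] psd_scale[OF QR(4), of "2 * m" "2 * c"] c
      by (simp add: h_def)
  next
    fix i i' assume "i < n" "i' < n"
    show "(\<Sum>j\<in>{..<5}. h j i i') = unitk i i'" by (rule sums)
    have "(\<Sum>j\<in>{..<5}. l j * h j i i') = of_real c *
        (Complex 1 1 * (h0 0 i i' - h0 2 i i') + Complex 1 (-1) * (h0 1 i i' - h0 3 i i'))"
    proof -
      have "Complex (-1) (-1) = - Complex 1 1" "Complex (-1) 1 = - Complex 1 (-1)" by (simp_all add: complex_eq_iff)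
      then show ?thesis unfolding five by (simp add: h_def l_def algebra_simps)
    qed
    also have "\<dots> = of_real (2 * real m / (2 * real m + 1)) * (Complex 1 1 * u i i' + Complex 1 (-1) * v i i')"
      unfolding d c2 by (simp add: algebra_simps)
    finally show "(\<Sum>j\<in>{..<5}. l j * h j i i') = of_real (2 * real m / (2 * real m + 1)) * (Complex 1 1 * u i i' + Complex 1 (-1) * v i i')" .
  qed simp
qed

text \<open>A finite chain settles the claim for \<open>a\<close> times
  \<open>2 * m / (2 * m + 1)\<close>. These multiples tend to \<open>a\<close>, and the minimal set
  is closed under limits.\<close>

lemma kmin_square:
  assumes K: "Complex 1 1 \<in> K" "Complex 1 (-1) \<in> K" "Complex (-1) 1 \<in> K" "Complex (-1) (-1) \<in> K" "0 \<in> K" "compact K"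
    and a: "passes_mat square_tests n a"
  shows "kmin n K a"
proof (rule kmin_limit)
  define u where "u i j = ((1 - \<i>) * a i j + (1 + \<i>) * cnj (a j i)) / 4" for i j
  define v where "v i j = ((1 + \<i>) * a i j + (1 - \<i>) * cnj (a j i)) / 4" for i j
  have a_eq: "Complex 1 1 * u i j + Complex 1 (-1) * v i j = a i j" for i j
    by (simp add: u_def v_def complex_eq_iff field_simps)
  have u: "u j i = cnj (u i j)" and v: "v j i = cnj (v i j)" for i j
    by (simp_all add: u_def v_def algebra_simps)
  have fu: "frm A u x y = ((1 - \<i>) * frm A a x y + (1 + \<i>) * cnj (frm A a y x)) / 4"
    and fv: "frm A v x y = ((1 + \<i>) * frm A a x y + (1 - \<i>) * cnj (frm A a y x)) / 4" for A x y
  proof -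
    have "frm A (\<lambda>i j. (1/4) * ((1 - \<i>) * a i j + (1 + \<i>) * cnj (a j i))) x y
        = (1/4) * ((1 - \<i>) * frm A a x y + (1 + \<i>) * cnj (frm A a y x))"
      "frm A (\<lambda>i j. (1/4) * ((1 + \<i>) * a i j + (1 - \<i>) * cnj (a j i))) x y
        = (1/4) * ((1 + \<i>) * frm A a x y + (1 - \<i>) * cnj (frm A a y x))"
      unfolding frm_kernel_scale frm_kernel_add frm_kernel_adj by simp_all
    then show "frm A u x y = ((1 - \<i>) * frm A a x y + (1 + \<i>) * cnj (frm A a y x)) / 4"
      "frm A v x y = ((1 + \<i>) * frm A a x y + (1 - \<i>) * cnj (frm A a y x)) / 4"
      by (simp_all add: u_def[abs_def] v_def[abs_def])
  qed
  have uv: "0 \<le> Re (frm {..<n} unitk x x) + Re (frm {..<n} unitk y y) + 2 * Re (frm {..<n} u x y + \<omega> * frm {..<n} v x y)"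
    if "cmod \<omega> = 1" for \<omega> x y
  proof -
    define p where "p = ((1 - \<i>) + \<omega> * (1 + \<i>)) / 4"
    define q where "q = ((1 + \<i>) + \<omega> * (1 - \<i>)) / 4"
    have "(p, cnj q) \<in> square_tests" using that by (auto simp: square_tests_def p_def q_def)
    then have "0 \<le> Re (frm {..<n} unitk x x) + Re (frm {..<n} unitk y y)
      + 2 * Re (p * frm {..<n} a x y + cnj q * frm {..<n} a y x)"
      using a unfolding passes_mat_def by blast
    moreover have "frm {..<n} u x y + \<omega> * frm {..<n} v x y = p * frm {..<n} a x y + q * cnj (frm {..<n} a y x)"
      unfolding fu fv p_def q_def by (simp add: field_simps)
    moreover have "Re (q * cnj (frm {..<n} a y x)) = Re (cnj q * frm {..<n} a y x)" by simp
    ultimately show ?thesis by simp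
  qed
  show "compact K" "K \<noteq> {}" using K by auto
  fix e :: real assume e: "0 < e"
  define B where "B = (\<Sum>i<n. \<Sum>j<n. cmod (a i j))"
  have B: "cmod (a i j) \<le> B" if "i < n" "j < n" for i j
  proof -
    have "cmod (a i j) \<le> (\<Sum>j<n. cmod (a i j))" using that by (intro member_le_sum) auto
    also have "\<dots> \<le> B" unfolding B_def using that by (intro member_le_sum[of i _ "\<lambda>i. \<Sum>j<n. cmod (a i j)"] sum_nonneg) auto
    finally show ?thesis .
  qed
  obtain m :: nat where "B / e < m" using reals_Archimedean2 by blast
  then have m: "B < e * (2 * real (Suc m) + 1)" 
  proof -
    have "B < e * real m" using \<open>B / e < m\<close> e by (simp add: pos_divide_less_eq mult.commute)
    also have "\<dots> \<le> e * (2 * real (Suc m) + 1)" using e by (intro mult_left_mono) auto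
    finally show ?thesis .
  qed
  let ?a' = "\<lambda>i j. of_real (2 * real (Suc m) / (2 * real (Suc m) + 1)) * (Complex 1 1 * u i j + Complex 1 (-1) * v i j)"
  have "kmin n K ?a'" by (rule kmin_square_of_chain[OF K(1-5) u v uv]) auto
  moreover have "cmod (?a' i j - a i j) \<le> e" if "i < n" "j < n" for i j
  proof -
    have "?a' i j - a i j = of_real (2 * real (Suc m) / (2 * real (Suc m) + 1) - 1) * a i j"
      unfolding a_eq by (simp add: algebra_simps)
    also have "2 * real (Suc m) / (2 * real (Suc m) + 1) - 1 = - (1 / (2 * real (Suc m) + 1))" by (simp add: field_simps)
    finally have "cmod (?a' i j - a i j) = cmod (of_real (- (1 / (2 * real (Suc m) + 1))) * a i j)"
      by (rule arg_cong)
    also have "\<dots> = cmod (a i j) / (2 * real (Suc m) + 1)"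
      unfolding norm_mult norm_of_real by simp
    also have "\<dots> \<le> B / (2 * real (Suc m) + 1)" using B[OF that] by (intro divide_right_mono) auto
    also have "\<dots> \<le> e" using m by (simp add: field_simps)
    finally show ?thesis .
  qed
  ultimately show "\<exists>a'. kmin n K a' \<and> (\<forall>i<n. \<forall>k<n. cmod (a' i k - a i k) \<le> e)" by blast
qed

section \<open>Bounded operators and the tail projections\<close>

lemma ell2_nth_Abs: "summable (\<lambda>n. (cmod (f n))\<^sup>2) \<Longrightarrow> ell2_nth (Abs_ell2 f) = f"
  by (simp add: Abs_ell2_inverse)

lemma ell2_nth_simps [simp]:
  "ell2_nth 0 n = 0"
  "ell2_nth (u + v) n = ell2_nth u n + ell2_nth v n"
  "ell2_nth (u - v) n = ell2_nth u n - ell2_nth v n"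
  "ell2_nth (- u) n = - ell2_nth u n"
  "ell2_nth (scaleC_ell2 c u) n = c * ell2_nth u n"
  "ell2_nth (r *\<^sub>R u) n = of_real r * ell2_nth u n"
  by (simp_all add: zero_ell2.rep_eq plus_ell2.rep_eq minus_ell2.rep_eq uminus_ell2.rep_eq
      scaleC_ell2.rep_eq scaleR_ell2.rep_eq)

lemma ell2_nth_sum: "ell2_nth (\<Sum>i\<in>A. f i) n = (\<Sum>i\<in>A. ell2_nth (f i) n)"
  by (induction A rule: infinite_finite_induct) simp_all

lemma cinner_add_left: "cinner (u + v) w = cinner u w + cinner v w"
  unfolding cinner_def suminf_add[OF ell2_summable_prod ell2_summable_prod]
  by (simp add: algebra_simps)

lemma cinner_commute: "cinner u v = cnj (cinner v u)"
proof -
  have "cnj (cinner v u) = (\<Sum>n. cnj (ell2_nth v n * cnj (ell2_nth u n)))"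
    unfolding cinner_def
    by (rule bounded_linear.suminf[OF bounded_linear_cnj ell2_summable_prod])
  then show ?thesis by (simp add: cinner_def mult.commute)
qed

lemma cinner_scaleC_left: "cinner (scaleC_ell2 c u) v = c * cinner u v"
  unfolding cinner_def suminf_mult[OF ell2_summable_prod, symmetric]
  by (simp add: algebra_simps)

lemma cinner_scaleC_right: "cinner u (scaleC_ell2 c v) = cnj c * cinner u v"
  using cinner_commute[of u "scaleC_ell2 c v"] cinner_commute[of u v]
  by (simp add: cinner_scaleC_left)

lemma cinner_add_right: "cinner u (v + w) = cinner u v + cinner u w"
  using cinner_commute[of u "v + w"] cinner_commute[of u v] cinner_commute[of u w]
  by (simp add: cinner_add_left)

lemma cinner_zero_left [simp]: "cinner 0 v = 0"
  by (simp add: cinner_def)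

lemma cinner_zero_right [simp]: "cinner u 0 = 0"
  by (simp add: cinner_def)

lemma scaleC_ell2_minus_one: "scaleC_ell2 (- 1) u = - u"
  by (rule ell2_eqI) simp

lemma cinner_minus_left: "cinner (- u) v = - cinner u v"
  using cinner_scaleC_left[of "- 1" u v] by (simp add: scaleC_ell2_minus_one)

lemma cinner_minus_right: "cinner u (- v) = - cinner u v"
  using cinner_scaleC_right[of u "- 1" v] by (simp add: scaleC_ell2_minus_one)

lemma cinner_diff_left: "cinner (u - v) w = cinner u w - cinner v w"
  using cinner_add_left[of u "- v" w] by (simp add: cinner_minus_left)

lemma cinner_diff_right: "cinner u (v - w) = cinner u v - cinner u w"
  using cinner_add_right[of u v "- w"] by (simp add: cinner_minus_right)

lemma cinner_scaleR_left: "cinner (r *\<^sub>R u) v = of_real r * cinner u v"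
  by (simp flip: scaleC_ell2_of_real add: cinner_scaleC_left)

lemma cinner_scaleR_right: "cinner u (r *\<^sub>R v) = of_real r * cinner u v"
  by (simp flip: scaleC_ell2_of_real add: cinner_scaleC_right)

lemma cinner_sum_left: "cinner (\<Sum>i\<in>A. f i) v = (\<Sum>i\<in>A. cinner (f i) v)"
  by (induction A rule: infinite_finite_induct) (simp_all add: cinner_add_left)

lemma cinner_sum_right: "cinner v (\<Sum>i\<in>A. f i) = (\<Sum>i\<in>A. cinner v (f i))"
  by (induction A rule: infinite_finite_induct) (simp_all add: cinner_add_right)

lemmas cinner_simps = cinner_add_left cinner_add_right cinner_diff_left cinner_diff_right
  cinner_minus_left cinner_minus_right cinner_scaleC_left cinner_scaleC_right
  cinner_scaleR_left cinner_scaleR_right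

lemma cinner_self: "cinner u u = of_real ((norm u)\<^sup>2)"
proof (rule complex_eqI)
  show "Re (cinner u u) = Re (of_real ((norm u)\<^sup>2))"
    by (simp add: power2_norm_eq_inner inner_ell2_def)
  have "Im (cinner u u) = - Im (cinner u u)"
    by (subst cinner_commute) simp
  then show "Im (cinner u u) = Im (of_real ((norm u)\<^sup>2))" by simp
qed

lemma norm_cinner_le: "cmod (cinner u v) \<le> norm u * norm v"
proof (cases "cinner u v = 0")
  case False
  define c where "c = cnj (sgn (cinner u v))"
  have "cmod c = 1" using False by (simp add: c_def norm_sgn)
  have "c * cinner u v = of_real (cmod (cinner u v))"
    using False complex_norm_square[of "cinner u v"]
    by (simp add: c_def sgn_div_norm divide_simps scaleR_conv_of_real power2_eq_square mult.commute)
  then have "cmod (cinner u v) = inner (scaleC_ell2 c u) v"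
    by (simp add: inner_ell2_def cinner_scaleC_left)
  also have "\<dots> \<le> norm (scaleC_ell2 c u) * norm v" by (rule norm_cauchy_schwarz)
  finally show ?thesis by (simp add: norm_scaleC_ell2 \<open>cmod c = 1\<close>)
qed simp

lemma norm_add_sq_ell2: "(norm (u + v))\<^sup>2 = (norm u)\<^sup>2 + (norm v)\<^sup>2 + 2 * Re (cinner u v)" for u v :: ell2
  by (simp add: power2_norm_eq_inner inner_add_left inner_add_right inner_commute[of v u]
      flip: inner_ell2_def)

lemma ell2_nth_bound: "cmod (ell2_nth u n) \<le> norm u"
proof (rule power2_le_imp_le)
  have "sum (\<lambda>n. (cmod (ell2_nth u n))\<^sup>2) {n} \<le> (\<Sum>n. (cmod (ell2_nth u n))\<^sup>2)"
    by (rule sum_le_suminf[OF ell2_summable]) auto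
  then show "(cmod (ell2_nth u n))\<^sup>2 \<le> (norm u)\<^sup>2"
    by (simp add: norm_ell2_sq)
qed simp

lemma ell2_partial_norm: "(\<Sum>i<n. (cmod (ell2_nth u i))\<^sup>2) \<le> (norm u)\<^sup>2"
  unfolding norm_ell2_sq by (rule sum_le_suminf[OF ell2_summable]) auto

lemma ell2_normI:
  assumes "\<And>n. (\<Sum>i<n. (cmod (ell2_nth u i))\<^sup>2) \<le> B\<^sup>2" "0 \<le> B"
  shows "norm u \<le> B"
proof -
  have "(norm u)\<^sup>2 \<le> B\<^sup>2"
    unfolding norm_ell2_sq by (rule suminf_le_const[OF ell2_summable assms(1)])
  then show ?thesis using assms(2) power2_le_imp_le by blast
qed

instance ell2 :: complete_space
proof
  fix X :: "nat \<Rightarrow> ell2"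
  assume X: "Cauchy X"
  define f where "f i = lim (\<lambda>m. ell2_nth (X m) i)" for i
  have f: "(\<lambda>m. ell2_nth (X m) i) \<longlonglongrightarrow> f i" for i
  proof -
    have "Cauchy (\<lambda>m. ell2_nth (X m) i)"
    proof (rule CauchyI)
      fix e :: real assume "0 < e"
      then obtain M where "\<forall>m\<ge>M. \<forall>n\<ge>M. norm (X m - X n) < e"
        using X CauchyD by blast
      then show "\<exists>M. \<forall>m\<ge>M. \<forall>n\<ge>M. norm (ell2_nth (X m) i - ell2_nth (X n) i) < e"
        using ell2_nth_bound[of "X _ - X _" i] by (metis (no_types) ell2_nth_simps(3) le_less_trans)
    qed
    then show ?thesis unfolding f_def by (simp add: Cauchy_convergent_iff convergent_LIMSEQ_iff)
  qed
  have fin: "(\<Sum>i<k. (cmod (ell2_nth (X m) i - f i))\<^sup>2) \<le> e\<^sup>2"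
    if M: "\<forall>n\<ge>M. norm (X m - X n) < e" and "0 < e" for m M e k
  proof (rule LIMSEQ_le_const2)
    show "(\<lambda>n. \<Sum>i<k. (cmod (ell2_nth (X m) i - ell2_nth (X n) i))\<^sup>2)
        \<longlonglongrightarrow> (\<Sum>i<k. (cmod (ell2_nth (X m) i - f i))\<^sup>2)"
      by (intro tendsto_intros f)
    have "(\<Sum>i<k. (cmod (ell2_nth (X m) i - ell2_nth (X n) i))\<^sup>2) \<le> e\<^sup>2" if "n \<ge> M" for n
      using ell2_partial_norm[of "X m - X n" k] power_mono[OF less_imp_le, of "norm (X m - X n)" e 2]
        M that by (simp add: order_trans)
    then show "\<exists>N. \<forall>n\<ge>N. (\<Sum>i<k. (cmod (ell2_nth (X m) i - ell2_nth (X n) i))\<^sup>2) \<le> e\<^sup>2"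
      by blast
  qed
  have sm: "summable (\<lambda>i. (cmod (ell2_nth (X m) i - f i))\<^sup>2)"
    if M: "\<forall>n\<ge>M. norm (X m - X n) < e" and "0 < e" for m M e
    by (rule summableI_nonneg_bounded[where x = "e\<^sup>2"]) (use fin[OF that] in auto)
  have "summable (\<lambda>i. (cmod (f i))\<^sup>2)"
  proof -
    obtain M where M: "\<forall>m\<ge>M. \<forall>n\<ge>M. norm (X m - X n) < 1"
      using X CauchyD[of X 1] by auto
    have "summable (\<lambda>i. (cmod (ell2_nth (X M) i + - (ell2_nth (X M) i - f i)))\<^sup>2)"
      by (rule square_summable_add[OF ell2_summable])
        (use sm[of M M 1] M in \<open>simp add: norm_minus_commute\<close>)
    then show ?thesis by simp
  qed
  then have nf: "ell2_nth (Abs_ell2 f) = f" by (rule ell2_nth_Abs)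
  have "X \<longlonglongrightarrow> Abs_ell2 f"
  proof (rule LIMSEQ_I)
    fix r :: real assume "0 < r"
    then obtain M where M: "\<forall>m\<ge>M. \<forall>n\<ge>M. norm (X m - X n) < r/2"
      using X CauchyD[of X "r/2"] by auto
    have "norm (X m - Abs_ell2 f) \<le> r/2" if "m \<ge> M" for m
      by (rule ell2_normI) (use fin[of M m "r/2"] M that \<open>0 < r\<close> in \<open>auto simp: nf\<close>)
    then show "\<exists>no. \<forall>n\<ge>no. norm (X n - Abs_ell2 f) < r"
      using \<open>0 < r\<close> by (metis field_sum_of_halves le_less_trans less_add_same_cancel1 half_gt_zero)
  qed
  then show "convergent X" by (auto simp: convergent_def)
qed

instance ell2 :: banach ..

lemma bop_simps [simp]:
  "bop_apply 0 u = 0" "bop_apply 1 u = u"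
  "bop_apply (x + y) u = bop_apply x u + bop_apply y u"
  "bop_apply (x - y) u = bop_apply x u - bop_apply y u"
  "bop_apply (- x) u = - bop_apply x u"
  "bop_apply (x * y) u = bop_apply x (bop_apply y u)"
  "bop_apply (r *\<^sub>R x) u = r *\<^sub>R bop_apply x u"
  "bop_apply (scaleC_bop c x) u = scaleC_ell2 c (bop_apply x u)"
  by (simp_all add: plus_bop.rep_eq minus_bop.rep_eq uminus_bop.rep_eq zero_bop.rep_eq
    times_bop.rep_eq scaleR_bop.rep_eq one_bop.rep_eq scaleC_bop.rep_eq)

lemma bop_linear:
  "bop_apply x 0 = 0"
  "bop_apply x (u + v) = bop_apply x u + bop_apply x v"
  "bop_apply x (u - v) = bop_apply x u - bop_apply x v"
  "bop_apply x (- u) = - bop_apply x u"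
  "bop_apply x (r *\<^sub>R u) = r *\<^sub>R bop_apply x u"
  "bop_apply x (\<Sum>i\<in>A. f i) = (\<Sum>i\<in>A. bop_apply x (f i))"
  using bop_bounded_linear[of x, THEN bounded_linear.linear]
  by (auto simp: linear_0 linear_add linear_diff linear_neg linear_scale linear_sum)

lemma bop_scaleC: "bop_apply x (scaleC_ell2 c u) = scaleC_ell2 c (bop_apply x u)"
  using bop_apply[of x] by auto

lemma bop_norm_le: "norm (bop_apply x u) \<le> norm x * norm u"
  using onorm[OF bop_bounded_linear] by (simp add: norm_bop.rep_eq)

lemma bop_normI:
  assumes "\<And>u. norm (bop_apply x u) \<le> B * norm u"
  shows "norm x \<le> B"
  unfolding norm_bop.rep_eq
proof (rule onorm_bound[OF _ assms])
  obtain u :: ell2 where "u \<noteq> 0"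
    by (metis bop_eqI bop_simps(1) bop_simps(2) zero_neq_one)
  with order_trans[OF norm_ge_zero assms[of u]] show "0 \<le> B"
    by (simp add: zero_le_mult_iff)
qed

lemma bop_sum: "bop_apply (\<Sum>i\<in>A. f i) u = (\<Sum>i\<in>A. bop_apply (f i) u)"
  by (induction A rule: infinite_finite_induct) simp_all

lemma scaleC_bop_of_real: "scaleC_bop (of_real r) x = r *\<^sub>R x"
  by (rule bop_eqI) (simp add: scaleC_ell2_of_real)

lemma norm_scaleC_bop: "norm (scaleC_bop c x) \<le> cmod c * norm x"
  by (rule bop_normI)
    (simp add: norm_scaleC_ell2 mult.assoc bop_norm_le mult_left_mono)

lemma bop_apply_tendsto:
  assumes "(X \<longlongrightarrow> x) F" shows "((\<lambda>n. bop_apply (X n) u) \<longlongrightarrow> bop_apply x u) F"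
proof -
  have "bounded_linear (\<lambda>x. bop_apply x u)"
    by (rule bounded_linear_intro[of _ "norm u"]) (simp_all add: bop_norm_le)
  then show ?thesis using assms by (rule bounded_linear.tendsto)
qed

lemma cinner_tendsto:
  assumes "(X \<longlongrightarrow> u) F" shows "((\<lambda>n. cinner (X n) v) \<longlongrightarrow> cinner u v) F"
proof -
  have "bounded_linear (\<lambda>u. cinner u v)"
    by (rule bounded_linear_intro[of _ "norm v"])
      (simp_all add: cinner_simps norm_cinner_le scaleR_conv_of_real)
  then show ?thesis using assms by (rule bounded_linear.tendsto)
qed

text \<open>Completeness lets the two infinite constructions below converge: the iterated compact
  perturbations and the iteration for the absolute value.\<close>

instance bop :: complete_space
proof
  fix X :: "nat \<Rightarrow> bop"
  assume X: "Cauchy X"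
  define f where "f u = lim (\<lambda>m. bop_apply (X m) u)" for u
  have f: "(\<lambda>m. bop_apply (X m) u) \<longlonglongrightarrow> f u" for u
  proof -
    have "bounded_linear (\<lambda>x. bop_apply x u)"
      by (rule bounded_linear_intro[of _ "norm u"]) (simp_all add: bop_norm_le)
    then have "Cauchy (\<lambda>m. bop_apply (X m) u)"
      using X by (rule bounded_linear.Cauchy)
    then show ?thesis unfolding f_def by (simp add: Cauchy_convergent_iff convergent_LIMSEQ_iff)
  qed
  have est: "norm (bop_apply (X m) u - f u) \<le> e * norm u"
    if M: "\<forall>n\<ge>M. norm (X m - X n) < e" for m M e u
  proof (rule LIMSEQ_le_const2)
    show "(\<lambda>n. norm (bop_apply (X m) u - bop_apply (X n) u)) \<longlonglongrightarrow> norm (bop_apply (X m) u - f u)"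
      by (intro tendsto_intros f)
    have "norm (bop_apply (X m) u - bop_apply (X n) u) \<le> e * norm u" if "n \<ge> M" for n
      using bop_norm_le[of "X m - X n" u] M that
      by (metis bop_simps(4) less_imp_le mult_right_mono norm_ge_zero order_trans)
    then show "\<exists>N. \<forall>n\<ge>N. norm (bop_apply (X m) u - bop_apply (X n) u) \<le> e * norm u" by blast
  qed
  have "bounded_linear f"
  proof -
    obtain M where M: "\<forall>m\<ge>M. \<forall>n\<ge>M. norm (X m - X n) < 1"
      using X CauchyD[of X 1] by auto
    show ?thesis
    proof (rule bounded_linear_intro[of _ "norm (X M) + 1"])
      fix u v :: ell2 and r :: real
      show "f (u + v) = f u + f v"
        using tendsto_add[OF f[of u] f[of v]] by (intro LIMSEQ_unique[OF f]) (simp add: bop_linear)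
      show "f (r *\<^sub>R u) = r *\<^sub>R f u"
        using tendsto_scaleR[OF tendsto_const f[of u]] by (intro LIMSEQ_unique[OF f]) (simp add: bop_linear)
      have "norm (f u) \<le> norm (bop_apply (X M) u) + norm (bop_apply (X M) u - f u)"
        by norm
      also have "\<dots> \<le> norm (X M) * norm u + 1 * norm u"
        by (intro add_mono bop_norm_le est[of M]) (use M in auto)
      finally show "norm (f u) \<le> norm u * (norm (X M) + 1)" by (simp add: algebra_simps)
    qed
  qed
  moreover have "f (scaleC_ell2 c u) = scaleC_ell2 c (f u)" for c u
    using bounded_linear.tendsto[OF bounded_linear_scaleC_ell2 f[of u], of c]
    by (intro LIMSEQ_unique[OF f]) (simp add: bop_scaleC)
  ultimately have nf: "bop_apply (Abs_bop f) = f" by (intro Abs_bop_inverse) simp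
  have "X \<longlonglongrightarrow> Abs_bop f"
  proof (rule LIMSEQ_I)
    fix r :: real assume "0 < r"
    then obtain M where M: "\<forall>m\<ge>M. \<forall>n\<ge>M. norm (X m - X n) < r/2"
      using X CauchyD[of X "r/2"] by auto
    have "norm (X m - Abs_bop f) \<le> r/2" if "m \<ge> M" for m
      by (rule bop_normI) (use est[of M m "r/2"] M that in \<open>auto simp: nf\<close>)
    then show "\<exists>no. \<forall>n\<ge>no. norm (X n - Abs_bop f) < r"
      using \<open>0 < r\<close> by (metis field_sum_of_halves le_less_trans less_add_same_cancel1 half_gt_zero)
  qed
  then show "convergent X" by (auto simp: convergent_def)
qed

instance bop :: banach ..

section \<open>Basis vectors and the adjoint\<close>

definition ebasis :: "nat \<Rightarrow> ell2" where
  "ebasis i = Abs_ell2 (\<lambda>n. if n = i then 1 else 0)"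

lemma ell2_nth_ebasis [simp]: "ell2_nth (ebasis i) n = (if n = i then 1 else 0)"
  unfolding ebasis_def
  by (subst ell2_nth_Abs) (auto intro!: summable_finite[of "{i}"] split: if_splits)

lemma cinner_ebasis_right: "cinner u (ebasis i) = ell2_nth u i"
proof -
  have "(\<lambda>n. ell2_nth u n * cnj (ell2_nth (ebasis i) n)) sums
      (\<Sum>n\<in>{i}. ell2_nth u n * cnj (ell2_nth (ebasis i) n))"
    by (rule sums_finite) auto
  then show ?thesis by (simp add: cinner_def sums_iff)
qed

lemma norm_ebasis [simp]: "norm (ebasis i) = 1"
proof -
  have "of_real ((norm (ebasis i))\<^sup>2) = (1 :: complex)"
    unfolding cinner_self[symmetric] by (simp add: cinner_ebasis_right)
  then have "(norm (ebasis i))\<^sup>2 = 1" by (metis of_real_eq_1_iff)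
  then show ?thesis using norm_ge_zero[of "ebasis i"] by (auto simp: power2_eq_1_iff)
qed

lemma cinner_ebasis_left: "cinner (ebasis i) u = cnj (ell2_nth u i)"
  by (subst cinner_commute) (simp add: cinner_ebasis_right)

text \<open>Riesz representation in coordinates: the adjoint must send \<open>v\<close> to the
  sequence \<open>g v\<close>. Testing \<open>x\<close> on the finite sum \<open>w\<close> of the
  \<open>g v i\<close> times basis vectors bounds \<open>norm w\<close> squared by
  \<open>norm x * norm v * norm w\<close>, whence \<open>g v\<close> is square summable.\<close>

lemma adj_exists: "\<exists>y. \<forall>u v. cinner (bop_apply x u) v = cinner u (bop_apply y v)"
proof -
  define g where "g v n = cinner v (bop_apply x (ebasis n))" for v n
  have part: "(\<Sum>i<k. (cmod (g v i))\<^sup>2) \<le> (norm x * norm v)\<^sup>2" for k v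
  proof -
    define S where "S = (\<Sum>i<k. (cmod (g v i))\<^sup>2)"
    define w where "w = (\<Sum>i<k. scaleC_ell2 (g v i) (ebasis i))"
    have nw: "(norm w)\<^sup>2 = S"
    proof -
      have "complex_of_real ((norm w)\<^sup>2) = (\<Sum>i<k. g v i * cnj (ell2_nth w i))"
        unfolding cinner_self[symmetric]
        by (subst (1) w_def) (simp add: cinner_sum_left cinner_scaleC_left cinner_ebasis_left)
      also have "\<dots> = (\<Sum>i<k. g v i * cnj (g v i))"
        by (rule sum.cong) (auto simp: w_def ell2_nth_sum if_distrib sum.delta cong: if_cong)
      also have "\<dots> = of_real S" unfolding S_def of_real_sum
        by (intro sum.cong complex_norm_square[symmetric]) simp
      finally show ?thesis by (simp only: of_real_eq_iff)
    qed
    have "cinner v (bop_apply x w) = (\<Sum>i<k. cnj (g v i) * g v i)"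
      by (simp add: w_def bop_linear bop_scaleC cinner_sum_right cinner_scaleC_right g_def)
    also have "\<dots> = of_real S"
      unfolding S_def of_real_sum
      by (intro sum.cong) (simp_all only: complex_norm_square mult.commute)
    finally have "S \<le> norm v * norm (bop_apply x w)"
      using norm_cinner_le[of v "bop_apply x w"] by simp
    also have "\<dots> \<le> norm v * (norm x * norm w)"
      by (intro mult_left_mono bop_norm_le) simp
    finally have "(norm w)\<^sup>2 \<le> (norm x * norm v) * norm w" by (simp add: nw ac_simps)
    then have "norm w \<le> norm x * norm v"
      by (cases "norm w = 0") (simp_all add: power2_eq_square)
    then have "(norm w)\<^sup>2 \<le> (norm x * norm v)\<^sup>2" by (intro power_mono) simp_all
    then show ?thesis by (simp add: nw S_def)
  qed
  have sm: "summable (\<lambda>n. (cmod (g v n))\<^sup>2)" for v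
    by (rule summableI_nonneg_bounded[where x = "(norm x * norm v)\<^sup>2"]) (use part in auto)
  define f where "f v = Abs_ell2 (g v)" for v
  have nf: "ell2_nth (f v) = g v" for v unfolding f_def by (rule ell2_nth_Abs[OF sm])
  have "bounded_linear f"
  proof (rule bounded_linear_intro[of _ "norm x"])
    fix u v :: ell2 and r :: real
    show "f (u + v) = f u + f v" by (rule ell2_eqI) (simp add: nf g_def cinner_simps)
    show "f (r *\<^sub>R u) = r *\<^sub>R f u" by (rule ell2_eqI) (simp add: nf g_def cinner_simps)
    show "norm (f u) \<le> norm u * norm x"
      by (rule ell2_normI) (use part[of u] in \<open>auto simp: nf mult.commute\<close>)
  qed
  moreover have "f (scaleC_ell2 c u) = scaleC_ell2 c (f u)" for c u
    by (rule ell2_eqI) (simp add: nf g_def cinner_simps)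
  ultimately have nb: "bop_apply (Abs_bop f) = f" by (intro Abs_bop_inverse) simp
  have "cinner (bop_apply x u) v = cinner u (f v)" for u v
  proof -
    define un where "un k = (\<Sum>i<k. scaleC_ell2 (ell2_nth u i) (ebasis i))" for k
    have unth: "ell2_nth (un k) i = (if i < k then ell2_nth u i else 0)" for k i
      by (simp add: un_def ell2_nth_sum if_distrib sum.delta cong: if_cong)
    have "un \<longlonglongrightarrow> u"
    proof (rule LIMSEQ_I)
      fix r :: real assume r: "0 < r"
      obtain M where M: "\<forall>n\<ge>M. norm (\<Sum>i. (cmod (ell2_nth u (i + n)))\<^sup>2) < r\<^sup>2"
        using suminf_exist_split[where r = "r\<^sup>2" and f = "\<lambda>n. (cmod (ell2_nth u n))\<^sup>2"]
        ell2_summable r by auto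
      have "norm (un n - u) < r" if "n \<ge> M" for n
      proof -
        have "(norm (un n - u))\<^sup>2 = (\<Sum>i. (cmod (ell2_nth (un n - u) (i + n)))\<^sup>2)
            + (\<Sum>i<n. (cmod (ell2_nth (un n - u) i))\<^sup>2)"
          unfolding norm_ell2_sq by (rule suminf_split_initial_segment[OF ell2_summable])
        also have "\<dots> = (\<Sum>i. (cmod (ell2_nth u (i + n)))\<^sup>2)" by (simp add: unth)
        also have "\<dots> < r\<^sup>2" using M that by (metis abs_ge_self le_less_trans real_norm_def)
        finally show ?thesis using r power_less_imp_less_base by fastforce
      qed
      then show "\<exists>no. \<forall>n\<ge>no. norm (un n - u) < r" by blast
    qed
    then have l1: "(\<lambda>k. cinner (un k) (f v)) \<longlonglongrightarrow> cinner u (f v)"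
      by (rule cinner_tendsto)
    have "(\<lambda>k. bop_apply x (un k)) \<longlonglongrightarrow> bop_apply x u"
      using \<open>un \<longlonglongrightarrow> u\<close> by (rule bounded_linear.tendsto[OF bop_bounded_linear])
    then have l2: "(\<lambda>k. cinner (bop_apply x (un k)) v) \<longlonglongrightarrow> cinner (bop_apply x u) v"
      by (rule cinner_tendsto)
    have "cinner (bop_apply x (un k)) v = cinner (un k) (f v)" for k
    proof -
      have "cinner (bop_apply x (un k)) v = (\<Sum>i<k. ell2_nth u i * cinner (bop_apply x (ebasis i)) v)"
        by (simp add: un_def bop_linear bop_scaleC cinner_sum_left cinner_scaleC_left)
      also have "\<dots> = (\<Sum>i<k. ell2_nth u i * cnj (g v i))"
        by (simp add: g_def flip: cinner_commute)
      also have "\<dots> = cinner (un k) (f v)"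
        by (simp add: un_def cinner_sum_left cinner_scaleC_left cinner_ebasis_left nf)
      finally show ?thesis .
    qed
    with l1 l2 show ?thesis using LIMSEQ_unique by fastforce
  qed
  then show ?thesis by (intro exI[of _ "Abs_bop f"]) (simp add: nb)
qed

lemma cinner_eqI: "(\<And>u. cinner u v = cinner u w) \<Longrightarrow> v = w"
  by (rule ell2_eqI) (metis cinner_ebasis_left complex_cnj_cancel_iff)

lemma cinner_adj: "cinner (bop_apply x u) v = cinner u (bop_apply (adj x) v)"
proof -
  obtain y where y: "\<forall>u v. cinner (bop_apply x u) v = cinner u (bop_apply y v)"
    using adj_exists by blast
  have "adj x = y"
    unfolding adj_def
    by (rule the_equality[where a = y]) (use y in \<open>auto intro!: bop_eqI cinner_eqI\<close>)
  with y show ?thesis by blast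
qed

lemma cinner_adj2: "cinner (bop_apply (adj x) u) v = cinner u (bop_apply x v)"
  by (metis cinner_adj cinner_commute)

lemma adjI:
  assumes "\<And>u v. cinner (bop_apply x u) v = cinner u (bop_apply y v)"
  shows "adj x = y"
  by (intro bop_eqI cinner_eqI) (simp flip: assms add: cinner_adj)

lemma adj_adj [simp]: "adj (adj x) = x"
  by (rule adjI) (rule cinner_adj2)

lemma adj_add: "adj (x + y) = adj x + adj y"
  by (rule adjI) (simp add: cinner_simps cinner_adj)

lemma adj_diff: "adj (x - y) = adj x - adj y"
  by (rule adjI) (simp add: cinner_simps cinner_adj)

lemma adj_mult: "adj (x * y) = adj y * adj x"
  by (rule adjI) (simp add: cinner_adj)

lemma adj_scaleR: "adj (r *\<^sub>R x) = r *\<^sub>R adj x"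
  by (rule adjI) (simp add: cinner_simps cinner_adj)

lemma adj_scaleC: "adj (scaleC_bop c x) = scaleC_bop (cnj c) (adj x)"
  by (rule adjI) (simp add: cinner_simps cinner_adj)

lemma adj_one [simp]: "adj 1 = 1"
  by (rule adjI) simp

lemma norm_adj_le: "norm (adj x) \<le> norm x"
proof (rule bop_normI)
  fix u
  let ?a = "norm (bop_apply (adj x) u)"
  have "?a\<^sup>2 = Re (cinner (bop_apply x (bop_apply (adj x) u)) u)"
    by (simp add: cinner_adj cinner_self)
  also have "\<dots> \<le> cmod (cinner (bop_apply x (bop_apply (adj x) u)) u)" by (rule complex_Re_le_cmod)
  also have "\<dots> \<le> norm (bop_apply x (bop_apply (adj x) u)) * norm u" by (rule norm_cinner_le)
  also have "\<dots> \<le> (norm x * ?a) * norm u" by (intro mult_right_mono bop_norm_le) simp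
  finally have "?a * ?a \<le> (norm x * norm u) * ?a" by (simp add: power2_eq_square ac_simps)
  then show "?a \<le> norm x * norm u"
    by (cases "?a = 0") simp_all
qed

lemma norm_adj [simp]: "norm (adj x) = norm x"
  using norm_adj_le[of x] norm_adj_le[of "adj x"] by simp

text \<open>Meaningful only for bounded \<open>d\<close>, since \<open>Abs_ell2\<close> and
  \<open>Abs_bop\<close> have to be applied inside their carriers. The facts below assume entries of
  modulus at most 1, which gives self-adjoint contractions.\<close>

definition diag_op :: "(nat \<Rightarrow> real) \<Rightarrow> bop" where
  "diag_op d = Abs_bop (\<lambda>u. Abs_ell2 (\<lambda>n. of_real (d n) * ell2_nth u n))"

context
  fixes d :: "nat \<Rightarrow> real"
  assumes d: "\<And>n. \<bar>d n\<bar> \<le> 1"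
begin

lemma diag_op_le: "(cmod (of_real (d n) * z))\<^sup>2 \<le> (cmod z)\<^sup>2"
  using d[of n] by (intro power_mono) (auto simp: norm_mult intro: mult_left_le_one_le)

lemma diag_op_apply: "ell2_nth (bop_apply (diag_op d) u) n = of_real (d n) * ell2_nth u n"
proof -
  define f where "f u = Abs_ell2 (\<lambda>n. of_real (d n) * ell2_nth u n)" for u
  have nf: "ell2_nth (f u) n = of_real (d n) * ell2_nth u n" for u n
    unfolding f_def
    by (subst ell2_nth_Abs) (auto intro: summable_comparison_test'[OF ell2_summable[of u]]
        simp: diag_op_le)
  have "bounded_linear f"
  proof (rule bounded_linear_intro[of _ 1])
    fix u v :: ell2 and r :: real
    show "f (u + v) = f u + f v" by (rule ell2_eqI) (simp add: nf algebra_simps)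
    show "f (r *\<^sub>R u) = r *\<^sub>R f u" by (rule ell2_eqI) (simp add: nf algebra_simps)
    have "(\<Sum>i<n. (cmod (ell2_nth (f u) i))\<^sup>2) \<le> (norm u)\<^sup>2" for n
      by (rule order_trans[OF sum_mono ell2_partial_norm]) (simp add: nf diag_op_le)
    then show "norm (f u) \<le> norm u * 1" by (auto intro: ell2_normI)
  qed
  moreover have "f (scaleC_ell2 c u) = scaleC_ell2 c (f u)" for c u
    by (rule ell2_eqI) (simp add: nf)
  ultimately have "bop_apply (Abs_bop f) = f" by (intro Abs_bop_inverse) simp
  then show ?thesis by (simp add: diag_op_def f_def[symmetric, abs_def] nf)
qed

lemma diag_op_cinner: "cinner (bop_apply (diag_op d) u) v = cinner u (bop_apply (diag_op d) v)"
  by (simp add: cinner_def diag_op_apply ac_simps)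

lemma adj_diag_op: "adj (diag_op d) = diag_op d"
  by (rule adjI) (rule diag_op_cinner)

lemma norm_diag_op_apply: "norm (bop_apply (diag_op d) u) \<le> norm u"
proof -
  have "(\<Sum>i<n. (cmod (ell2_nth (bop_apply (diag_op d) u) i))\<^sup>2) \<le> (norm u)\<^sup>2" for n
    by (rule order_trans[OF sum_mono ell2_partial_norm]) (simp add: diag_op_apply diag_op_le)
  then show ?thesis by (auto intro: ell2_normI)
qed

lemma norm_diag_op: "norm (diag_op d) \<le> 1"
  by (rule bop_normI) (simp add: norm_diag_op_apply)

end

lemma norm_diag_op_Pythagoras:
  assumes "\<And>n. (c n)\<^sup>2 + (d n)\<^sup>2 = 1"
  shows "(norm (bop_apply (diag_op c) u))\<^sup>2 + (norm (bop_apply (diag_op d) u))\<^sup>2 = (norm u)\<^sup>2"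
proof -
  have c: "\<bar>c n\<bar> \<le> 1" for n
    using assms[of n] zero_le_power2[of "d n"] abs_square_le_1[of "c n"] by linarith
  have d: "\<bar>d n\<bar> \<le> 1" for n
    using assms[of n] zero_le_power2[of "c n"] abs_square_le_1[of "d n"] by linarith
  have "(cmod (of_real (c n) * z))\<^sup>2 + (cmod (of_real (d n) * z))\<^sup>2 = (cmod z)\<^sup>2" for n z
    using assms[of n] by (simp add: norm_mult power_mult_distrib flip: distrib_right)
  then show ?thesis
    unfolding norm_ell2_sq suminf_add[OF ell2_summable ell2_summable]
    by (simp add: diag_op_apply[OF c] diag_op_apply[OF d])
qed

section \<open>Head and tail projections\<close>

definition head :: "nat \<Rightarrow> bop" where "head m = diag_op (\<lambda>n. if n < m then 1 else 0)"
definition tail :: "nat \<Rightarrow> bop" where "tail m = diag_op (\<lambda>n. if n < m then 0 else 1)"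

lemma head_nth [simp]: "ell2_nth (bop_apply (head m) u) n = (if n < m then ell2_nth u n else 0)"
  unfolding head_def by (subst diag_op_apply) auto

lemma tail_nth [simp]: "ell2_nth (bop_apply (tail m) u) n = (if n < m then 0 else ell2_nth u n)"
  unfolding tail_def by (subst diag_op_apply) auto

lemma adj_head [simp]: "adj (head m) = head m"
  unfolding head_def by (rule adj_diag_op) simp

lemma adj_tail [simp]: "adj (tail m) = tail m"
  unfolding tail_def by (rule adj_diag_op) simp

lemma norm_tail: "norm (tail m) \<le> 1"
  unfolding tail_def by (rule norm_diag_op) simp

lemma head_eq: "head m = 1 - tail m"
  by (intro bop_eqI ell2_eqI) simp

lemma tail_tail: "m \<le> n \<Longrightarrow> tail m * tail n = tail n"
  by (intro bop_eqI ell2_eqI) simp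

lemma norm_tail_apply: "norm (bop_apply (tail m) u) \<le> norm u"
  using bop_norm_le[of "tail m" u] mult_right_mono[OF norm_tail[of m] norm_ge_zero[of u]] by simp

lemma head_sum: "bop_apply (head m) u = (\<Sum>i<m. scaleC_ell2 (ell2_nth u i) (ebasis i))"
  by (rule ell2_eqI) (simp add: ell2_nth_sum if_distrib sum.delta cong: if_cong)

lemma tail_tendsto: "(\<lambda>m. bop_apply (tail m) u) \<longlonglongrightarrow> 0"
proof (rule LIMSEQ_I)
  fix r :: real assume r: "0 < r"
  obtain M where M: "\<forall>n\<ge>M. norm (\<Sum>i. (cmod (ell2_nth u (i + n)))\<^sup>2) < r\<^sup>2"
    using suminf_exist_split[where r = "r\<^sup>2" and f = "\<lambda>n. (cmod (ell2_nth u n))\<^sup>2"]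
      ell2_summable r by auto
  have "norm (bop_apply (tail n) u) < r" if "n \<ge> M" for n
  proof -
    have "(norm (bop_apply (tail n) u))\<^sup>2 = (\<Sum>i. (cmod (ell2_nth (bop_apply (tail n) u) (i + n)))\<^sup>2)
        + (\<Sum>i<n. (cmod (ell2_nth (bop_apply (tail n) u) i))\<^sup>2)"
      unfolding norm_ell2_sq by (rule suminf_split_initial_segment[OF ell2_summable])
    also have "\<dots> = (\<Sum>i. (cmod (ell2_nth u (i + n)))\<^sup>2)" by simp
    also have "\<dots> < r\<^sup>2" using M that by (metis abs_ge_self le_less_trans real_norm_def)
    finally show ?thesis using r power_less_imp_less_base by fastforce
  qed
  then show "\<exists>no. \<forall>n\<ge>no. norm (bop_apply (tail n) u - 0) < r" by auto
qed

text \<open>The tails tend to 0 only pointwise, but \<open>head n\<close> has finite rank, so the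
  norm is controlled by finitely many vectors.\<close>

lemma tail_mult_head_tendsto: "(\<lambda>m. norm (tail m * y * head n)) \<longlonglongrightarrow> 0"
proof (rule Lim_null_comparison)
  let ?g = "\<lambda>m. \<Sum>i<n. norm (bop_apply (tail m) (bop_apply y (ebasis i)))"
  have "norm (tail m * y * head n) \<le> ?g m" for m
  proof (rule bop_normI)
    fix u
    have "bop_apply (tail m * y * head n) u =
        (\<Sum>i<n. scaleC_ell2 (ell2_nth u i) (bop_apply (tail m) (bop_apply y (ebasis i))))"
      by (simp add: head_sum bop_linear bop_scaleC)
    also have "norm \<dots> \<le> (\<Sum>i<n. norm u * norm (bop_apply (tail m) (bop_apply y (ebasis i))))"
      by (intro order_trans[OF norm_sum] sum_mono)
        (simp add: norm_scaleC_ell2 ell2_nth_bound mult_right_mono)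
    finally show "norm (bop_apply (tail m * y * head n) u) \<le> ?g m * norm u"
      by (simp add: sum_distrib_left mult.commute)
  qed
  then show "\<forall>\<^sub>F m in sequentially. norm (norm (tail m * y * head n)) \<le> ?g m" by simp
  have "?g \<longlonglongrightarrow> (\<Sum>i<n. 0)" by (intro tendsto_sum tendsto_norm_zero tail_tendsto)
  then show "?g \<longlonglongrightarrow> 0" by simp
qed

lemma head_mult_tail_tendsto: "(\<lambda>m. norm (head n * y * tail m)) \<longlonglongrightarrow> 0"
proof -
  have "norm (head n * y * tail m) = norm (tail m * adj y * head n)" for m
    using norm_adj[of "head n * y * tail m"] by (simp add: adj_mult mult.assoc)
  then show ?thesis using tail_mult_head_tendsto[of "adj y" n] by simp
qed

lemma norm_mult_tail_mono:
  assumes "m \<le> n" shows "norm (k * tail n) \<le> norm (k * tail m)"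
proof -
  have "k * tail n = (k * tail m) * tail n" by (simp add: mult.assoc tail_tail assms)
  also have "norm \<dots> \<le> norm (k * tail m) * 1"
    by (intro order_trans[OF norm_mult_ineq] mult_left_mono norm_tail) simp
  finally show ?thesis by simp
qed

text \<open>The tail projection can be moved to the fixed vector \<open>w\<close>, whose tails tend
  to 0.\<close>

lemma weakly_null_tail:
  assumes "\<And>m. bop_apply (tail m) (\<xi> m) = \<xi> m" "\<And>m. norm (\<xi> m) \<le> 1"
  shows "(\<lambda>m. cinner (\<xi> m) w) \<longlonglongrightarrow> 0"
proof (rule Lim_null_comparison)
  have "norm (cinner (\<xi> m) w) \<le> norm (bop_apply (tail m) w)" for m
  proof -
    have "cinner (\<xi> m) w = cinner (\<xi> m) (bop_apply (tail m) w)"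
      using cinner_adj[of "tail m" "\<xi> m" w] by (simp add: assms(1))
    also have "norm \<dots> \<le> norm (\<xi> m) * norm (bop_apply (tail m) w)" by (rule norm_cinner_le)
    also have "\<dots> \<le> 1 * norm (bop_apply (tail m) w)" by (intro mult_right_mono assms) simp
    finally show ?thesis by simp
  qed
  then show "\<forall>\<^sub>F m in sequentially. norm (cinner (\<xi> m) w) \<le> norm (bop_apply (tail m) w)" by simp
qed (rule tendsto_norm_zero[OF tail_tendsto])

section \<open>Compactness as decay on the tails\<close>

lemma bop_norm_witness:
  assumes "e < norm x" "0 \<le> e"
  obtains u where "norm u = 1" "e < norm (bop_apply x u)"
proof -
  have "\<exists>u. \<not> norm (bop_apply x u) \<le> e * norm u"
    using bop_normI[of x e] assms by force
  then obtain u where u: "e * norm u < norm (bop_apply x u)" by (auto simp: not_le)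
  then have "u \<noteq> 0" using bop_linear(1) by auto
  have "norm (bop_apply x (inverse (norm u) *\<^sub>R u)) = inverse (norm u) * norm (bop_apply x u)"
    by (simp add: bop_linear)
  also have "\<dots> > e" using u \<open>u \<noteq> 0\<close> by (simp add: field_simps)
  finally show ?thesis using that[of "inverse (norm u) *\<^sub>R u"] \<open>u \<noteq> 0\<close> by simp
qed

lemma norm_mult_tail_tendsto_0I:
  assumes "\<And>e. 0 < e \<Longrightarrow> \<exists>m. norm (k * tail m) \<le> e"
  shows "(\<lambda>m. norm (k * tail m)) \<longlonglongrightarrow> 0"
proof (rule LIMSEQ_I)
  fix r :: real assume "0 < r"
  then obtain m where m: "norm (k * tail m) \<le> r/2" using assms[of "r/2"] by auto
  have "norm (norm (k * tail n) - 0) < r" if "n \<ge> m" for n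
    using norm_mult_tail_mono[OF that, of k] m \<open>0 < r\<close> by simp
  then show "\<exists>no. \<forall>n\<ge>no. norm (norm (k * tail n) - 0) < r" by blast
qed

text \<open>The norms decrease with \<open>m\<close>, so if they do not tend to 0 they are bounded
  away from 0 for every \<open>m\<close>.\<close>

lemma norm_mult_tail_witness:
  assumes "\<not> (\<lambda>m. norm (k * tail m)) \<longlonglongrightarrow> 0"
  obtains e \<xi> where "0 < e" "\<And>m. bop_apply (tail m) (\<xi> m) = \<xi> m" "\<And>m. norm (\<xi> m) \<le> 1"
    "\<And>m. e < norm (bop_apply k (\<xi> m))"
proof -
  obtain e where e: "0 < e" "\<And>m. e < norm (k * tail m)"
    using norm_mult_tail_tendsto_0I[of k] assms by (meson not_le_imp_less)
  have "\<exists>u. norm u = 1 \<and> e < norm (bop_apply (k * tail m) u)" for m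
    using bop_norm_witness[of e "k * tail m"] e by (metis less_imp_le)
  then obtain u where u: "\<And>m. norm (u m) = 1" "\<And>m. e < norm (bop_apply (k * tail m) (u m))"
    by metis
  show ?thesis
  proof (rule that[of e "\<lambda>m. bop_apply (tail m) (u m)"])
    show "bop_apply (tail m) (bop_apply (tail m) (u m)) = bop_apply (tail m) (u m)" for m
      using tail_tail[of m m] by (metis bop_simps(6) order_refl)
    show "norm (bop_apply (tail m) (u m)) \<le> 1" for m
      using norm_tail_apply[of m "u m"] u(1)[of m] by simp
  qed (use e u in auto)
qed

text \<open>Together with \<open>compact_opI\<close> this replaces the topological definition of
  compactness by decay on the tails. Unit ball vectors far out tend weakly to 0; a subsequence of
  their images converges in norm, necessarily to 0.\<close>

lemma compact_op_tail:
  assumes "compact_op k" shows "(\<lambda>m. norm (k * tail m)) \<longlonglongrightarrow> 0"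
proof (rule ccontr)
  assume "\<not> (\<lambda>m. norm (k * tail m)) \<longlonglongrightarrow> 0"
  then obtain e \<xi> where e: "0 < e" "\<And>m. bop_apply (tail m) (\<xi> m) = \<xi> m" "\<And>m. norm (\<xi> m) \<le> 1"
    "\<And>m. e < norm (bop_apply k (\<xi> m))" by (rule norm_mult_tail_witness) blast
  have "bop_apply k (\<xi> m) \<in> closure (bop_apply k ` cball 0 1)" for m
    using e(3)[of m] by (intro subsetD[OF closure_subset]) auto
  moreover have "seq_compact (closure (bop_apply k ` cball 0 1))"
    using assms by (simp add: compact_op_def compact_imp_seq_compact)
  ultimately obtain l r where r: "strict_mono r" "((\<lambda>m. bop_apply k (\<xi> m)) \<circ> r) \<longlonglongrightarrow> l"
    by (metis seq_compactE)
  have "(\<lambda>m. cinner (bop_apply k (\<xi> m)) l) \<longlonglongrightarrow> 0"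
    using weakly_null_tail[OF e(2,3)] by (simp add: cinner_adj)
  then have "(\<lambda>m. cinner (bop_apply k (\<xi> (r m))) l) \<longlonglongrightarrow> 0"
    using LIMSEQ_subseq_LIMSEQ[OF _ r(1)] by (fastforce simp: o_def)
  moreover have "(\<lambda>m. cinner (bop_apply k (\<xi> (r m))) l) \<longlonglongrightarrow> cinner l l"
    using cinner_tendsto[OF r(2)] by (simp add: o_def)
  ultimately have "cinner l l = 0" using LIMSEQ_unique by blast
  then have "l = 0" by (simp add: cinner_self)
  then have "(\<lambda>m. norm (bop_apply k (\<xi> (r m)))) \<longlonglongrightarrow> 0"
    using tendsto_norm[OF r(2)] by (simp add: o_def)
  then have "e \<le> 0" by (rule LIMSEQ_le_const) (use e(4) in \<open>auto intro: less_imp_le\<close>)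
  with e(1) show False by simp
qed

text \<open>The image of the unit ball lies within \<open>norm (k * tail m)\<close> of the compact
  set \<open>C m\<close>, the combinations of finitely many images of basis vectors with
  coefficients in the unit disc. It is therefore totally bounded, and its closure is
  complete.\<close>

lemma compact_opI:
  assumes "(\<lambda>m. norm (k * tail m)) \<longlonglongrightarrow> 0" shows "compact_op k"
proof -
  define S where "S = bop_apply k ` cball 0 1"
  define C where "C m = {\<Sum>i<m. scaleC_ell2 (c i) (bop_apply k (ebasis i)) | c. \<forall>i<m. c i \<in> cball 0 1}"
    for m
  have C: "compact (C m)" for m
  proof (induction m)
    case 0
    have "C 0 = {0}" by (auto simp: C_def)
    then show ?case by simp
  next
    case (Suc m)
    have eq: "C (Suc m) = {a + b | a b. a \<in> C m \<and>
        b \<in> (\<lambda>z. scaleC_ell2 z (bop_apply k (ebasis m))) ` cball 0 1}" (is "_ = ?R")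
    proof (intro equalityI subsetI)
      fix v assume "v \<in> C (Suc m)"
      then obtain c where "\<forall>i<Suc m. c i \<in> cball 0 1"
        "v = (\<Sum>i<Suc m. scaleC_ell2 (c i) (bop_apply k (ebasis i)))"
        unfolding C_def by blast
      then show "v \<in> ?R"
        unfolding C_def mem_Collect_eq
        by (intro exI[of _ "\<Sum>i<m. scaleC_ell2 (c i) (bop_apply k (ebasis i))"]
            exI[of _ "scaleC_ell2 (c m) (bop_apply k (ebasis m))"] conjI exI[of _ c]) auto
    next
      fix v assume "v \<in> ?R"
      then obtain c z where "\<forall>i<m. c i \<in> cball 0 1" "z \<in> cball 0 1"
        "v = (\<Sum>i<m. scaleC_ell2 (c i) (bop_apply k (ebasis i))) + scaleC_ell2 z (bop_apply k (ebasis m))"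
        by (auto simp: C_def)
      then show "v \<in> C (Suc m)"
        unfolding C_def mem_Collect_eq by (intro exI[of _ "c(m := z)"]) auto
    qed
    have "bounded_linear (\<lambda>z. scaleC_ell2 z v)" for v
      by (rule bounded_linear_intro[of _ "norm v"])
        (auto intro: ell2_eqI simp: norm_scaleC_ell2 algebra_simps scaleR_conv_of_real)
    then have "compact ((\<lambda>z. scaleC_ell2 z v) ` cball 0 1)" for v
      by (intro compact_continuous_image linear_continuous_on) auto
    from compact_sums[OF Suc.IH this] show ?case unfolding eq .
  qed
  have near: "\<exists>w\<in>C m. norm (v - w) \<le> norm (k * tail m)" if "v \<in> S" for v m
  proof -
    from that obtain u where u: "norm u \<le> 1" "v = bop_apply k u" by (auto simp: S_def)
    let ?w = "bop_apply k (bop_apply (head m) u)"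
    have "?w \<in> C m"
      using order_trans[OF ell2_nth_bound u(1)]
      by (auto simp: C_def head_sum bop_linear bop_scaleC)
    moreover have "v - ?w = bop_apply (k * tail m) u" by (simp add: u head_eq bop_linear)
    moreover have "norm (bop_apply (k * tail m) u) \<le> norm (k * tail m) * 1"
      by (intro order_trans[OF bop_norm_le] mult_left_mono u) simp
    ultimately show ?thesis by (metis mult.right_neutral)
  qed
  have tb: "\<exists>F. finite F \<and> closure S \<subseteq> (\<Union>x\<in>F. ball x e)" if "0 < e" for e :: real
  proof -
    from order_tendstoD(2)[OF assms, of "e/4"] that obtain m where m: "norm (k * tail m) < e/4"
      by (auto simp: eventually_sequentially)
    have "e/4 > 0" using that by simp
    then obtain F where F: "finite F" "C m \<subseteq> (\<Union>x\<in>F. ball x (e/4))"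
      using C[of m] unfolding compact_eq_totally_bounded by blast
    have "S \<subseteq> (\<Union>x\<in>F. cball x (e/2))"
    proof
      fix v assume "v \<in> S"
      then obtain w where w: "w \<in> C m" "norm (v - w) \<le> norm (k * tail m)" using near by blast
      then obtain x where x: "x \<in> F" "dist x w < e/4" using F(2) by auto
      have "dist x v \<le> dist x w + dist w v" by (rule dist_triangle)
      also have "dist w v \<le> e/4" using w(2) m by (simp add: dist_norm norm_minus_commute)
      finally show "v \<in> (\<Union>x\<in>F. cball x (e/2))" using x by (auto intro!: bexI[of _ x])
    qed
    moreover have "closed (\<Union>x\<in>F. cball x (e/2))" using F(1) by auto
    ultimately have "closure S \<subseteq> (\<Union>x\<in>F. cball x (e/2))" by (rule closure_minimal)
    also have "\<dots> \<subseteq> (\<Union>x\<in>F. ball x e)"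
      using that by (intro UN_mono order_refl) (simp add: subset_iff)
    finally show ?thesis using F(1) by blast
  qed
  have "complete (closure S)" by (simp add: complete_eq_closed)
  with tb have "compact (closure S)" unfolding compact_eq_totally_bounded by blast
  then show ?thesis by (simp add: compact_op_def S_def)
qed

lemma compact_op_add:
  assumes "compact_op k" "compact_op l" shows "compact_op (k + l)"
proof (rule compact_opI, rule Lim_null_comparison)
  show "\<forall>\<^sub>F m in sequentially. norm (norm ((k + l) * tail m)) \<le> norm (k * tail m) + norm (l * tail m)"
    by (simp add: distrib_right norm_triangle_ineq)
  show "(\<lambda>m. norm (k * tail m) + norm (l * tail m)) \<longlonglongrightarrow> 0"
    using tendsto_add[OF assms[THEN compact_op_tail]] by simp
qed

lemma compact_op_head_left: "compact_op (head n * y)"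
  by (rule compact_opI) (rule head_mult_tail_tendsto)

lemma compact_op_head_right: "compact_op (y * head n)"
proof (rule compact_opI)
  have "head n * tail m = 0" if "m \<ge> n" for m
    using that by (intro bop_eqI ell2_eqI) simp
  then have "y * head n * tail m = 0" if "m \<ge> n" for m
    using that by (simp add: mult.assoc)
  then show "(\<lambda>m. norm (y * head n * tail m)) \<longlonglongrightarrow> 0"
    by (intro tendsto_eventually eventually_sequentiallyI[of n]) simp
qed

lemma compact_op_limit:
  assumes "\<And>n. compact_op (K n)" "K \<longlonglongrightarrow> k" shows "compact_op k"
proof (rule compact_opI, rule norm_mult_tail_tendsto_0I)
  fix e :: real assume "0 < e"
  then obtain n where "norm (K n - k) < e/2"
    using LIMSEQ_D[OF assms(2), of "e/2"] by auto
  then have n: "norm (k - K n) < e/2" by (simp add: norm_minus_commute)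
  obtain m where m: "norm (K n * tail m) < e/2"
    using order_tendstoD(2)[OF compact_op_tail[OF assms(1)], of "e/2" n] \<open>0 < e\<close>
    by (auto simp: eventually_sequentially)
  have "k * tail m = (k - K n) * tail m + K n * tail m" by (simp add: algebra_simps)
  also have "norm \<dots> \<le> norm ((k - K n) * tail m) + norm (K n * tail m)" by (rule norm_triangle_ineq)
  also have "norm ((k - K n) * tail m) \<le> norm (k - K n) * 1"
    by (intro order_trans[OF norm_mult_ineq] mult_left_mono norm_tail) simp
  finally show "\<exists>m. norm (k * tail m) \<le> e" using n m by (intro exI[of _ m]) simp
qed

section \<open>The disc\<close>

definition elem_op :: "nat \<Rightarrow> nat \<Rightarrow> bop" where
  "elem_op i j = Abs_bop (\<lambda>u. scaleC_ell2 (ell2_nth u j) (ebasis i))"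

lemma elem_op_apply [simp]: "bop_apply (elem_op i j) u = scaleC_ell2 (ell2_nth u j) (ebasis i)"
proof -
  let ?f = "\<lambda>u. scaleC_ell2 (ell2_nth u j) (ebasis i)"
  have "bounded_linear ?f"
    by (rule bounded_linear_intro[of _ 1])
      (auto intro!: ell2_eqI simp: algebra_simps norm_scaleC_ell2 ell2_nth_bound)
  moreover have "?f (scaleC_ell2 c u) = scaleC_ell2 c (?f u)" for c u
    by (rule ell2_eqI) simp
  ultimately show ?thesis unfolding elem_op_def by (subst Abs_bop_inverse) auto
qed

text \<open>A matrix is placed on the first \<open>n\<close> coordinates, so that its operator norm
  and its powers are those of \<open>bop\<close>.\<close>

definition mat_bop :: "nat \<Rightarrow> (nat \<Rightarrow> nat \<Rightarrow> complex) \<Rightarrow> bop" where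
  "mat_bop n a = (\<Sum>i<n. \<Sum>j<n. scaleC_bop (a i j) (elem_op i j))"

lemma cinner_mat_bop: "cinner (bop_apply (mat_bop n a) u) v = frm {..<n} a (ell2_nth u) (ell2_nth v)"
  by (simp add: mat_bop_def bop_sum cinner_sum_left cinner_scaleC_left cinner_ebasis_left frm_def mult.assoc)

lemma cinner_frame:
  "cinner (bop_apply y (\<Sum>i<n. scaleC_ell2 (x i) (e i))) (\<Sum>i<n. scaleC_ell2 (x' i) (e i))
    = frm {..<n} (\<lambda>i j. cinner (bop_apply y (e j)) (e i)) x x'"
  by (simp add: bop_linear bop_scaleC cinner_sum_left cinner_sum_right
      cinner_scaleC_left cinner_scaleC_right sum_distrib_left frm_def ac_simps)

definition vec_ell2 :: "nat \<Rightarrow> (nat \<Rightarrow> complex) \<Rightarrow> ell2" where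
  "vec_ell2 n x = (\<Sum>i<n. scaleC_ell2 (x i) (ebasis i))"

lemma cinner_vec_ell2:
  "cinner (bop_apply y (vec_ell2 n x)) (vec_ell2 n x') = frm {..<n} (\<lambda>i k. cinner (bop_apply y (ebasis k)) (ebasis i)) x x'"
  unfolding vec_ell2_def by (rule cinner_frame)

lemma norm_vec_ell2: "of_real ((norm (vec_ell2 n x))\<^sup>2) = frm {..<n} unitk x x"
proof -
  have "of_real ((norm (vec_ell2 n x))\<^sup>2) = frm {..<n} (\<lambda>i k. cinner (bop_apply 1 (ebasis k)) (ebasis i)) x x"
    unfolding cinner_self[symmetric] cinner_vec_ell2[symmetric] by simp
  also have "\<dots> = frm {..<n} unitk x x"
    by (rule frm_cong) (auto simp: cinner_ebasis_right)
  finally show ?thesis .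
qed

lemma contraction_of_tests:
  assumes "\<And>u v. 0 \<le> (norm u)\<^sup>2 + (norm v)\<^sup>2 + 2 * Re (cinner (bop_apply y u) v)"
  shows "norm y \<le> 1"
proof (rule bop_normI)
  fix u
  let ?w = "bop_apply y u"
  show "norm ?w \<le> 1 * norm u"
  proof (cases "?w = 0 \<or> u = 0")
    case True
    then show ?thesis by (auto simp: bop_linear)
  next
    case False
    then have pos: "norm ?w > 0" "norm u > 0" by auto
    \<comment> \<open>The test is applied to \<open>v = - s *\<^sub>R ?w\<close>, rescaled to the
      norm of \<open>u\<close>; with equal norms the sum of squares becomes a product and nothing is
      lost.\<close>
    define s where "s = norm u / norm ?w"
    have "0 \<le> (norm u)\<^sup>2 + (norm ((- s) *\<^sub>R ?w))\<^sup>2 + 2 * Re (cinner ?w ((- s) *\<^sub>R ?w))"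
      by (rule assms)
    also have "(norm ((- s) *\<^sub>R ?w))\<^sup>2 = (norm u)\<^sup>2"
      using pos by (simp add: s_def)
    also have "Re (cinner ?w ((- s) *\<^sub>R ?w)) = - norm u * norm ?w"
      using pos by (simp add: cinner_scaleR_right cinner_minus_right cinner_self s_def power2_eq_square)
    finally have "norm u * norm ?w \<le> norm u * norm u" by (simp add: power2_eq_square)
    then show ?thesis using pos by simp
  qed
qed

text \<open>The partial sums of the Neumann series replace the Poisson kernel \<open>Re ((1 + z) / (1 - z))\<close>.\<close>

lemma partial_Neumann_real_part:
  fixes z :: bop and N :: nat
  assumes z: "norm z \<le> r" "r \<le> 1"
  defines "g \<equiv> \<Sum>m<N. z ^ m"
  shows "(norm \<xi>)\<^sup>2 - 2 * (real N + 1) * r ^ N * (norm \<xi>)\<^sup>2 \<le> 2 * Re (cinner (bop_apply g \<xi>) \<xi>)"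
proof -
  define \<eta> where "\<eta> = bop_apply g \<xi>"
  define q where "q = bop_apply (z ^ N) \<xi>"
  have r0: "0 \<le> r" using z(1) norm_ge_zero[of z] by linarith
  have zg: "z * g = g - 1 + z ^ N"
    unfolding g_def by (induction N) (simp_all add: algebra_simps)
  have "bop_apply z \<eta> = (\<eta> - \<xi>) + q"
    using arg_cong[OF zg, of "\<lambda>x. bop_apply x \<xi>"] by (simp add: \<eta>_def q_def)
  moreover have "norm (bop_apply z \<eta>) \<le> norm \<eta>"
    using order_trans[OF bop_norm_le[of z \<eta>] mult_right_mono[of "norm z" 1 "norm \<eta>"]] z by simp
  \<comment> \<open>Without the remainder \<open>q\<close> this expands to
    \<open>(norm \<xi>)\<^sup>2 \<le> 2 * Re (cinner \<eta> \<xi>)\<close>, which says that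
    \<open>(1 + z) / (1 - z) = 2 / (1 - z) - 1\<close> has nonnegative real part.\<close>
  ultimately have "(norm ((\<eta> - \<xi>) + q))\<^sup>2 \<le> (norm \<eta>)\<^sup>2" by simp
  moreover have "(norm ((\<eta> - \<xi>) + q))\<^sup>2 = (norm (\<eta> - \<xi>))\<^sup>2 + (norm q)\<^sup>2 + 2 * Re (cinner (\<eta> - \<xi>) q)"
    by (rule norm_add_sq_ell2)
  moreover have "(norm (\<eta> - \<xi>))\<^sup>2 = (norm \<eta>)\<^sup>2 + (norm \<xi>)\<^sup>2 - 2 * Re (cinner \<eta> \<xi>)"
    using norm_add_sq_ell2[of \<eta> "- \<xi>"] by (simp add: cinner_minus_right)
  ultimately have main: "(norm \<xi>)\<^sup>2 + 2 * Re (cinner (\<eta> - \<xi>) q) \<le> 2 * Re (cinner \<eta> \<xi>)"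
    using zero_le_power2[of "norm q"] by linarith
  have zm: "norm (bop_apply (z ^ m) \<xi>) \<le> r ^ m * norm \<xi>" for m
    by (intro order_trans[OF bop_norm_le] mult_right_mono order_trans[OF norm_power_ineq] power_mono z) simp_all
  have "norm \<eta> \<le> (\<Sum>m<N. norm (bop_apply (z ^ m) \<xi>))"
    unfolding \<eta>_def g_def bop_sum by (rule norm_sum)
  also have "\<dots> \<le> (\<Sum>m<N. 1 * norm \<xi>)"
    by (intro sum_mono order_trans[OF zm] mult_right_mono power_le_one r0 z) simp
  finally have "norm (\<eta> - \<xi>) \<le> (real N + 1) * norm \<xi>"
    using norm_triangle_ineq4[of \<eta> \<xi>] by (simp add: algebra_simps)
  then have "norm (\<eta> - \<xi>) * norm q \<le> ((real N + 1) * norm \<xi>) * (r ^ N * norm \<xi>)"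
    unfolding q_def by (intro mult_mono zm) auto
  moreover have "- Re (cinner (\<eta> - \<xi>) q) \<le> norm (\<eta> - \<xi>) * norm q"
    using norm_cinner_le[of "\<eta> - \<xi>" q] abs_Re_le_cmod[of "cinner (\<eta> - \<xi>) q"] by linarith
  ultimately show ?thesis
    using main by (simp add: \<eta>_def power2_eq_square algebra_simps)
qed

lemma scaleC_bop_mult: "scaleC_bop c x * scaleC_bop d y = scaleC_bop (c * d) (x * y)"
  by (rule bop_eqI) (simp add: bop_scaleC scaleC_ell2_scaleC mult.commute)

lemma scaleC_bop_power: "scaleC_bop c x ^ m = scaleC_bop (c ^ m) (x ^ m)"
proof (induction m)
  case 0
  then show ?case by (auto intro!: bop_eqI ell2_eqI)
qed (simp add: scaleC_bop_mult)

text \<open>A discrete Poisson formula. The weights \<open>h j\<close> are normalised truncated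
  Poisson kernels at the roots of unity; their zeroth moment is the unit and their first moment is
  \<open>r / (1 + \<epsilon>)\<close> times \<open>y\<close>. The radius \<open>r < 1\<close> makes
  the truncation error, which \<open>\<epsilon>\<close> has to absorb, tend to 0.\<close>

lemma kmin_disc_strict:
  fixes y :: bop
  assumes y: "norm y \<le> 1" and r: "0 \<le> r" "r < 1" and N: "2 \<le> N"
  defines "\<epsilon> \<equiv> 2 * (real N + 1) * r ^ N"
  shows "kmin n (cball 0 1) (\<lambda>i k. of_real (r / (1 + \<epsilon>)) * cinner (bop_apply y (ebasis k)) (ebasis i))"
proof -
  \<comment> \<open>With \<open>Suc N\<close> roots the powers \<open>w j ^ Suc m\<close> for
    \<open>m < N\<close>, which come from the adjoint part, still average to 0.\<close>
  define w where "w j = wroot (Suc N) j" for j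
  have w: "cmod (w j) = 1" for j by (simp add: w_def)
  have \<epsilon>: "0 \<le> \<epsilon>" unfolding \<epsilon>_def using r by simp
  define z where "z j = scaleC_bop (of_real r * cnj (w j)) y" for j
  define g where "g j = (\<Sum>m<N. z j ^ m)" for j
  define Y where "Y m i k = cinner (bop_apply (y ^ m) (ebasis k)) (ebasis i)" for m i k
  define G where "G j i k = cinner (bop_apply (g j) (ebasis k)) (ebasis i)" for j i k
  have G: "G j i k = (\<Sum>m<N. of_real r ^ m * cnj (w j) ^ m * Y m i k)" for j i k
    by (simp add: G_def g_def z_def scaleC_bop_power bop_sum cinner_sum_left cinner_scaleC_left Y_def power_mult_distrib)
  have Y0: "Y 0 i k = unitk i k" for i k by (simp add: Y_def cinner_ebasis_right)
  have Y1: "Y 1 i k = cinner (bop_apply y (ebasis k)) (ebasis i)" for i k by (simp add: Y_def)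
  have orth: "(\<Sum>j<Suc N. w j ^ a * cnj (w j) ^ b) = (if a = b then of_nat (Suc N) else 0)"
    if "a \<le> N" "b \<le> N" for a b
    unfolding w_def using that by (intro wroot_orthogonal) auto
  define C where "C = 1 / (real (Suc N) * (1 + \<epsilon>))"
  have C: "0 \<le> C" "C * real (Suc N) * (1 + \<epsilon>) = 1" using \<epsilon> by (simp_all add: C_def)
  \<comment> \<open>Up to normalisation this is \<open>2 * Re (G j) - 1\<close>, the Poisson kernel,
    plus the multiple \<open>\<epsilon>\<close> of the unit that restores positivity after
    truncation.\<close>
  define h where "h j i k = of_real C * (G j i k + cnj (G j k i) + of_real (\<epsilon> - 1) * unitk i k)" for j i k
  have sumG: "(\<Sum>j<Suc N. w j ^ a * G j i k) = of_nat (Suc N) * (of_real r ^ a * Y a i k)" if "a < N" for a i k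
  proof -
    have "(\<Sum>j<Suc N. w j ^ a * G j i k) = (\<Sum>j<Suc N. \<Sum>m<N. of_real r ^ m * Y m i k * (w j ^ a * cnj (w j) ^ m))"
      by (simp only: G sum_distrib_left ac_simps)
    also have "\<dots> = (\<Sum>m<N. of_real r ^ m * Y m i k * (\<Sum>j<Suc N. w j ^ a * cnj (w j) ^ m))"
      unfolding sum_distrib_left by (rule sum.swap)
    also have "\<dots> = (\<Sum>m<N. if a = m then of_nat (Suc N) * (of_real r ^ m * Y m i k) else 0)"
      by (rule sum.cong) (use that in \<open>auto simp: orth simp del: sum.lessThan_Suc\<close>)
    finally show ?thesis using that by (simp del: sum.lessThan_Suc)
  qed
  have sumG': "(\<Sum>j<Suc N. w j * cnj (G j k i)) = 0" for i k
  proof -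
    have "(\<Sum>j<Suc N. w j * cnj (G j k i)) = (\<Sum>j<Suc N. \<Sum>m<N. of_real r ^ m * cnj (Y m k i) * (w j ^ Suc m * cnj (w j) ^ 0))"
      by (simp add: G sum_distrib_left ac_simps del: sum.lessThan_Suc)
    also have "\<dots> = (\<Sum>m<N. of_real r ^ m * cnj (Y m k i) * (\<Sum>j<Suc N. w j ^ Suc m * cnj (w j) ^ 0))"
      unfolding sum_distrib_left by (rule sum.swap)
    also have "\<dots> = 0"
      by (rule sum.neutral) (use orth[of "Suc _" 0] in \<open>auto simp del: sum.lessThan_Suc power_Suc\<close>)
    finally show ?thesis .
  qed
  have sumw: "(\<Sum>j<Suc N. w j) = 0" using orth[of 1 0] N by (simp del: sum.lessThan_Suc)
  have psd: "psd {..<n} (h j)" for j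
  proof -
    have "0 \<le> Re (frm {..<n} (G j) x x) * 2 + (\<epsilon> - 1) * Re (frm {..<n} unitk x x)" for x
    proof -
      define \<xi> where "\<xi> = vec_ell2 n x"
      have "norm (z j) \<le> r"
        unfolding z_def using order_trans[OF norm_scaleC_bop[of "of_real r * cnj (w j)" y]] r w y
        by (simp add: norm_mult mult_left_le)
      from partial_Neumann_real_part[OF this, of \<xi> N] r
      have "(norm \<xi>)\<^sup>2 - \<epsilon> * (norm \<xi>)\<^sup>2 \<le> 2 * Re (cinner (bop_apply (g j) \<xi>) \<xi>)"
        by (simp add: g_def \<epsilon>_def)
      moreover have "cinner (bop_apply (g j) \<xi>) \<xi> = frm {..<n} (G j) x x"
        unfolding \<xi>_def cinner_vec_ell2 by (simp add: G_def[abs_def])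
      moreover have "(norm \<xi>)\<^sup>2 = Re (frm {..<n} unitk x x)"
        unfolding \<xi>_def norm_vec_ell2[symmetric] by simp
      ultimately show ?thesis by (simp add: algebra_simps)
    qed
    then have pos: "0 \<le> C * (2 * Re (frm {..<n} (G j) x x) + (\<epsilon> - 1) * Re (frm {..<n} unitk x x))" for x
      using C(1) by (intro mult_nonneg_nonneg) (simp_all add: mult.commute)
    have eq: "frm {..<n} (h j) x x = of_real C * (frm {..<n} (G j) x x + cnj (frm {..<n} (G j) x x)
        + of_real (\<epsilon> - 1) * frm {..<n} unitk x x)" for x
      unfolding h_def[abs_def] frm_kernel_scale frm_kernel_add frm_kernel_adj by simp
    show ?thesis
      unfolding psd_def complex_nonneg_Reals_iff eq
    proof (intro allI conjI)
      fix x
      have "Im (frm {..<n} unitk x x) = 0" by (rule psdD(2)[OF psd_unitk]) simp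
      then show "Im (of_real C * (frm {..<n} (G j) x x + cnj (frm {..<n} (G j) x x)
        + of_real (\<epsilon> - 1) * frm {..<n} unitk x x)) = 0" by simp
      show "0 \<le> Re (of_real C * (frm {..<n} (G j) x x + cnj (frm {..<n} (G j) x x)
        + of_real (\<epsilon> - 1) * frm {..<n} unitk x x))" using pos[of x] by simp
    qed
  qed
  show ?thesis
    unfolding kmin_def
  proof (intro exI[of _ "{..<Suc N}"] exI[of _ h] exI[of _ w] conjI ballI allI impI)
    fix j show "psd {..<n} (h j)" by (rule psd)
    show "w j \<in> cball 0 1" by (simp add: w)
  next
    fix i k assume "i < n" "k < n"
    have s0: "(\<Sum>j<Suc N. G j i k) = of_nat (Suc N) * unitk i k" for i k
      using sumG[of 0 i k] N Y0[of i k] by (simp del: sum.lessThan_Suc)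
    have s0': "(\<Sum>j<Suc N. cnj (G j k i)) = of_nat (Suc N) * unitk i k"
      using arg_cong[OF s0[of k i], of cnj] by (auto simp del: sum.lessThan_Suc)
    have one: "of_real C * of_nat (Suc N) * of_real (1 + \<epsilon>) = (1 :: complex)"
      using arg_cong[OF C(2), of complex_of_real] by (simp only: of_real_mult of_real_of_nat_eq of_real_1)
    have "(\<Sum>j<Suc N. h j i k) = of_real C * ((\<Sum>j<Suc N. G j i k) + (\<Sum>j<Suc N. cnj (G j k i))
        + of_nat (Suc N) * (of_real (\<epsilon> - 1) * unitk i k))"
      unfolding h_def sum_distrib_left[symmetric] sum.distrib by simp
    also have "\<dots> = (of_real C * of_nat (Suc N) * of_real (1 + \<epsilon>)) * unitk i k"
      unfolding s0 s0' by (simp add: algebra_simps)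
    finally show "(\<Sum>j<Suc N. h j i k) = unitk i k" by (simp only: one mult_1)
    have "(\<Sum>j<Suc N. w j * h j i k) = (\<Sum>j<Suc N. of_real C * (w j * G j i k + w j * cnj (G j k i)
        + w j * (of_real (\<epsilon> - 1) * unitk i k)))"
      unfolding h_def by (intro sum.cong refl) (simp only: distrib_left mult.left_commute)
    also have "\<dots> = of_real C * ((\<Sum>j<Suc N. w j * G j i k) + (\<Sum>j<Suc N. w j * cnj (G j k i))
        + (\<Sum>j<Suc N. w j) * (of_real (\<epsilon> - 1) * unitk i k))"
      unfolding sum_distrib_left[symmetric] sum.distrib sum_distrib_right[symmetric] by simp
    also have "(\<Sum>j<Suc N. w j * G j i k) = of_nat (Suc N) * (of_real r * Y 1 i k)"
      using sumG[of 1 i k] N by (simp del: sum.lessThan_Suc)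
    also have "of_real C * (of_nat (Suc N) * (of_real r * Y 1 i k) + (\<Sum>j<Suc N. w j * cnj (G j k i))
        + (\<Sum>j<Suc N. w j) * (of_real (\<epsilon> - 1) * unitk i k)) = of_real (C * real (Suc N)) * (of_real r * Y 1 i k)"
      unfolding sumG' sumw by simp
    also have "C * real (Suc N) = 1 / (1 + \<epsilon>)" using C(2) \<epsilon> by (simp add: field_simps)
    finally show "(\<Sum>j<Suc N. w j * h j i k) = of_real (r / (1 + \<epsilon>)) * cinner (bop_apply y (ebasis k)) (ebasis i)"
      unfolding Y1 by (simp del: sum.lessThan_Suc)
  qed simp
qed

definition disc_tests :: "(complex \<times> complex) set" where
  "disc_tests = {(1, 0)}"

lemma kmin_disc:
  assumes "passes_mat disc_tests n a"
  shows "kmin n (cball 0 1) a"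
proof (rule kmin_limit)
  define y where "y = mat_bop n a"
  have "norm y \<le> 1"
  proof (rule contraction_of_tests)
    fix u v
    have part: "Re (frm {..<n} unitk (ell2_nth u) (ell2_nth u)) \<le> (norm u)\<^sup>2" for u
      using ell2_partial_norm[of u n] by (simp add: frm_unitk_self)
    show "0 \<le> (norm u)\<^sup>2 + (norm v)\<^sup>2 + 2 * Re (cinner (bop_apply y u) v)"
    proof -
      have "0 \<le> Re (frm {..<n} unitk x x) + Re (frm {..<n} unitk x' x') + 2 * Re (frm {..<n} a x x')" for x x'
        using assms by (simp add: passes_mat_def disc_tests_def)
      from this[of "ell2_nth u" "ell2_nth v"] show ?thesis
        using part[of u] part[of v] unfolding y_def cinner_mat_bop by linarith
    qed
  qed
  have a: "cinner (bop_apply y (ebasis k)) (ebasis i) = a i k" if "i < n" "k < n" for i k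
  proof -
    have "cinner (bop_apply y (ebasis k)) (ebasis i)
      = frm {..<n} a (\<lambda>j. if j = k then 1 else 0) (\<lambda>j. if j = i then 1 else 0)"
      unfolding y_def cinner_mat_bop by (rule frm_cong) auto
    then show ?thesis using that by (simp add: frm_unit)
  qed
  show "compact (cball 0 1 :: complex set)" "cball 0 1 \<noteq> ({} :: complex set)" by auto
  fix e :: real assume e: "0 < e"
  \<comment> \<open>An entry changes by at most \<open>(1 - r) + \<epsilon>\<close>, and each
    summand gets half of \<open>d\<close>. The cap at 1 keeps \<open>r\<close> nonnegative.\<close>
  define d where "d = min e 1"
  have d: "0 < d" "d \<le> e" "d \<le> 1" using e by (auto simp: d_def)
  define r where "r = 1 - d / 2"
  have r: "0 \<le> r" "r < 1" using d by (auto simp: r_def)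
  have "(\<lambda>N. 2 * (real N * r ^ N) + 2 * r ^ N) \<longlonglongrightarrow> 2 * 0 + 2 * 0"
    by (intro tendsto_add tendsto_mult tendsto_const powser_times_n_limit_0 LIMSEQ_realpow_zero) (use r in auto)
  then have "\<forall>\<^sub>F N in sequentially. 2 * (real N * r ^ N) + 2 * r ^ N < d / 2"
    using d by (intro order_tendstoD(2)[of _ "2 * 0 + 2 * 0"]) auto
  then obtain N0 where "\<And>N. N \<ge> N0 \<Longrightarrow> 2 * (real N * r ^ N) + 2 * r ^ N < d / 2"
    unfolding eventually_sequentially by blast
  then obtain N where N: "2 \<le> N" "2 * (real N * r ^ N) + 2 * r ^ N < d / 2"
    using max.cobounded1[of N0 2] max.cobounded2[of 2 N0] by (metis max.commute)
  define \<epsilon> where "\<epsilon> = 2 * (real N + 1) * r ^ N"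
  have \<epsilon>: "0 \<le> \<epsilon>" "\<epsilon> < d / 2" using r N(2) by (simp_all add: \<epsilon>_def algebra_simps)
  let ?a' = "\<lambda>i k. of_real (r / (1 + \<epsilon>)) * cinner (bop_apply y (ebasis k)) (ebasis i)"
  have "kmin n (cball 0 1) ?a'" unfolding \<epsilon>_def by (rule kmin_disc_strict[OF \<open>norm y \<le> 1\<close> r N(1)])
  moreover have "cmod (?a' i k - a i k) \<le> e" if "i < n" "k < n" for i k
  proof -
    have "cmod (a i k) \<le> norm (bop_apply y (ebasis k)) * norm (ebasis i)"
      unfolding a[OF that, symmetric] by (rule norm_cinner_le)
    also have "\<dots> \<le> 1"
      using bop_norm_le[of y "ebasis k"] \<open>norm y \<le> 1\<close> by simp
    finally have a1: "cmod (a i k) \<le> 1" .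
    have "?a' i k - a i k = of_real (r / (1 + \<epsilon>) - 1) * a i k"
      by (simp add: a[OF that] algebra_simps)
    then have "cmod (?a' i k - a i k) = \<bar>r / (1 + \<epsilon>) - 1\<bar> * cmod (a i k)"
      by (simp only: norm_mult norm_of_real)
    also have "\<dots> \<le> \<bar>r / (1 + \<epsilon>) - 1\<bar> * 1" by (intro mult_left_mono a1) simp
    also have "r / (1 + \<epsilon>) - 1 = - ((d / 2 + \<epsilon>) / (1 + \<epsilon>))"
      using \<epsilon> by (simp add: r_def field_simps)
    also have "\<bar>- ((d / 2 + \<epsilon>) / (1 + \<epsilon>))\<bar> * 1 = (d / 2 + \<epsilon>) / (1 + \<epsilon>)"
      using \<epsilon> d by simp
    also have "\<dots> \<le> d / 2 + \<epsilon>" using \<epsilon> d by (simp add: field_simps)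
    also have "\<dots> \<le> e" using \<epsilon> d by simp
    finally show ?thesis .
  qed
  ultimately show "\<exists>a'. kmin n (cball 0 1) a' \<and> (\<forall>i<n. \<forall>k<n. cmod (a' i k - a i k) \<le> e)" by blast
qed

section \<open>Compact perturbations\<close>

text \<open>For nonnegative \<open>r\<close> this says that the compression of
  \<open>p y + cnj q (adj y)\<close> to the range of \<open>tail m\<close> has norm at most
  \<open>r\<close>. The values \<open>r = 1\<close> and \<open>m = 0\<close> give the operator
  version of \<open>passes_mat\<close>; both parameters relax it. The quadratic form makes estimates
  on orthogonal pieces additive.\<close>

definition passes_bop :: "(complex \<times> complex) set \<Rightarrow> real \<Rightarrow> nat \<Rightarrow> bop \<Rightarrow> bool" where
  "passes_bop T r m y \<longleftrightarrow> (\<forall>(p, q)\<in>T. \<forall>u v. bop_apply (tail m) u = u \<longrightarrow> bop_apply (tail m) v = v \<longrightarrow>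
    0 \<le> r * ((norm u)\<^sup>2 + (norm v)\<^sup>2) + 2 * Re (p * cinner (bop_apply y u) v + q * cinner (bop_apply y v) u))"

lemma passes_bopD:
  assumes "passes_bop T r m y" "(p, q) \<in> T" "bop_apply (tail m) u = u" "bop_apply (tail m) v = v"
  shows "0 \<le> r * ((norm u)\<^sup>2 + (norm v)\<^sup>2) + 2 * Re (p * cinner (bop_apply y u) v + q * cinner (bop_apply y v) u)"
  using assms unfolding passes_bop_def by auto

lemma passes_bopI:
  assumes "\<And>p q u v. (p, q) \<in> T \<Longrightarrow> bop_apply (tail m) u = u \<Longrightarrow> bop_apply (tail m) v = v \<Longrightarrow>
    0 \<le> r * ((norm u)\<^sup>2 + (norm v)\<^sup>2) + 2 * Re (p * cinner (bop_apply y u) v + q * cinner (bop_apply y v) u)"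
  shows "passes_bop T r m y"
  using assms unfolding passes_bop_def by blast

lemma tail_0 [simp]: "tail 0 = 1"
  by (intro bop_eqI ell2_eqI) simp

section \<open>A partition that almost commutes with an operator\<close>

lemma norm_scaled_cross_sum:
  fixes nn :: "nat \<Rightarrow> nat" and b \<eta> :: real and L :: nat
  assumes mono: "strict_mono nn" and \<beta>: "\<And>k. \<bar>\<beta> k\<bar> \<le> b"
    and small: "\<And>k. norm (head (nn k) * y * tail (nn (Suc k))) \<le> \<eta>"
  shows "norm (\<Sum>k<L. \<beta> k *\<^sub>R (head (nn k) * y * tail (nn k))) \<le> b * sqrt L * norm y + b * (L * \<eta>)"
proof -
  have b: "0 \<le> b" using \<beta>[of 0] by linarith
  have \<eta>: "0 \<le> \<eta>" using small[of 0] norm_ge_zero order_trans by blast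
  \<comment> \<open>\<open>D k\<close> projects onto the coordinates from \<open>nn (k - 1)\<close>
    up to \<open>nn k\<close>. Replacing \<open>head (nn k)\<close> by \<open>D k\<close> costs only
    the small \<open>R k\<close>, and the remaining terms have orthogonal ranges, so Pythagoras
    yields \<open>sqrt L\<close> where the triangle inequality would yield \<open>L\<close>.\<close>
  define D where "D k = (if k = 0 then head (nn 0) else head (nn k) - head (nn (k - 1)))" for k
  define R where "R k = (if k = 0 then 0 else head (nn (k - 1)) * y * tail (nn k))" for k
  have split: "head (nn k) * y * tail (nn k) = D k * y * tail (nn k) + R k" for k
    by (auto simp: D_def R_def algebra_simps)
  have Dnth: "ell2_nth (bop_apply (D k) u) i = (if i < nn k \<and> (k = 0 \<or> nn (k - 1) \<le> i) then ell2_nth u i else 0)" for k u i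
    using strict_monoD[OF mono, of "k - 1" k] by (cases k) (auto simp: D_def)
  have orth: "inner (bop_apply (D k) u) (bop_apply (D l) v) = 0" if "k < l" for k l u v
  proof -
    have "nn k \<le> nn (l - 1)" using that mono by (simp add: strict_mono_less_eq)
    then have "ell2_nth (bop_apply (D k) u) i * cnj (ell2_nth (bop_apply (D l) v) i) = 0" for i
      using that by (auto simp: Dnth)
    then have "(\<lambda>i. ell2_nth (bop_apply (D k) u) i * cnj (ell2_nth (bop_apply (D l) v) i)) = (\<lambda>i. 0)"
      by auto
    then show ?thesis unfolding inner_ell2_def cinner_def by simp
  qed
  have normD: "norm (bop_apply (D k) u) \<le> norm u" for k u
  proof -
    have "D k = diag_op (\<lambda>i. if i < nn k \<and> (k = 0 \<or> nn (k - 1) \<le> i) then 1 else 0)"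
      by (intro bop_eqI ell2_eqI, subst diag_op_apply) (auto simp: Dnth)
    then show ?thesis by (simp add: norm_diag_op_apply)
  qed
  have "norm (\<Sum>k<L. \<beta> k *\<^sub>R (D k * y * tail (nn k))) \<le> b * sqrt L * norm y"
  proof (rule bop_normI)
    fix u
    define w where "w k = \<beta> k *\<^sub>R bop_apply (D k) (bop_apply y (bop_apply (tail (nn k)) u))" for k
    have nw: "norm (w k) \<le> b * (norm y * norm u)" for k
    proof -
      have "norm (w k) \<le> b * norm (bop_apply y (bop_apply (tail (nn k)) u))"
        unfolding w_def norm_scaleR by (intro mult_mono \<beta> normD b) simp
      also have "norm (bop_apply y (bop_apply (tail (nn k)) u)) \<le> norm y * norm u"
        by (intro order_trans[OF bop_norm_le] mult_left_mono norm_tail_apply) simp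
      finally show ?thesis using b by (simp add: mult_left_mono)
    qed
    have "(norm (\<Sum>k<L. w k))\<^sup>2 = (\<Sum>k<L. (norm (w k))\<^sup>2)"
    proof (rule norm_sum_Pythagorean)
      show "pairwise (\<lambda>i j. real_inner_class.orthogonal (w i) (w j)) {..<L}"
      proof (rule pairwiseI)
        fix k l :: nat assume "k \<noteq> l"
        have "inner (w i) (w j) = 0" if "i < j" for i j using orth[OF that] by (simp add: w_def)
        from this[of k l] this[of l k] \<open>k \<noteq> l\<close> show "real_inner_class.orthogonal (w k) (w l)"
          by (auto simp: real_inner_class.orthogonal_def inner_commute[of "w k"] dest: nat_neq_iff[THEN iffD1])
      qed
    qed simp
    also have "\<dots> \<le> (\<Sum>k<L. (b * (norm y * norm u))\<^sup>2)" by (intro sum_mono power_mono nw) simp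
    also have "\<dots> = (b * sqrt L * norm y * norm u)\<^sup>2" by (simp add: power_mult_distrib algebra_simps)
    finally have "norm (\<Sum>k<L. w k) \<le> b * sqrt L * norm y * norm u"
      by (rule power2_le_imp_le) (simp add: b)
    then show "norm (bop_apply (\<Sum>k<L. \<beta> k *\<^sub>R (D k * y * tail (nn k))) u) \<le> b * sqrt L * norm y * norm u"
      by (simp add: bop_sum w_def)
  qed
  moreover have "norm (\<Sum>k<L. \<beta> k *\<^sub>R R k) \<le> b * (L * \<eta>)"
  proof -
    have "norm (\<beta> k *\<^sub>R R k) \<le> b * \<eta>" for k
    proof -
      have "norm (R k) \<le> \<eta>" using small[of "k - 1"] \<eta> by (cases k) (simp_all add: R_def)
      then show ?thesis using \<beta>[of k] b by (simp add: mult_mono)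
    qed
    then have "norm (\<Sum>k<L. \<beta> k *\<^sub>R R k) \<le> (\<Sum>k<L. b * \<eta>)" by (intro sum_norm_le) simp
    then show ?thesis by (simp add: algebra_simps)
  qed
  moreover have "(\<Sum>k<L. \<beta> k *\<^sub>R (head (nn k) * y * tail (nn k)))
      = (\<Sum>k<L. \<beta> k *\<^sub>R (D k * y * tail (nn k))) + (\<Sum>k<L. \<beta> k *\<^sub>R R k)"
    by (simp add: split scaleR_add_right sum.distrib)
  ultimately show ?thesis using norm_triangle_le by (metis (no_types, lifting) add_mono)
qed

text \<open>The commutator of \<open>head m\<close> with \<open>y\<close> is
  \<open>head m * y * tail m - tail m * y * head m\<close>. The first part leads to the preceding
  sum, the second to the adjoint of that sum for \<open>adj y\<close>.\<close>

lemma norm_commutator_step: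
  fixes nn :: "nat \<Rightarrow> nat" and b \<eta> :: real and L :: nat
  assumes "strict_mono nn" "\<And>k. \<bar>\<beta> k\<bar> \<le> b"
    and "\<And>k. norm (head (nn k) * y * tail (nn (Suc k))) \<le> \<eta>"
    and "\<And>k. norm (tail (nn (Suc k)) * y * head (nn k)) \<le> \<eta>"
  defines "h \<equiv> \<Sum>k<L. \<beta> k *\<^sub>R head (nn k)"
  shows "norm (h * y - y * h) \<le> 2 * (b * sqrt L * norm y + b * (L * \<eta>))"
proof -
  define S where "S x = (\<Sum>k<L. \<beta> k *\<^sub>R (head (nn k) * x * tail (nn k)))" for x
  have adjS: "adj (S x) = (\<Sum>k<L. \<beta> k *\<^sub>R (tail (nn k) * adj x * head (nn k)))" for x
    unfolding S_def by (induction L) (simp_all add: adj_add adj_scaleR adj_mult mult.assoc, rule adjI, simp)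
  have "head m * y - y * head m = head m * y * tail m - tail m * y * head m" for m
    by (simp add: head_eq algebra_simps)
  then have "h * y - y * h = S y - adj (S (adj y))"
    unfolding adjS adj_adj unfolding S_def h_def sum_distrib_left sum_distrib_right sum_subtractf[symmetric]
    by (intro sum.cong refl) (simp flip: scaleR_diff_right)
  then have "norm (h * y - y * h) \<le> norm (S y) + norm (S (adj y))"
    using norm_triangle_ineq4[of "S y" "adj (S (adj y))"] by simp
  moreover have "norm (S y) \<le> b * sqrt L * norm y + b * (L * \<eta>)"
    unfolding S_def by (rule norm_scaled_cross_sum[OF assms(1-3)])
  moreover have "norm (S (adj y)) \<le> b * sqrt L * norm (adj y) + b * (L * \<eta>)"
    unfolding S_def
  proof (rule norm_scaled_cross_sum[OF assms(1,2)])
    fix k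
    show "norm (head (nn k) * adj y * tail (nn (Suc k))) \<le> \<eta>"
      using assms(4)[of k] norm_adj[of "head (nn k) * adj y * tail (nn (Suc k))"]
      by (simp add: adj_mult mult.assoc)
  qed
  ultimately show ?thesis by simp
qed

text \<open>As \<open>head n\<close> has finite rank, \<open>y\<close> hardly connects the first
  \<open>n\<close> coordinates with those far beyond; the sequence iterates this choice.\<close>

lemma exists_sparse_sequence:
  assumes "0 < \<eta>"
  obtains nn :: "nat \<Rightarrow> nat" where "strict_mono nn" "N \<le> nn 0"
    "\<And>k. norm (head (nn k) * y * tail (nn (Suc k))) \<le> \<eta>"
    "\<And>k. norm (tail (nn (Suc k)) * y * head (nn k)) \<le> \<eta>"
proof -
  have "\<exists>m. n < m \<and> norm (head n * y * tail m) \<le> \<eta> \<and> norm (tail m * y * head n) \<le> \<eta>" for n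
  proof -
    have "\<forall>\<^sub>F m in sequentially. norm (head n * y * tail m) < \<eta>"
      by (rule order_tendstoD(2)[OF head_mult_tail_tendsto assms])
    moreover have "\<forall>\<^sub>F m in sequentially. norm (tail m * y * head n) < \<eta>"
      by (rule order_tendstoD(2)[OF tail_mult_head_tendsto assms])
    moreover have "\<forall>\<^sub>F m in sequentially. n < m" by (rule eventually_gt_at_top)
    ultimately have "\<forall>\<^sub>F m in sequentially. n < m \<and> norm (head n * y * tail m) \<le> \<eta> \<and> norm (tail m * y * head n) \<le> \<eta>"
      by eventually_elim simp
    then show ?thesis by (rule eventually_happens'[OF sequentially_bot])
  qed
  then obtain F where F: "\<And>n. n < F n \<and> norm (head n * y * tail (F n)) \<le> \<eta> \<and> norm (tail (F n) * y * head n) \<le> \<eta>"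
    by metis
  define nn where "nn k = (F ^^ k) N" for k
  have "strict_mono nn" unfolding strict_mono_Suc_iff using F by (simp add: nn_def)
  then show ?thesis using F by (intro that[of nn]) (simp_all add: nn_def)
qed

text \<open>A quasicentral partition made by hand: \<open>c\<close> and \<open>d\<close> are the
  cosine and sine of an angle that climbs from 0 to \<open>pi / 2\<close> in \<open>L\<close> equal
  steps at sparse positions. A step has height at most \<open>2 / L\<close>, and since the steps act
  on almost orthogonal pieces the commutators are of order \<open>1 / sqrt L\<close>, not of order
  1.\<close>

lemma almost_commuting_partition:
  assumes \<delta>: "0 < \<delta>"
  obtains c d M where "\<And>i. (c i)\<^sup>2 + (d i)\<^sup>2 = (1 :: real)" "\<And>i. i < N \<Longrightarrow> d i = 0"
    "\<And>i. M \<le> i \<Longrightarrow> c i = 0 \<and> d i = 1"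
    "norm (diag_op c * y * diag_op c + diag_op d * y * diag_op d - y) \<le> \<delta>"
proof -
  \<comment> \<open>The constant 32, here and in \<open>\<eta>\<close>, makes both terms of the
    commutator bound at most \<open>\<delta> / 16\<close>.\<close>
  obtain L0 :: nat where L0: "(32 * norm y / \<delta>)\<^sup>2 < L0" using reals_Archimedean2 by blast
  define L where "L = Suc L0"
  have L: "0 < L" "32 * norm y / \<delta> \<le> sqrt L"
    using L0 by (auto simp: L_def intro!: real_le_rsqrt)
  define b where "b = 2 / real L"
  define \<eta> where "\<eta> = \<delta> / 32"
  have \<eta>: "0 < \<eta>" using \<delta> by (simp add: \<eta>_def)
  obtain nn where nn: "strict_mono nn" "N \<le> nn 0"
    "\<And>k. norm (head (nn k) * y * tail (nn (Suc k))) \<le> \<eta>"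
    "\<And>k. norm (tail (nn (Suc k)) * y * head (nn k)) \<le> \<eta>"
    by (rule exists_sparse_sequence[OF \<eta>, where N = N and y = y]) (rule that)
  \<comment> \<open>Parametrising by an angle makes \<open>(c i)\<^sup>2 + (d i)\<^sup>2 = 1\<close>
    automatic, while both functions have small increments.\<close>
  define \<theta> where "\<theta> k = pi * real k / (2 * real L)" for k
  define \<beta> where "\<beta> k = cos (\<theta> k) - cos (\<theta> (Suc k))" for k
  define \<gamma> where "\<gamma> k = sin (\<theta> (Suc k)) - sin (\<theta> k)" for k
  have \<theta>d: "\<bar>(\<theta> (Suc k) - \<theta> k) / 2\<bar> \<le> b / 2" for k
  proof -
    have "(\<theta> (Suc k) - \<theta> k) / 2 = pi / (4 * real L)" using L by (simp add: \<theta>_def field_simps)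
    also have "\<bar>\<dots>\<bar> \<le> b / 2" using pi_less_4 L by (simp add: b_def field_simps)
    finally show ?thesis .
  qed
  have \<beta>: "\<bar>\<beta> k\<bar> \<le> b" for k
  proof -
    have "\<bar>\<beta> k\<bar> = 2 * \<bar>sin ((\<theta> k + \<theta> (Suc k)) / 2)\<bar> * \<bar>sin ((\<theta> (Suc k) - \<theta> k) / 2)\<bar>"
      by (simp add: \<beta>_def cos_diff_cos abs_mult)
    also have "\<dots> \<le> 2 * 1 * \<bar>(\<theta> (Suc k) - \<theta> k) / 2\<bar>"
      by (intro mult_mono abs_sin_x_le_abs_x) auto
    finally show ?thesis using \<theta>d[of k] by simp
  qed
  have \<gamma>: "\<bar>\<gamma> k\<bar> \<le> b" for k
  proof -
    have "\<bar>\<gamma> k\<bar> = 2 * \<bar>sin ((\<theta> (Suc k) - \<theta> k) / 2)\<bar> * \<bar>cos ((\<theta> (Suc k) + \<theta> k) / 2)\<bar>"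
      by (simp add: \<gamma>_def sin_diff_sin abs_mult)
    also have "\<dots> \<le> 2 * \<bar>(\<theta> (Suc k) - \<theta> k) / 2\<bar> * 1"
      by (intro mult_mono abs_sin_x_le_abs_x) auto
    finally show ?thesis using \<theta>d[of k] by simp
  qed
  define c where "c i = (\<Sum>k<L. if i < nn k then \<beta> k else 0)" for i
  define d where "d i = 1 - (\<Sum>k<L. if i < nn k then \<gamma> k else 0)" for i
  have val: "\<exists>\<kappa>\<le>L. c i = cos (\<theta> \<kappa>) \<and> d i = sin (\<theta> \<kappa>) \<and> (i < nn 0 \<longrightarrow> \<kappa> = 0) \<and> (nn L \<le> i \<longrightarrow> \<kappa> = L)" for i
  proof -
    \<comment> \<open>The step on which the coordinate \<open>i\<close> lies, capped at
      \<open>L\<close>. The sums defining \<open>c i\<close> and \<open>d i\<close>, which have the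
      shape needed for the commutator bound, telescope from there.\<close>
    define \<kappa> where "\<kappa> = (LEAST k. i < nn k \<or> L \<le> k)"
    have \<kappa>L: "\<kappa> \<le> L" unfolding \<kappa>_def by (rule Least_le) simp
    have iff: "i < nn k \<longleftrightarrow> \<kappa> \<le> k" if "k < L" for k
    proof
      assume "i < nn k" then show "\<kappa> \<le> k" unfolding \<kappa>_def by (intro Least_le) simp
    next
      assume k: "\<kappa> \<le> k"
      have "i < nn \<kappa> \<or> L \<le> \<kappa>" unfolding \<kappa>_def by (rule LeastI[of _ L]) simp
      then show "i < nn k" using k that nn(1) by (metis leD le_less_trans less_le_trans strict_mono_less_eq)
    qed
    have tele: "(\<Sum>k<L. if i < nn k then g (Suc k) - g k else 0) = g L - g \<kappa>" for g :: "nat \<Rightarrow> real"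
    proof -
      have "(\<Sum>k<L. if i < nn k then g (Suc k) - g k else 0) = (\<Sum>k=\<kappa>..<L. g (Suc k) - g k)"
        by (rule sum.mono_neutral_cong_right) (auto simp: iff)
      then show ?thesis using sum_Suc_diff'[OF \<kappa>L, of g] by simp
    qed
    have \<theta>L: "\<theta> L = pi / 2" using L by (simp add: \<theta>_def)
    have "c i = - (\<Sum>k<L. if i < nn k then cos (\<theta> (Suc k)) - cos (\<theta> k) else 0)"
      unfolding c_def sum_negf[symmetric] by (intro sum.cong) (auto simp: \<beta>_def)
    then have "c i = cos (\<theta> \<kappa>)" unfolding tele[of "\<lambda>k. cos (\<theta> k)"] by (simp add: \<theta>L)
    moreover have "d i = sin (\<theta> \<kappa>)"
      unfolding d_def \<gamma>_def tele[of "\<lambda>k. sin (\<theta> k)"] by (simp add: \<theta>L)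
    moreover have "\<kappa> = 0" if "i < nn 0" using iff[of 0] L that by simp
    moreover have "\<kappa> = L" if "nn L \<le> i"
      using iff[of \<kappa>] \<kappa>L that nn(1) by (metis dual_order.order_iff_strict leD le_less_trans strict_mono_less)
    ultimately show ?thesis using \<kappa>L by blast
  qed
  have one: "(c i)\<^sup>2 + (d i)\<^sup>2 = 1" for i using val[of i] by auto
  have c1: "\<bar>c i\<bar> \<le> 1" and d1: "\<bar>d i\<bar> \<le> 1" for i using val[of i] by auto
  have d0: "d i = 0" if "i < N" for i using val[of i] that nn(2) by (auto simp: \<theta>_def)
  have cL: "c i = 0 \<and> d i = 1" if "nn L \<le> i" for i
  proof -
    have "c i = cos (\<theta> L)" "d i = sin (\<theta> L)" using val[of i] that by auto
    moreover have "\<theta> L = pi / 2" using L by (simp add: \<theta>_def)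
    ultimately show ?thesis by simp
  qed
  define f where "f = diag_op c"
  define g where "g = diag_op d"
  define G where "G = (\<Sum>k<L. \<gamma> k *\<^sub>R head (nn k))"
  have f_eq: "f = (\<Sum>k<L. \<beta> k *\<^sub>R head (nn k))"
  proof (intro bop_eqI ell2_eqI)
    fix u i
    have "(\<Sum>k<L. of_real (if i < nn k then \<beta> k else 0) * ell2_nth u i)
        = (\<Sum>k<L. of_real (\<beta> k) * (if i < nn k then ell2_nth u i else 0))"
      by (intro sum.cong) auto
    then show "ell2_nth (bop_apply f u) i = ell2_nth (bop_apply (\<Sum>k<L. \<beta> k *\<^sub>R head (nn k)) u) i"
      by (simp add: f_def diag_op_apply[OF c1] bop_sum ell2_nth_sum c_def sum_distrib_right)
  qed
  have g_eq: "g = 1 - G"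
  proof (intro bop_eqI ell2_eqI)
    fix u i
    have "(\<Sum>k<L. of_real (if i < nn k then \<gamma> k else 0) * ell2_nth u i)
        = (\<Sum>k<L. of_real (\<gamma> k) * (if i < nn k then ell2_nth u i else 0))"
      by (intro sum.cong) auto
    then show "ell2_nth (bop_apply g u) i = ell2_nth (bop_apply (1 - G) u) i"
      by (simp add: g_def G_def diag_op_apply[OF d1] bop_sum ell2_nth_sum d_def left_diff_distrib sum_distrib_right)
  qed
  have small: "2 * (b * sqrt L * norm y + b * (L * \<eta>)) \<le> \<delta> / 2"
  proof -
    have "b * sqrt L * norm y = 2 * norm y / sqrt L"
      using L by (simp add: b_def field_simps real_div_sqrt)
    also have "\<dots> \<le> \<delta> / 16"
      using L(2) \<delta> L(1) by (simp add: field_simps)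
    finally have "b * sqrt L * norm y \<le> \<delta> / 16" .
    moreover have "b * (L * \<eta>) = \<delta> / 16" using L by (simp add: b_def \<eta>_def)
    ultimately show ?thesis using \<delta> by simp
  qed
  have cf: "norm (f * y - y * f) \<le> \<delta> / 2"
    unfolding f_eq using norm_commutator_step[where \<beta> = \<beta> and nn = nn and L = L, OF nn(1) \<beta> nn(3,4)] small by linarith
  have "g * y - y * g = - (G * y - y * G)" by (simp add: g_eq algebra_simps)
  then have "norm (g * y - y * g) = norm (G * y - y * G)" by (simp only: norm_minus_cancel)
  then have cg: "norm (g * y - y * g) \<le> \<delta> / 2"
    using norm_commutator_step[where \<beta> = \<gamma> and nn = nn and L = L, OF nn(1) \<gamma> nn(3,4)] small unfolding G_def by linarith
  have ff: "f * f + g * g = 1"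
  proof (intro bop_eqI ell2_eqI)
    fix u i
    have "of_real (c i) * (of_real (c i) * z) + of_real (d i) * (of_real (d i) * z) = of_real ((c i)\<^sup>2 + (d i)\<^sup>2) * z" for z :: complex
      by (simp add: power2_eq_square algebra_simps)
    then show "ell2_nth (bop_apply (f * f + g * g) u) i = ell2_nth (bop_apply 1 u) i"
      by (simp add: f_def g_def diag_op_apply[OF c1] diag_op_apply[OF d1] one del: of_real_add)
  qed
  have nf: "norm f \<le> 1" "norm g \<le> 1" unfolding f_def g_def by (rule norm_diag_op, rule c1 d1)+
  \<comment> \<open>As \<open>f * f + g * g = 1\<close>, the error of the splitting is expressed by
    the two commutators.\<close>
  have "f * y * f + g * y * g - y = - (f * (f * y - y * f) + g * (g * y - y * g))"
  proof -
    have "f * (f * y - y * f) + g * (g * y - y * g) = (f * f + g * g) * y - (f * y * f + g * y * g)"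
      by (simp add: algebra_simps)
    then show ?thesis by (simp add: ff)
  qed
  also have "norm \<dots> \<le> norm (f * (f * y - y * f)) + norm (g * (g * y - y * g))"
    unfolding norm_minus_cancel by (rule norm_triangle_ineq)
  also have "\<dots> \<le> 1 * (\<delta> / 2) + 1 * (\<delta> / 2)"
    using \<delta> by (intro add_mono order_trans[OF norm_mult_ineq] mult_mono nf cf cg) auto
  finally have "norm (diag_op c * y * diag_op c + diag_op d * y * diag_op d - y) \<le> \<delta>"
    by (simp add: f_def g_def)
  with one d0 cL show ?thesis by (rule that)
qed

section \<open>Iterated gluing\<close>

lemma bounded_tests_cross:
  assumes "cmod p \<le> B" "cmod q \<le> B"
    and "cmod \<alpha> \<le> s * (norm u * norm v)" "cmod \<beta> \<le> s * (norm u * norm v)" and s: "0 \<le> s"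
  shows "\<bar>2 * Re (p * \<alpha> + q * \<beta>)\<bar> \<le> 2 * B * s * ((norm u)\<^sup>2 + (norm v)\<^sup>2)"
proof -
  have B: "0 \<le> B" using assms(1) norm_ge_zero order_trans by blast
  have "0 \<le> (norm u - norm v)\<^sup>2" by simp
  then have uv: "2 * (norm u * norm v) \<le> (norm u)\<^sup>2 + (norm v)\<^sup>2" by (simp add: power2_diff)
  have "cmod (p * \<alpha>) \<le> B * (s * (norm u * norm v))" "cmod (q * \<beta>) \<le> B * (s * (norm u * norm v))"
    unfolding norm_mult using assms B by (intro mult_mono; simp)+
  then have "cmod (p * \<alpha> + q * \<beta>) \<le> B * s * (2 * (norm u * norm v))"
    using norm_triangle_ineq[of "p * \<alpha>" "q * \<beta>"] by (simp add: algebra_simps)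
  also have "\<dots> \<le> B * s * ((norm u)\<^sup>2 + (norm v)\<^sup>2)"
    using B s by (intro mult_left_mono uv) simp
  finally show ?thesis using abs_Re_le_cmod[of "p * \<alpha> + q * \<beta>"] by simp
qed

lemma cinner_apply_le: "cmod (cinner (bop_apply y u) v) \<le> norm y * (norm u * norm v)"
proof -
  have "cmod (cinner (bop_apply y u) v) \<le> norm (bop_apply y u) * norm v" by (rule norm_cinner_le)
  also have "\<dots> \<le> (norm y * norm u) * norm v" by (intro mult_right_mono bop_norm_le) simp
  finally show ?thesis by (simp add: mult.assoc)
qed

text \<open>A compact operator is small far out, and the bound \<open>B\<close> on the coefficients
  makes its effect small for all tests simultaneously. The margin \<open>e\<close> is shared equally
  between \<open>x\<close> and the perturbation.\<close>

lemma passes_bop_compact_perturbation: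
  assumes T: "\<And>p q. (p, q) \<in> T \<Longrightarrow> cmod p \<le> B \<and> cmod q \<le> B" and k: "compact_op (y - x)"
    and x: "\<And>e. 0 < e \<Longrightarrow> \<exists>N. passes_bop T (1 + e) N x" and e: "0 < e"
  shows "\<exists>N. passes_bop T (1 + e) N y"
proof -
  obtain N1 where N1: "passes_bop T (1 + e / 2) N1 x" using x[of "e / 2"] e by auto
  define B' where "B' = \<bar>B\<bar> + 1"
  have T': "cmod p \<le> B'" "cmod q \<le> B'" if "(p, q) \<in> T" for p q using T[OF that] by (auto simp: B'_def)
  have B': "0 < B'" by (simp add: B'_def)
  have "\<forall>\<^sub>F m in sequentially. norm ((y - x) * tail m) < e / (4 * B')"
    by (rule order_tendstoD(2)[OF compact_op_tail[OF k]]) (use e B' in simp)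
  then obtain N2 where N2: "\<And>m. m \<ge> N2 \<Longrightarrow> norm ((y - x) * tail m) < e / (4 * B')"
    unfolding eventually_sequentially by blast
  define N where "N = max N1 N2"
  define s where "s = norm ((y - x) * tail N)"
  have s: "s < e / (4 * B')" unfolding s_def by (rule N2) (simp add: N_def)
  have "passes_bop T (1 + e) N y"
  proof (rule passes_bopI)
    fix p q u v assume pq: "(p, q) \<in> T" and u: "bop_apply (tail N) u = u" and v: "bop_apply (tail N) v = v"
    have "tail N1 * tail N = tail N" by (rule tail_tail) (simp add: N_def)
    then have N1u: "bop_apply (tail N1) w = w" if "bop_apply (tail N) w = w" for w using that by (metis bop_simps(6))
    have ku: "cmod (cinner (bop_apply (y - x) w) w') \<le> s * (norm w * norm w')" if "bop_apply (tail N) w = w" for w w'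
      using cinner_apply_le[of "(y - x) * tail N" w w'] that unfolding s_def by (simp del: bop_simps(4))
    have "\<bar>2 * Re (p * cinner (bop_apply (y - x) u) v + q * cinner (bop_apply (y - x) v) u)\<bar>
        \<le> 2 * B' * s * ((norm u)\<^sup>2 + (norm v)\<^sup>2)"
      using ku[OF v, of u] by (intro bounded_tests_cross T'[OF pq] ku u) (simp_all add: mult.commute s_def)
    also have "\<dots> \<le> e / 2 * ((norm u)\<^sup>2 + (norm v)\<^sup>2)"
    proof (rule mult_right_mono)
      show "2 * B' * s \<le> e / 2" using s B' by (simp add: field_simps)
    qed simp
    finally have k: "\<bar>2 * Re (p * cinner (bop_apply (y - x) u) v + q * cinner (bop_apply (y - x) v) u)\<bar>
        \<le> e / 2 * ((norm u)\<^sup>2 + (norm v)\<^sup>2)" .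
    have "0 \<le> (1 + e / 2) * ((norm u)\<^sup>2 + (norm v)\<^sup>2) + 2 * Re (p * cinner (bop_apply x u) v + q * cinner (bop_apply x v) u)"
      by (rule passes_bopD[OF N1 pq N1u[OF u] N1u[OF v]])
    moreover have "2 * Re (p * cinner (bop_apply y u) v + q * cinner (bop_apply y v) u)
      = 2 * Re (p * cinner (bop_apply x u) v + q * cinner (bop_apply x v) u)
      + 2 * Re (p * cinner (bop_apply (y - x) u) v + q * cinner (bop_apply (y - x) v) u)"
      by (simp add: cinner_diff_left algebra_simps)
    moreover have half: "(1 + e) * ((norm u)\<^sup>2 + (norm v)\<^sup>2) = (1 + e / 2) * ((norm u)\<^sup>2 + (norm v)\<^sup>2) + e / 2 * ((norm u)\<^sup>2 + (norm v)\<^sup>2)"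
      by (simp add: algebra_simps)
    ultimately show "0 \<le> (1 + e) * ((norm u)\<^sup>2 + (norm v)\<^sup>2) + 2 * Re (p * cinner (bop_apply y u) v + q * cinner (bop_apply y v) u)"
      using k half by linarith
  qed
  then show ?thesis by blast
qed

text \<open>Far out the tests hold with the better constant, and close to the origin scaling restores
  it; the two pieces are glued along a partition that almost commutes with \<open>y\<close>.\<close>

lemma passes_bop_improve:
  assumes e: "0 < e" and y0: "passes_bop T (1 + e) 0 y" and yN: "passes_bop T (1 + e / 2) N y"
  shows "\<exists>y'. compact_op (y' - y) \<and> passes_bop T (1 + e / 2) 0 y' \<and> norm (y' - y) \<le> e * (norm y + 1)"
proof -
  obtain c d M where cd: "\<And>i. (c i)\<^sup>2 + (d i)\<^sup>2 = (1 :: real)" "\<And>i. i < N \<Longrightarrow> d i = 0"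
    "\<And>i. M \<le> i \<Longrightarrow> c i = 0 \<and> d i = 1"
    "norm (diag_op c * y * diag_op c + diag_op d * y * diag_op d - y) \<le> e"
    by (rule almost_commuting_partition[OF e, where N = N and y = y]) (rule that)
  have c1: "\<bar>c i\<bar> \<le> 1" for i
    using cd(1)[of i] zero_le_power2[of "d i"] abs_square_le_1[of "c i"] by linarith
  have d1: "\<bar>d i\<bar> \<le> 1" for i
    using cd(1)[of i] zero_le_power2[of "c i"] abs_square_le_1[of "d i"] by linarith
  define f where "f = diag_op c"
  define g where "g = diag_op d"
  note fn = diag_op_apply[of c, OF c1, folded f_def]
  note gn = diag_op_apply[of d, OF d1, folded g_def]
  \<comment> \<open>The factor that scales the constant \<open>1 + e\<close> down to
    \<open>1 + e / 2\<close>. It is applied only to the piece near the origin, since scaling the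
    rest would not be a compact change.\<close>
  define r where "r = (1 + e / 2) / (1 + e)"
  have r: "0 \<le> r" "r \<le> 1" "r * (1 + e) = 1 + e / 2" "1 - r \<le> e"
    using e by (simp_all add: r_def field_simps)
  define y' where "y' = r *\<^sub>R (f * y * f) + g * y * g"
  have "compact_op (y' - y)"
  proof -
    have fM: "f * head M = f"
      by (intro bop_eqI ell2_eqI) (use cd(3) in \<open>auto simp: fn not_less\<close>)
    have gM: "(g - 1) * head M = g - 1" "head M * (g - 1) = g - 1"
      by (intro bop_eqI ell2_eqI; use cd(3) in \<open>auto simp: gn not_less\<close>)+
    have "(r *\<^sub>R (f * y * f)) * head M = r *\<^sub>R (f * y * f)"
      by (simp add: mult.assoc fM)
    then have 1: "compact_op (r *\<^sub>R (f * y * f))" by (metis compact_op_head_right)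
    have "head M * ((g - 1) * y * g) = (g - 1) * y * g"
      by (simp only: mult.assoc[symmetric] gM(2))
    then have 2: "compact_op ((g - 1) * y * g)" by (metis compact_op_head_left)
    have "(y * (g - 1)) * head M = y * (g - 1)"
      by (simp only: mult.assoc gM(1))
    then have 3: "compact_op (y * (g - 1))" by (metis compact_op_head_right)
    have "compact_op (r *\<^sub>R (f * y * f) + ((g - 1) * y * g + y * (g - 1)))"
      by (intro compact_op_add 1 2 3)
    moreover have "r *\<^sub>R (f * y * f) + ((g - 1) * y * g + y * (g - 1)) = y' - y"
      by (simp add: y'_def algebra_simps)
    ultimately show ?thesis by simp
  qed
  moreover have "passes_bop T (1 + e / 2) 0 y'"
  proof (rule passes_bopI)
    fix p q u v assume pq: "(p, q) \<in> T"
    \<comment> \<open>There are no cross terms between \<open>f\<close> and \<open>g\<close>, so the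
      test of \<open>y'\<close> is the sum of two tests of \<open>y\<close>: one on the whole space,
      scaled by \<open>r\<close>, and one on vectors in the range of \<open>tail N\<close>.\<close>
    have ci: "cinner (bop_apply y' a) b = of_real r * cinner (bop_apply y (bop_apply f a)) (bop_apply f b)
        + cinner (bop_apply y (bop_apply g a)) (bop_apply g b)" for a b
      unfolding y'_def f_def g_def by (simp add: cinner_simps diag_op_cinner[OF c1] diag_op_cinner[OF d1])
    have pyt: "(norm (bop_apply f a))\<^sup>2 + (norm (bop_apply g a))\<^sup>2 = (norm a)\<^sup>2" for a
      unfolding f_def g_def by (rule norm_diag_op_Pythagoras[OF cd(1)])
    have gt: "bop_apply (tail N) (bop_apply g a) = bop_apply g a" for a
      by (rule ell2_eqI) (simp add: gn cd(2))
    have re: "r * ((1 + e) * S + F) = (1 + e / 2) * S + r * F" for S F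
      unfolding r(3)[symmetric] by (simp add: algebra_simps)
    let ?F = "\<lambda>h. 2 * Re (p * cinner (bop_apply y (bop_apply h u)) (bop_apply h v) + q * cinner (bop_apply y (bop_apply h v)) (bop_apply h u))"
    have "0 \<le> (1 + e) * ((norm (bop_apply f u))\<^sup>2 + (norm (bop_apply f v))\<^sup>2) + ?F f"
      by (rule passes_bopD[OF y0 pq]) simp_all
    then have "0 \<le> r * ((1 + e) * ((norm (bop_apply f u))\<^sup>2 + (norm (bop_apply f v))\<^sup>2) + ?F f)"
      using r(1) by simp
    also have "\<dots> = (1 + e / 2) * ((norm (bop_apply f u))\<^sup>2 + (norm (bop_apply f v))\<^sup>2) + r * ?F f"
      by (rule re)
    finally have 1: "0 \<le> (1 + e / 2) * ((norm (bop_apply f u))\<^sup>2 + (norm (bop_apply f v))\<^sup>2) + r * ?F f" .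
    have 2: "0 \<le> (1 + e / 2) * ((norm (bop_apply g u))\<^sup>2 + (norm (bop_apply g v))\<^sup>2) + ?F g"
      by (rule passes_bopD[OF yN pq gt gt])
    have "2 * Re (p * cinner (bop_apply y' u) v + q * cinner (bop_apply y' v) u) = r * ?F f + ?F g"
      unfolding ci by (simp add: algebra_simps)
    moreover have "(1 + e / 2) * ((norm u)\<^sup>2 + (norm v)\<^sup>2) = (1 + e / 2) * ((norm (bop_apply f u))\<^sup>2 + (norm (bop_apply f v))\<^sup>2)
       + (1 + e / 2) * ((norm (bop_apply g u))\<^sup>2 + (norm (bop_apply g v))\<^sup>2)"
      unfolding pyt[of u, symmetric] pyt[of v, symmetric] by (simp add: algebra_simps)
    ultimately show "0 \<le> (1 + e / 2) * ((norm u)\<^sup>2 + (norm v)\<^sup>2) + 2 * Re (p * cinner (bop_apply y' u) v + q * cinner (bop_apply y' v) u)"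
      using 1 2 by linarith
  qed
  moreover have "norm (y' - y) \<le> e * (norm y + 1)"
  proof -
    have nf: "norm f \<le> 1" unfolding f_def by (rule norm_diag_op[OF c1])
    have "norm (f * y * f) \<le> norm f * norm y * norm f"
      by (intro order_trans[OF norm_mult_ineq] mult_right_mono norm_mult_ineq) simp
    also have "\<dots> \<le> 1 * norm y * 1" by (intro mult_mono nf) auto
    finally have "(1 - r) * norm (f * y * f) \<le> e * norm y" using r e by (intro mult_mono) auto
    moreover have "y' - y = (f * y * f + g * y * g - y) - (1 - r) *\<^sub>R (f * y * f)"
      by (simp add: y'_def algebra_simps)
    moreover have "norm ((1 - r) *\<^sub>R (f * y * f)) = (1 - r) * norm (f * y * f)" using r by simp
    ultimately show ?thesis
      using cd(4) norm_triangle_ineq4[of "f * y * f + g * y * g - y" "(1 - r) *\<^sub>R (f * y * f)"]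
      unfolding f_def g_def by (simp add: algebra_simps)
  qed
  ultimately show ?thesis by blast
qed

text \<open>The iteration starts with a crude constant and halves its excess at each step. Every
  \<open>Y n\<close> is a compact perturbation of \<open>x\<close>, so the tests far out remain
  available for it; the limit passes with constant 1.\<close>

lemma exists_compact_perturbation_passes:
  assumes T: "\<And>p q. (p, q) \<in> T \<Longrightarrow> cmod p \<le> B \<and> cmod q \<le> B"
    and x: "\<And>e. 0 < e \<Longrightarrow> \<exists>N. passes_bop T (1 + e) N x"
  shows "\<exists>k. compact_op k \<and> passes_bop T 1 0 (x + k)"
proof -
  \<comment> \<open>Large enough for \<open>x\<close> itself to pass every test with constant
    \<open>1 + e0\<close> by the trivial norm estimate.\<close>
  define e0 where "e0 = 2 * \<bar>B\<bar> * norm x + 1"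
  have e0: "0 < e0" unfolding e0_def by (intro add_nonneg_pos) simp_all
  define e where "e n = e0 / 2 ^ n" for n :: nat
  have e: "0 < e n" "e (Suc n) = e n / 2" for n using e0 by (simp_all add: e_def)
  define P where "P n y \<longleftrightarrow> compact_op (y - x) \<and> passes_bop T (1 + e n) 0 y" for n y
  have "P 0 x"
  proof -
    have "compact_op (head 0 * 0)" by (rule compact_op_head_left)
    moreover have "passes_bop T (1 + e 0) 0 x"
    proof (rule passes_bopI)
      fix p q u v assume "(p, q) \<in> T"
      then have pq: "cmod p \<le> \<bar>B\<bar>" "cmod q \<le> \<bar>B\<bar>" using T by fastforce+
      have "\<bar>2 * Re (p * cinner (bop_apply x u) v + q * cinner (bop_apply x v) u)\<bar>
          \<le> 2 * \<bar>B\<bar> * norm x * ((norm u)\<^sup>2 + (norm v)\<^sup>2)"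
        using cinner_apply_le[of x v u] by (intro bounded_tests_cross pq cinner_apply_le) (simp_all add: mult.commute)
      also have "\<dots> \<le> (1 + e 0) * ((norm u)\<^sup>2 + (norm v)\<^sup>2)"
        by (rule mult_right_mono) (simp_all add: e_def e0_def)
      finally show "0 \<le> (1 + e 0) * ((norm u)\<^sup>2 + (norm v)\<^sup>2) + 2 * Re (p * cinner (bop_apply x u) v + q * cinner (bop_apply x v) u)"
        by linarith
    qed
    ultimately show ?thesis by (simp add: P_def)
  qed
  moreover have "\<exists>y'. P (Suc n) y' \<and> norm (y' - y) \<le> e n * (norm y + 1)" if "P n y" for n y
  proof -
    have y: "compact_op (y - x)" "passes_bop T (1 + e n) 0 y" using that by (simp_all add: P_def)
    obtain N where "passes_bop T (1 + e n / 2) N y"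
      using passes_bop_compact_perturbation[OF T y(1) x, of "e n / 2"] e(1)[of n] by auto
    from passes_bop_improve[OF e(1) y(2) this] obtain y' where y': "compact_op (y' - y)"
      "passes_bop T (1 + e n / 2) 0 y'" "norm (y' - y) \<le> e n * (norm y + 1)" by blast
    have "compact_op (y' - x)" using compact_op_add[OF y'(1) y(1)] by simp
    then show ?thesis using y' by (intro exI[of _ y']) (simp add: P_def e(2))
  qed
  ultimately obtain Y where Y: "\<And>n. P n (Y n)" "\<And>n. norm (Y (Suc n) - Y n) \<le> e n * (norm (Y n) + 1)"
    using dependent_nat_choice[of P "\<lambda>n y y'. norm (y' - y) \<le> e n * (norm y + 1)"] by metis
  define C where "C = exp (2 * e0) * (norm (Y 0) + 1)"
  \<comment> \<open>The increments are bounded relative to the current norm, so a discrete Gronwall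
    estimate with \<open>1 + t \<le> exp t\<close> is needed before they become summable.\<close>
  have nY: "norm (Y n) + 1 \<le> exp (\<Sum>k<n. e k) * (norm (Y 0) + 1)" for n
  proof (induction n)
    case (Suc n)
    have "norm (Y (Suc n)) + 1 \<le> norm (Y n) + norm (Y (Suc n) - Y n) + 1"
      using norm_triangle_ineq2[of "Y (Suc n)" "Y n"] by simp
    also have "\<dots> \<le> (1 + e n) * (norm (Y n) + 1)" using Y(2)[of n] by (simp add: algebra_simps)
    also have "\<dots> \<le> exp (e n) * (exp (\<Sum>k<n. e k) * (norm (Y 0) + 1))"
      using e(1)[of n] by (intro mult_mono Suc exp_ge_add_one_self) simp_all
    finally show ?case by (simp add: exp_add mult_ac)
  qed simp
  have se: "(\<Sum>k<n. e k) \<le> 2 * e0" for n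
  proof -
    have "(\<Sum>k<n. e k) = e0 * (\<Sum>k<n. (1/2) ^ k)" by (simp add: e_def sum_distrib_left power_divide)
    also have "(\<Sum>k<n. (1/2 :: real) ^ k) = 2 - 2 * (1/2) ^ n" by (induction n) simp_all
    also have "e0 * (2 - 2 * (1/2) ^ n) \<le> e0 * 2" using e0 by (intro mult_left_mono) simp_all
    finally show ?thesis by simp
  qed
  have nYC: "norm (Y n) + 1 \<le> C" for n
    unfolding C_def using order_trans[OF nY[of n] mult_right_mono[of "exp (\<Sum>k<n. e k)" "exp (2 * e0)"]] se[of n] by simp
  have step: "norm (Y (Suc n) - Y n) \<le> (e0 * C) * (1/2) ^ n" for n
    using order_trans[OF Y(2)[of n] mult_left_mono[OF nYC[of n], of "e n"]] e(1)[of n]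
    by (simp add: e_def power_divide field_simps)
  have "summable (\<lambda>n. Y (Suc n) - Y n)"
    by (rule summable_comparison_test'[OF _ step]) (intro summable_mult summable_geometric, simp)
  then have "convergent (\<lambda>n. \<Sum>k<n. Y (Suc k) - Y k)" by (rule summable_iff_convergent[THEN iffD1])
  then have "convergent (\<lambda>n. Y n - Y 0)" by (simp add: sum_lessThan_telescope)
  then obtain z where "(\<lambda>n. Y n - Y 0) \<longlonglongrightarrow> z" by (auto simp: convergent_def)
  then have lim: "Y \<longlonglongrightarrow> z + Y 0" using tendsto_add[OF _ tendsto_const[of "Y 0"]] by fastforce
  define k where "k = z + Y 0 - x"
  have "compact_op k"
  proof (rule compact_op_limit)
    show "compact_op (Y n - x)" for n using Y(1)[of n] by (simp add: P_def)
    show "(\<lambda>n. Y n - x) \<longlonglongrightarrow> k" unfolding k_def by (intro tendsto_diff lim tendsto_const)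
  qed
  moreover have "passes_bop T 1 0 (x + k)"
  proof (rule passes_bopI)
    fix p q u v assume pq: "(p, q) \<in> T"
    have lim': "Y \<longlonglongrightarrow> x + k" using lim by (simp add: k_def)
    have "e \<longlonglongrightarrow> 0"
    proof -
      have "(\<lambda>n. e0 * (1/2) ^ n) \<longlonglongrightarrow> e0 * 0" by (intro tendsto_mult tendsto_const LIMSEQ_realpow_zero) auto
      then show ?thesis by (simp add: e_def[abs_def] power_divide)
    qed
    then have "(\<lambda>n. (1 + e n) * ((norm u)\<^sup>2 + (norm v)\<^sup>2) + 2 * Re (p * cinner (bop_apply (Y n) u) v + q * cinner (bop_apply (Y n) v) u))
      \<longlonglongrightarrow> (1 + 0) * ((norm u)\<^sup>2 + (norm v)\<^sup>2) + 2 * Re (p * cinner (bop_apply (x + k) u) v + q * cinner (bop_apply (x + k) v) u)"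
      by (intro tendsto_intros cinner_tendsto bop_apply_tendsto lim')
    then have "0 \<le> (1 + 0) * ((norm u)\<^sup>2 + (norm v)\<^sup>2) + 2 * Re (p * cinner (bop_apply (x + k) u) v + q * cinner (bop_apply (x + k) v) u)"
    proof (rule LIMSEQ_le_const)
      have "0 \<le> (1 + e n) * ((norm u)\<^sup>2 + (norm v)\<^sup>2) + 2 * Re (p * cinner (bop_apply (Y n) u) v + q * cinner (bop_apply (Y n) v) u)" for n
        by (rule passes_bopD[OF _ pq, of _ 0]) (use Y(1)[of n] in \<open>simp_all add: P_def\<close>)
      then show "\<exists>N. \<forall>n\<ge>N. 0 \<le> (1 + e n) * ((norm u)\<^sup>2 + (norm v)\<^sup>2) + 2 * Re (p * cinner (bop_apply (Y n) u) v + q * cinner (bop_apply (Y n) v) u)"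
        by blast
    qed
    then show "0 \<le> 1 * ((norm u)\<^sup>2 + (norm v)\<^sup>2) + 2 * Re (p * cinner (bop_apply (x + k) u) v + q * cinner (bop_apply (x + k) v) u)"
      by (simp only: add_0_right)
  qed
  ultimately show ?thesis by blast
qed

section \<open>Absolute values\<close>

lemma closed_subalgebra_mem:
  assumes "cstar_subalgebra A"
  shows "1 \<in> A" "a \<in> A \<Longrightarrow> b \<in> A \<Longrightarrow> a + b \<in> A" "a \<in> A \<Longrightarrow> b \<in> A \<Longrightarrow> a * b \<in> A"
    "a \<in> A \<Longrightarrow> scaleC_bop c a \<in> A" "a \<in> A \<Longrightarrow> adj a \<in> A" "closed A"
    "a \<in> A \<Longrightarrow> r *\<^sub>R a \<in> A" "a \<in> A \<Longrightarrow> b \<in> A \<Longrightarrow> a - b \<in> A"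
proof -
  show 1: "1 \<in> A" "a \<in> A \<Longrightarrow> b \<in> A \<Longrightarrow> a + b \<in> A" "a \<in> A \<Longrightarrow> b \<in> A \<Longrightarrow> a * b \<in> A"
    "a \<in> A \<Longrightarrow> scaleC_bop c a \<in> A" "a \<in> A \<Longrightarrow> adj a \<in> A" "closed A" for a b c
    using assms by (auto simp: cstar_subalgebra_def)
  show 2: "r *\<^sub>R a \<in> A" if "a \<in> A" for a r
    using 1(4)[OF that, of "of_real r"] by (simp add: scaleC_bop_of_real)
  show "a - b \<in> A" if "a \<in> A" "b \<in> A"
    using 1(2)[OF that(1) 2[OF that(2), of "- 1"]] by simp
qed

text \<open>The operator \<open>1 - |b|\<close> is the fixed point of \<open>r \<mapsto> (1 - b\<^sup>2 + r\<^sup>2) / 2\<close>; the scalar iteration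
  \<open>\<rho> \<mapsto> (1 + \<rho>\<^sup>2) / 2\<close> dominates the increments.\<close>

lemma exists_absolute_value:
  assumes sa: "adj b = b" and nb: "norm b \<le> 1"
  obtains s where "s * s = b * b" "s * b = b * s" "adj s = s" "\<And>u. 0 \<le> Re (cinner (bop_apply s u) u)"
    "\<And>A. cstar_subalgebra A \<Longrightarrow> b \<in> A \<Longrightarrow> s \<in> A"
proof -
  define y where "y = 1 - b * b"
  have ny: "norm y \<le> 1"
  proof (rule bop_normI)
    fix u
    have nbu: "norm (bop_apply b w) \<le> norm w" for w
      using order_trans[OF bop_norm_le[of b w] mult_right_mono[OF nb norm_ge_zero[of w]]] by simp
    have "cinner u (bop_apply b (bop_apply b u)) = of_real ((norm (bop_apply b u))\<^sup>2)"
      using cinner_adj[of b u "bop_apply b u"] by (simp add: sa cinner_self)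
    then have "(norm (bop_apply y u))\<^sup>2 = (norm u)\<^sup>2 + (norm (bop_apply b (bop_apply b u)))\<^sup>2 - 2 * (norm (bop_apply b u))\<^sup>2"
      using norm_add_sq_ell2[of u "- bop_apply b (bop_apply b u)"] by (simp add: y_def cinner_minus_right)
    also have "\<dots> \<le> (norm u)\<^sup>2"
    proof -
      have "(norm (bop_apply b (bop_apply b u)))\<^sup>2 \<le> (norm (bop_apply b u))\<^sup>2"
        by (rule power_mono[OF nbu]) simp
      then show ?thesis using zero_le_power2[of "norm (bop_apply b u)"] by linarith
    qed
    finally show "norm (bop_apply y u) \<le> 1 * norm u"
      using power2_le_imp_le[of "norm (bop_apply y u)" "norm u"] by simp
  qed
  \<comment> \<open>The iterates are polynomials in \<open>b * b\<close>; hence they commute with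
    \<open>b\<close>, are self-adjoint and stay in every closed subalgebra that contains
    \<open>b\<close>.\<close>
  define r where "r = rec_nat 0 (\<lambda>_ r. (1/2) *\<^sub>R (y + r * r))"
  have r: "r 0 = 0" "r (Suc n) = (1/2) *\<^sub>R (y + r n * r n)" for n by (simp_all add: r_def)
  \<comment> \<open>The scalar increments telescope and their sums never exceed 1. This gives
    convergence of \<open>r\<close> even when \<open>norm y = 1\<close>, where no geometric estimate
    applies.\<close>
  define \<rho> where "\<rho> = rec_nat 0 (\<lambda>_ t :: real. (1 + t * t) / 2)"
  have \<rho>: "\<rho> 0 = 0" "\<rho> (Suc n) = (1 + \<rho> n * \<rho> n) / 2" for n by (simp_all add: \<rho>_def)
  have \<rho>01: "0 \<le> \<rho> n \<and> \<rho> n \<le> 1" for n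
  proof (induction n)
    case (Suc n)
    then have "\<rho> n * \<rho> n \<le> 1 * 1" by (intro mult_mono) auto
    then show ?case using Suc by (simp add: \<rho>)
  qed (simp add: \<rho>)
  have nr: "norm (r n) \<le> \<rho> n" for n
  proof (induction n)
    case (Suc n)
    have "norm (r (Suc n)) \<le> (1/2) * (norm y + norm (r n * r n))"
      by (simp add: r norm_triangle_ineq)
    also have "norm (r n * r n) \<le> \<rho> n * \<rho> n"
      using \<rho>01[of n] by (intro order_trans[OF norm_mult_ineq] mult_mono Suc) simp_all
    finally show ?case using ny by (simp add: \<rho>)
  qed (simp add: r \<rho>)
  have incr: "norm (r (Suc n) - r n) \<le> \<rho> (Suc n) - \<rho> n" for n
  proof (induction n)
    case 0
    then show ?case using ny by (simp add: r \<rho>)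
  next
    case (Suc n)
    have "r (Suc (Suc n)) - r (Suc n) = (1/2) *\<^sub>R (r (Suc n) * r (Suc n) - r n * r n)"
      by (simp add: r(2)[of "Suc n"] r(2)[of n] algebra_simps)
    also have "r (Suc n) * r (Suc n) - r n * r n = r (Suc n) * (r (Suc n) - r n) + (r (Suc n) - r n) * r n"
      by (simp add: algebra_simps)
    finally have "norm (r (Suc (Suc n)) - r (Suc n)) \<le> (1/2) * (norm (r (Suc n) * (r (Suc n) - r n)) + norm ((r (Suc n) - r n) * r n))"
      by (simp add: norm_triangle_ineq)
    also have "norm (r (Suc n) * (r (Suc n) - r n)) \<le> \<rho> (Suc n) * (\<rho> (Suc n) - \<rho> n)"
      using \<rho>01[of "Suc n"] by (intro order_trans[OF norm_mult_ineq] mult_mono Suc nr) simp_all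
    also have "norm ((r (Suc n) - r n) * r n) \<le> (\<rho> (Suc n) - \<rho> n) * \<rho> n"
      using \<rho>01[of n] order_trans[OF norm_ge_zero Suc] by (intro order_trans[OF norm_mult_ineq] mult_mono Suc nr) simp_all
    finally have "norm (r (Suc (Suc n)) - r (Suc n)) \<le> (\<rho> (Suc n) * \<rho> (Suc n) - \<rho> n * \<rho> n) / 2"
      by (simp add: algebra_simps)
    moreover have "t - t' = (p - p') / 2" if "t = (1 + p) / 2" "t' = (1 + p') / 2" for t t' p p' :: real
      using that by simp
    from this[OF \<rho>(2)[of "Suc n"] \<rho>(2)[of n]]
    have "\<rho> (Suc (Suc n)) - \<rho> (Suc n) = (\<rho> (Suc n) * \<rho> (Suc n) - \<rho> n * \<rho> n) / 2" .
    ultimately show ?case by simp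
  qed
  have "summable (\<lambda>n. norm (r (Suc n) - r n))"
  proof (rule summableI_nonneg_bounded[where x = 1])
    fix n
    have "(\<Sum>k<n. norm (r (Suc k) - r k)) \<le> (\<Sum>k<n. \<rho> (Suc k) - \<rho> k)" by (intro sum_mono incr)
    also have "\<dots> = \<rho> n" by (subst sum_lessThan_telescope) (simp add: \<rho>(1))
    also have "\<dots> \<le> 1" using \<rho>01[of n] by simp
    finally show "(\<Sum>k<n. norm (r (Suc k) - r k)) \<le> 1" .
  qed simp
  then have "summable (\<lambda>n. r (Suc n) - r n)" by (rule summable_norm_cancel)
  then have "convergent (\<lambda>n. \<Sum>k<n. r (Suc k) - r k)" by (rule summable_iff_convergent[THEN iffD1])
  then have "convergent r" unfolding sum_lessThan_telescope by (simp add: r(1))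
  then obtain q where q: "r \<longlonglongrightarrow> q" by (auto simp: convergent_def)
  have "(\<lambda>n. r (Suc n)) \<longlonglongrightarrow> (1/2) *\<^sub>R (y + q * q)" unfolding r by (intro tendsto_intros q)
  then have qq: "q = (1/2) *\<^sub>R (y + q * q)" using LIMSEQ_unique[OF LIMSEQ_Suc[OF q]] by blast
  have nq: "norm q \<le> 1"
    by (rule LIMSEQ_le_const2[OF tendsto_norm[OF q]]) (use nr \<rho>01 order_trans in blast)
  define s where "s = 1 - q"
  have "q + q = y + q * q" using arg_cong[OF qq, of "\<lambda>x. 2 *\<^sub>R x"] by (simp add: scaleR_2)
  then have "s * s = b * b" by (simp add: s_def y_def algebra_simps)
  moreover have "s * b = b * s"
  proof -
    have "r n * b = b * r n" for n
    proof (induction n)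
      case (Suc n)
      have "r n * r n * b = b * (r n * r n)" using Suc by (metis mult.assoc)
      then show ?case by (simp add: r y_def distrib_left distrib_right left_diff_distrib right_diff_distrib mult.assoc)
    qed (simp add: r)
    then have "(\<lambda>n. b * r n) \<longlonglongrightarrow> q * b" using tendsto_mult[OF q tendsto_const[of b]] by simp
    then have "q * b = b * q" using tendsto_mult[OF tendsto_const[of b] q] LIMSEQ_unique by blast
    then show ?thesis by (simp add: s_def algebra_simps)
  qed
  moreover have "adj s = s"
  proof -
    have "adj (r n) = r n" for n
      by (induction n) (simp_all add: r y_def adj_scaleR adj_add adj_diff adj_mult sa, rule adjI, simp)
    then have rc: "cinner (bop_apply (r n) u) v = cinner u (bop_apply (r n) v)" for n u v
      using cinner_adj[of "r n" u v] by simp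
    have "cinner (bop_apply q u) v = cinner u (bop_apply q v)" for u v
    proof -
      have 1: "(\<lambda>n. cinner (bop_apply (r n) u) v) \<longlonglongrightarrow> cinner (bop_apply q u) v"
        by (intro cinner_tendsto bop_apply_tendsto q)
      have "(\<lambda>n. cnj (cinner (bop_apply (r n) v) u)) \<longlonglongrightarrow> cnj (cinner (bop_apply q v) u)"
        by (intro tendsto_cnj cinner_tendsto bop_apply_tendsto q)
      then have "(\<lambda>n. cinner (bop_apply (r n) u) v) \<longlonglongrightarrow> cinner u (bop_apply q v)"
        by (simp add: rc flip: cinner_commute)
      with 1 show ?thesis using LIMSEQ_unique by blast
    qed
    then have "adj q = q" by (rule adjI)
    then show ?thesis by (simp add: s_def adj_diff)
  qed
  moreover have "0 \<le> Re (cinner (bop_apply s u) u)" for u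
  proof -
    have "Re (cinner (bop_apply q u) u) \<le> cmod (cinner (bop_apply q u) u)" by (rule complex_Re_le_cmod)
    also have "\<dots> \<le> norm q * (norm u * norm u)" by (rule cinner_apply_le)
    also have "\<dots> \<le> 1 * (norm u * norm u)" by (intro mult_right_mono nq) simp
    finally show ?thesis by (simp add: s_def cinner_diff_left cinner_self power2_eq_square)
  qed
  moreover have "s \<in> A" if A: "cstar_subalgebra A" "b \<in> A" for A
  proof -
    note mem = closed_subalgebra_mem[OF A(1)]
    have "r n \<in> A" for n
    proof (induction n)
      case 0
      have "0 *\<^sub>R (1 :: bop) \<in> A" by (rule mem(7)[OF mem(1)])
      then show ?case by (simp add: r)
    qed (auto simp: r y_def intro!: mem(2,3,7,8) mem(1) A(2))
    then have "q \<in> A" using closed_sequentially[OF mem(6) _ q] by blast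
    then show ?thesis unfolding s_def by (rule mem(8)[OF mem(1)])
  qed
  ultimately show ?thesis by (rule that)
qed

text \<open>The operator \<open>z = (1/2) *\<^sub>R (s + b)\<close> is the positive part of
  \<open>b\<close>, and \<open>b * z = s * z = z * z\<close>. So the form of \<open>b\<close> is
  nonnegative at every \<open>z \<xi>\<close>, while it is nonpositive on the range of
  \<open>tail N\<close>. For \<open>\<xi>\<close> in the unit ball and far out,
  \<open>z \<xi>\<close> lies almost in that range and must be small.\<close>

lemma compact_positive_part:
  assumes sa: "adj b = b" and s: "s * s = b * b" "s * b = b * s" "adj s = s"
    and pos: "\<And>u. 0 \<le> Re (cinner (bop_apply s u) u)"
    and tl: "\<And>u. bop_apply (tail N) u = u \<Longrightarrow> Re (cinner (bop_apply b u) u) \<le> 0"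
  shows "compact_op ((1/2) *\<^sub>R (s + b))"
proof (rule compact_opI, rule ccontr)
  define z where "z = (1/2) *\<^sub>R (s + b)"
  assume "\<not> (\<lambda>m. norm ((1/2) *\<^sub>R (s + b) * tail m)) \<longlonglongrightarrow> 0"
  then have "\<not> (\<lambda>m. norm (z * tail m)) \<longlonglongrightarrow> 0" by (simp add: z_def)
  then obtain e \<xi> where \<xi>: "0 < e" "\<And>m. bop_apply (tail m) (\<xi> m) = \<xi> m" "\<And>m. norm (\<xi> m) \<le> 1"
    "\<And>m. e < norm (bop_apply z (\<xi> m))" by (rule norm_mult_tail_witness) blast
  have bz: "b * z = s * z" by (simp add: z_def s algebra_simps)
  have zz: "z * z = s * z" by (simp add: z_def s(1) s(2) algebra_simps flip: scaleR_2 scaleR_add_left)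
  have az: "adj z = z" by (simp add: z_def adj_scaleR adj_add s(3) sa)
  define \<eta> where "\<eta> m = bop_apply z (\<xi> m)" for m
  have n\<eta>: "norm (\<eta> m) \<le> norm z" for m
    unfolding \<eta>_def using order_trans[OF bop_norm_le[of z "\<xi> m"] mult_left_mono[OF \<xi>(3)[of m] norm_ge_zero[of z]]] by simp
  \<comment> \<open>Measures how far \<open>z \<xi>\<close> is from the range of
    \<open>tail N\<close> when \<open>\<xi>\<close> lies in the tail \<open>m\<close>.\<close>
  define h where "h m = norm (head N * z * tail m)" for m
  have h0: "h \<longlonglongrightarrow> 0" unfolding h_def by (rule head_mult_tail_tendsto)
  have hb: "norm (bop_apply (head N) (\<eta> m)) \<le> h m" for m
  proof -
    have "bop_apply (head N) (\<eta> m) = bop_apply (head N * z * tail m) (\<xi> m)" by (simp add: \<eta>_def \<xi>(2))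
    also have "norm \<dots> \<le> h m * norm (\<xi> m)" unfolding h_def by (rule bop_norm_le)
    also have "\<dots> \<le> h m * 1" by (intro mult_left_mono \<xi>) (simp add: h_def)
    finally show ?thesis by simp
  qed
  define C where "C = (norm s + 1) * (2 * norm b * norm z)"
  \<comment> \<open>The fourth power results from two quadratic losses:
    \<open>norm (\<eta> m)\<close> squared is at most the norm of \<open>s \<eta>\<close>, and the
    square of the latter is controlled by the form of \<open>s\<close> at
    \<open>\<eta>\<close>.\<close>
  have "(norm (bop_apply z (\<xi> m))) ^ 4 \<le> C * h m" for m
  proof -
    let ?h = "bop_apply (head N) (\<eta> m)" and ?t = "bop_apply (tail N) (\<eta> m)"
    have \<eta>ht: "\<eta> m = ?h + ?t" by (simp add: head_eq)
    have t: "bop_apply (tail N) ?t = ?t" using tail_tail[of N N] by (metis bop_simps(6) order_refl)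
    have e1: "cinner (bop_apply b (\<eta> m)) (\<eta> m) = cinner (bop_apply b ?t) ?t + (cinner (bop_apply b ?h) (\<eta> m) + cinner (bop_apply b ?t) ?h)"
    proof -
      have "cinner (bop_apply b (\<eta> m)) (\<eta> m) = cinner (bop_apply b ?h) (\<eta> m) + cinner (bop_apply b ?t) (\<eta> m)"
        by (subst (1) \<eta>ht) (simp only: bop_linear cinner_add_left)
      also have "cinner (bop_apply b ?t) (\<eta> m) = cinner (bop_apply b ?t) ?h + cinner (bop_apply b ?t) ?t"
        by (subst (2) \<eta>ht) (simp only: cinner_add_right)
      finally show ?thesis by simp
    qed
    have e2: "Re (cinner (bop_apply b ?h) (\<eta> m)) \<le> norm b * (h m * norm z)"
    proof -
      have "Re (cinner (bop_apply b ?h) (\<eta> m)) \<le> norm b * (norm ?h * norm (\<eta> m))"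
        using order_trans[OF complex_Re_le_cmod cinner_apply_le] .
      also have "\<dots> \<le> norm b * (h m * norm z)" by (intro mult_left_mono mult_mono hb n\<eta>) (auto simp: h_def)
      finally show ?thesis .
    qed
    have e3: "Re (cinner (bop_apply b ?t) ?h) \<le> norm b * (h m * norm z)"
    proof -
      have "Re (cinner (bop_apply b ?t) ?h) \<le> norm b * (norm ?t * norm ?h)"
        using order_trans[OF complex_Re_le_cmod cinner_apply_le] .
      also have "\<dots> \<le> norm b * (norm z * h m)"
        by (intro mult_left_mono mult_mono hb order_trans[OF norm_tail_apply n\<eta>]) auto
      finally show ?thesis by (simp add: mult.commute)
    qed
    have e4: "cinner (bop_apply b (\<eta> m)) (\<eta> m) = cinner (bop_apply s (\<eta> m)) (\<eta> m)"
      using arg_cong[OF bz, of "\<lambda>x. bop_apply x (\<xi> m)"] by (simp add: \<eta>_def)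
    have "Re (cinner (bop_apply s (\<eta> m)) (\<eta> m))
        = Re (cinner (bop_apply b ?t) ?t) + (Re (cinner (bop_apply b ?h) (\<eta> m)) + Re (cinner (bop_apply b ?t) ?h))"
      unfolding e4[symmetric] e1 by simp
    then have sle: "Re (cinner (bop_apply s (\<eta> m)) (\<eta> m)) \<le> 2 * norm b * norm z * h m"
      using tl[OF t] e2 e3 by (simp add: ac_simps)
    define w where "w = bop_apply s (\<eta> m)"
    \<comment> \<open>Positivity of \<open>s\<close> at \<open>\<eta> - \<tau> w\<close> bounds
      \<open>norm w\<close> squared by \<open>norm s + 1\<close> times the form of \<open>s\<close>
      at \<open>\<eta>\<close>, without a square root of \<open>s\<close>. The summand 1 excludes
      division by 0.\<close>
    define \<tau> where "\<tau> = 1 / (norm s + 1)"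
    have \<tau>: "0 < \<tau>" "\<tau> * (norm s + 1) = 1" "\<tau> * norm s \<le> 1"
    proof -
      have "norm s + 1 > 0" using norm_ge_zero[of s] by linarith
      then show "0 < \<tau>" "\<tau> * (norm s + 1) = 1" "\<tau> * norm s \<le> 1" by (simp_all add: \<tau>_def field_simps)
    qed
    have sym: "cinner (bop_apply s w) (\<eta> m) = of_real ((norm w)\<^sup>2)"
      using cinner_adj[of s w "\<eta> m"] by (simp add: s(3) w_def cinner_self)
    have "0 \<le> Re (cinner (bop_apply s (\<eta> m - \<tau> *\<^sub>R w)) (\<eta> m - \<tau> *\<^sub>R w))" by (rule pos)
    also have "\<dots> = Re (cinner (bop_apply s (\<eta> m)) (\<eta> m)) - 2 * \<tau> * (norm w)\<^sup>2 + \<tau> * \<tau> * Re (cinner (bop_apply s w) w)"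
      by (simp add: bop_linear cinner_simps sym cinner_self flip: w_def) (simp add: algebra_simps)
    also have "\<tau> * \<tau> * Re (cinner (bop_apply s w) w) \<le> \<tau> * (norm w)\<^sup>2"
    proof -
      have "Re (cinner (bop_apply s w) w) \<le> norm s * (norm w * norm w)"
        using order_trans[OF complex_Re_le_cmod cinner_apply_le] .
      then have "\<tau> * \<tau> * Re (cinner (bop_apply s w) w) \<le> \<tau> * \<tau> * (norm s * (norm w * norm w))"
        using \<tau>(1) by (intro mult_left_mono) auto
      also have "\<dots> = (\<tau> * norm s) * (\<tau> * (norm w)\<^sup>2)" by (simp add: power2_eq_square)
      also have "\<dots> \<le> 1 * (\<tau> * (norm w)\<^sup>2)" using \<tau> by (intro mult_right_mono) auto
      finally show ?thesis by simp
    qed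
    finally have "\<tau> * (norm w)\<^sup>2 \<le> 2 * norm b * norm z * h m" using sle by simp
    then have "(norm s + 1) * (\<tau> * (norm w)\<^sup>2) \<le> (norm s + 1) * (2 * norm b * norm z * h m)"
      by (intro mult_left_mono) simp_all
    then have nw: "(norm w)\<^sup>2 \<le> C * h m"
      using \<tau>(2) by (simp add: C_def mult.assoc[symmetric] mult.commute[of _ \<tau>])
    have "(norm (\<eta> m))\<^sup>2 \<le> norm w"
    proof -
      have "of_real ((norm (\<eta> m))\<^sup>2) = cinner w (\<xi> m)"
        using cinner_adj[of z "\<eta> m" "\<xi> m"] arg_cong[OF zz, of "\<lambda>x. bop_apply x (\<xi> m)"]
        by (simp add: az \<eta>_def w_def cinner_self)
      then have "(norm (\<eta> m))\<^sup>2 = cmod (cinner w (\<xi> m))"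
        by (metis abs_of_nonneg norm_of_real zero_le_power2)
      also have "\<dots> \<le> norm w * norm (\<xi> m)" by (rule norm_cinner_le)
      also have "\<dots> \<le> norm w * 1" by (intro mult_left_mono \<xi>) simp
      finally show ?thesis by simp
    qed
    then have "((norm (\<eta> m))\<^sup>2)\<^sup>2 \<le> (norm w)\<^sup>2" by (intro power_mono) simp_all
    with nw show ?thesis by (simp add: \<eta>_def)
  qed
  then have "e ^ 4 \<le> C * h m" for m
    using order_trans[OF power_mono[OF less_imp_le[OF \<xi>(4)[of m]], of 4]] \<xi>(1) by (simp add: less_imp_le)
  moreover have "(\<lambda>m. C * h m) \<longlonglongrightarrow> C * 0" by (intro tendsto_mult tendsto_const h0)
  ultimately have "e ^ 4 \<le> C * 0" by (intro LIMSEQ_le_const[of "\<lambda>m. C * h m"]) auto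
  then show False using \<xi>(1) by simp
qed

section \<open>Completely positive maps\<close>

abbreviation kern :: "complex mat \<Rightarrow> nat \<Rightarrow> nat \<Rightarrow> complex" where
  "kern A \<equiv> (\<lambda>i j. A $$ (i, j))"

lemma mat_form_eq_frm:
  assumes "A \<in> carrier_mat n n" "v \<in> carrier_vec n" "w \<in> carrier_vec n"
  shows "(A *\<^sub>v v) \<bullet>c w = frm {..<n} (kern A) (\<lambda>i. v $ i) (\<lambda>i. w $ i)"
  using assms by (simp add: frm_def scalar_prod_def atLeast0LessThan sum_distrib_right)

lemma frm_vec:
  "A \<in> carrier_mat n n \<Longrightarrow> frm {..<n} (kern A) x y = (A *\<^sub>v Matrix.vec n x) \<bullet>c Matrix.vec n y"
  by (subst mat_form_eq_frm) (auto intro!: frm_cong)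

lemma positive_mat_iff: "positive_mat n h \<longleftrightarrow> h \<in> carrier_mat n n \<and> psd {..<n} (kern h)"
proof -
  have "(\<forall>v\<in>carrier_vec n. (h *\<^sub>v v) \<bullet>c v \<in> \<real>\<^sub>\<ge>\<^sub>0) \<longleftrightarrow> psd {..<n} (kern h)" if h: "h \<in> carrier_mat n n"
    unfolding psd_def
  proof (intro iffI allI ballI)
    fix x assume "\<forall>v\<in>carrier_vec n. (h *\<^sub>v v) \<bullet>c v \<in> \<real>\<^sub>\<ge>\<^sub>0"
    then show "frm {..<n} (kern h) x x \<in> \<real>\<^sub>\<ge>\<^sub>0" unfolding frm_vec[OF h] by simp
  next
    fix v :: "complex Matrix.vec" assume "\<forall>x. frm {..<n} (kern h) x x \<in> \<real>\<^sub>\<ge>\<^sub>0" "v \<in> carrier_vec n"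
    then show "(h *\<^sub>v v) \<bullet>c v \<in> \<real>\<^sub>\<ge>\<^sub>0" using mat_form_eq_frm[OF h] by simp
  qed
  then show ?thesis unfolding positive_mat_def by blast
qed

lemma min_level_iff: "a \<in> min_level n K \<longleftrightarrow> a \<in> carrier_mat n n \<and> kmin n K (kern a)"
proof
  assume "a \<in> min_level n K"
  then obtain m h l where a: "a \<in> carrier_mat n n" and h: "\<forall>j<m. positive_mat n (h j) \<and> l j \<in> K"
    and sum: "msum n m h = 1\<^sub>m n" "a = msum n m (\<lambda>j. l j \<cdot>\<^sub>m h j)"
    unfolding min_level_def by auto
  have "(\<Sum>j<m. kern (h j) i k) = unitk i k" if "i < n" "k < n" for i k
    using arg_cong[OF sum(1), of "\<lambda>x. x $$ (i, k)"] that by (simp add: msum_def)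
  moreover have "(\<Sum>j<m. l j * kern (h j) i k) = kern a i k" if ik: "i < n" "k < n" for i k
  proof -
    have "kern a i k = (\<Sum>j<m. (l j \<cdot>\<^sub>m h j) $$ (i, k))"
      using arg_cong[OF sum(2), of "\<lambda>x. x $$ (i, k)"] ik by (simp add: msum_def)
    also have "\<dots> = (\<Sum>j<m. l j * kern (h j) i k)"
      by (rule sum.cong) (use h ik in \<open>auto simp: positive_mat_iff\<close>)
    finally show ?thesis by simp
  qed
  ultimately have "kmin n K (kern a)"
    unfolding kmin_def using h
    by (intro exI[of _ "{..<m}"] exI[of _ "\<lambda>j. kern (h j)"] exI[of _ l]) (auto simp: positive_mat_iff)
  with a show "a \<in> carrier_mat n n \<and> kmin n K (kern a)" by simp
next
  assume a: "a \<in> carrier_mat n n \<and> kmin n K (kern a)"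
  obtain J :: "nat set" and h l where J: "finite J" "card J \<le> 4 * n * n" "\<And>j. j \<in> J \<Longrightarrow> psd {..<n} (h j)" "\<And>j. j \<in> J \<Longrightarrow> l j \<in> K"
    "\<And>i k. i < n \<Longrightarrow> k < n \<Longrightarrow> (\<Sum>j\<in>J. h j i k) = unitk i k"
    "\<And>i k. i < n \<Longrightarrow> k < n \<Longrightarrow> (\<Sum>j\<in>J. l j * h j i k) = kern a i k"
    by (rule kmin_card_le[OF conjunct2[OF a]]) (rule that)
  obtain f where f: "bij_betw f {..<card J} J"
    using ex_bij_betw_nat_finite[OF J(1)] by (auto simp: atLeast0LessThan)
  then have fJ: "f j \<in> J" if "j < card J" for j using that by (auto dest: bij_betwE)
  define H where "H j = Matrix.mat n n (\<lambda>(i, k). h (f j) i k)" for j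
  have "msum n (card J) H = 1\<^sub>m n"
  proof (rule eq_matI)
    fix i k assume "i < dim_row (1\<^sub>m n)" "k < dim_col (1\<^sub>m n)"
    then show "msum n (card J) H $$ (i, k) = 1\<^sub>m n $$ (i, k)"
      using J(5)[of i k] sum.reindex_bij_betw[OF f, of "\<lambda>j. h j i k"] by (simp add: msum_def H_def)
  qed (simp_all add: msum_def)
  moreover have "a = msum n (card J) (\<lambda>j. l (f j) \<cdot>\<^sub>m H j)"
  proof (rule eq_matI)
    fix i k assume "i < dim_row (msum n (card J) (\<lambda>j. l (f j) \<cdot>\<^sub>m H j))" "k < dim_col (msum n (card J) (\<lambda>j. l (f j) \<cdot>\<^sub>m H j))"
    then show "a $$ (i, k) = msum n (card J) (\<lambda>j. l (f j) \<cdot>\<^sub>m H j) $$ (i, k)"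
      using J(6)[of i k] sum.reindex_bij_betw[OF f, of "\<lambda>j. l j * h j i k"] by (simp add: msum_def H_def)
  qed (use a in \<open>auto simp: msum_def\<close>)
  moreover have "positive_mat n (H j)" if "j < card J" for j
  proof -
    have "psd {..<n} (kern (H j)) \<longleftrightarrow> psd {..<n} (h (f j))"
      by (rule psd_cong) (simp add: H_def)
    then show ?thesis using J(3)[OF fJ[OF that]] by (simp add: positive_mat_iff H_def)
  qed
  ultimately show "a \<in> min_level n K"
    using a J(4) fJ unfolding min_level_def
    by (intro CollectI conjI exI[of _ "card J"] exI[of _ H] exI[of _ "\<lambda>j. l (f j)"]) auto
qed

lemma block_positive_mat_iff:
  assumes "\<And>i j. i < k \<Longrightarrow> j < k \<Longrightarrow> b i j \<in> carrier_mat n n"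
  shows "block_positive_mat n k b \<longleftrightarrow> (\<forall>\<eta>. (\<Sum>i<k. \<Sum>j<k. frm {..<n} (kern (b i j)) (\<eta> j) (\<eta> i)) \<in> \<real>\<^sub>\<ge>\<^sub>0)"
proof -
  have eq: "(\<Sum>i<k. \<Sum>j<k. frm {..<n} (kern (b i j)) (x j) (x i)) = (\<Sum>i<k. \<Sum>j<k. (b i j *\<^sub>v Matrix.vec n (x j)) \<bullet>c Matrix.vec n (x i))" for x
    using assms by (intro sum.cong refl frm_vec) auto
  show ?thesis
    unfolding block_positive_mat_def
  proof (intro iffI allI impI)
    fix x assume H: "\<forall>\<eta>. (\<forall>i<k. \<eta> i \<in> carrier_vec n) \<longrightarrow> (\<Sum>i<k. \<Sum>j<k. (b i j *\<^sub>v \<eta> j) \<bullet>c \<eta> i) \<in> \<real>\<^sub>\<ge>\<^sub>0"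
    show "(\<Sum>i<k. \<Sum>j<k. frm {..<n} (kern (b i j)) (x j) (x i)) \<in> \<real>\<^sub>\<ge>\<^sub>0"
      unfolding eq by (rule H[rule_format]) simp
  next
    fix \<eta> :: "nat \<Rightarrow> complex Matrix.vec"
    assume H: "\<forall>\<eta>. (\<Sum>i<k. \<Sum>j<k. frm {..<n} (kern (b i j)) (\<eta> j) (\<eta> i)) \<in> \<real>\<^sub>\<ge>\<^sub>0"
      and \<eta>: "\<forall>i<k. \<eta> i \<in> carrier_vec n"
    have "(\<Sum>i<k. \<Sum>j<k. (b i j *\<^sub>v \<eta> j) \<bullet>c \<eta> i) = (\<Sum>i<k. \<Sum>j<k. frm {..<n} (kern (b i j)) (\<lambda>p. \<eta> j $ p) (\<lambda>p. \<eta> i $ p))"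
      using assms \<eta> by (intro sum.cong refl mat_form_eq_frm) auto
    then show "(\<Sum>i<k. \<Sum>j<k. (b i j *\<^sub>v \<eta> j) \<bullet>c \<eta> i) \<in> \<real>\<^sub>\<ge>\<^sub>0"
      using H[rule_format, of "\<lambda>i p. \<eta> i $ p"] by simp
  qed
qed

lemma ucp_mapD:
  assumes "ucp_map n A \<phi>"
  shows "a \<in> A \<Longrightarrow> \<phi> a \<in> carrier_mat n n"
    "a \<in> A \<Longrightarrow> b \<in> A \<Longrightarrow> \<phi> (a + b) = \<phi> a + \<phi> b"
    "a \<in> A \<Longrightarrow> \<phi> (scaleC_bop c a) = c \<cdot>\<^sub>m \<phi> a" "\<phi> 1 = 1\<^sub>m n"
    "\<forall>i<k. \<forall>j<k. x i j \<in> A \<Longrightarrow> block_positive_bop k x \<Longrightarrow> block_positive_mat n k (\<lambda>i j. \<phi> (x i j))"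
  using assms unfolding ucp_map_def by blast+

lemma ucp_map_block_form:
  assumes "ucp_map n A \<phi>" "\<And>i j. i < k \<Longrightarrow> j < k \<Longrightarrow> x i j \<in> A" "block_positive_bop k x"
  shows "(\<Sum>i<k. \<Sum>j<k. frm {..<n} (kern (\<phi> (x i j))) (\<eta> j) (\<eta> i)) \<in> \<real>\<^sub>\<ge>\<^sub>0"
  using ucp_mapD(5)[OF assms(1), of k x] assms(2,3) block_positive_mat_iff[of k "\<lambda>i j. \<phi> (x i j)" n]
    ucp_mapD(1)[OF assms(1)] by auto

lemma ucp_map_subset: "ucp_map n UNIV \<phi> \<Longrightarrow> ucp_map n A \<phi>"
  unfolding ucp_map_def by blast

lemma two_sum: "(\<Sum>i<(2::nat). \<Sum>j<(2::nat). f i j) = f 0 0 + f 0 (Suc 0) + (f (Suc 0) 0 + f (Suc 0) (Suc 0))"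
  by (simp add: numeral_2_eq_2)

text \<open>The block with \<open>norm a\<close> on the diagonal and \<open>a\<close>,
  \<open>adj a\<close> off it is positive. Its image has a real form, and real forms for the
  multipliers 1 and \<open>\<i>\<close> force the two off-diagonal images to be adjoint to each
  other.\<close>

lemma ucp_map_adj:
  assumes \<phi>: "ucp_map n A \<phi>" and A: "cstar_subalgebra A" and a: "a \<in> A" and ij: "i < n" "j < n"
  shows "\<phi> (adj a) $$ (i, j) = cnj (\<phi> a $$ (j, i))"
proof -
  note mem = closed_subalgebra_mem[OF A]
  define c where "c = scaleC_bop (of_real (norm a)) 1"
  have c: "c \<in> A" unfolding c_def by (intro mem)
  define x where "x p q = (if p = q then c else if p = 0 then adj a else a)" for p q :: nat
  have x: "x p q \<in> A" for p q using a c mem(5) by (simp add: x_def)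
  have "block_positive_bop 2 x"
    unfolding block_positive_bop_def
  proof
    fix \<xi> :: "nat \<Rightarrow> ell2"
    define t where "t = cinner (bop_apply a (\<xi> 0)) (\<xi> (Suc 0))"
    have "cinner (bop_apply (adj a) (\<xi> (Suc 0))) (\<xi> 0) = cnj t"
      unfolding t_def cinner_adj2 by (rule cinner_commute)
    then have eq: "(\<Sum>i<2. \<Sum>j<2. cinner (bop_apply (x i j) (\<xi> j)) (\<xi> i))
        = of_real (norm a * ((norm (\<xi> 0))\<^sup>2 + (norm (\<xi> (Suc 0)))\<^sup>2) + 2 * Re t)"
      unfolding two_sum by (simp add: x_def c_def cinner_scaleC_left cinner_self t_def[symmetric] complex_eq_iff algebra_simps)
    have "0 \<le> (norm (\<xi> 0) - norm (\<xi> (Suc 0)))\<^sup>2" by simp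
    then have "2 * (norm (\<xi> 0) * norm (\<xi> (Suc 0))) \<le> (norm (\<xi> 0))\<^sup>2 + (norm (\<xi> (Suc 0)))\<^sup>2" by (simp add: power2_diff)
    then have "norm a * (2 * (norm (\<xi> 0) * norm (\<xi> (Suc 0)))) \<le> norm a * ((norm (\<xi> 0))\<^sup>2 + (norm (\<xi> (Suc 0)))\<^sup>2)"
      by (intro mult_left_mono) simp_all
    moreover have "- Re t \<le> norm a * (norm (\<xi> 0) * norm (\<xi> (Suc 0)))"
      using cinner_apply_le[of a "\<xi> 0" "\<xi> (Suc 0)"] abs_Re_le_cmod[of t] unfolding t_def by linarith
    ultimately have "0 \<le> norm a * ((norm (\<xi> 0))\<^sup>2 + (norm (\<xi> (Suc 0)))\<^sup>2) + 2 * Re t" by linarith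
    then show "(\<Sum>i<2. \<Sum>j<2. cinner (bop_apply (x i j) (\<xi> j)) (\<xi> i)) \<in> \<real>\<^sub>\<ge>\<^sub>0"
      unfolding eq by (simp only: nonneg_Reals_of_real_iff)
  qed
  from ucp_map_block_form[OF \<phi> x this]
  have pos: "(\<Sum>p<2. \<Sum>q<2. frm {..<n} (kern (\<phi> (x p q))) (\<eta> q) (\<eta> p)) \<in> \<real>\<^sub>\<ge>\<^sub>0" for \<eta> .
  have \<phi>c: "\<phi> c = of_real (norm a) \<cdot>\<^sub>m 1\<^sub>m n" unfolding c_def using ucp_mapD(3,4)[OF \<phi>] mem(1) by simp
  have "frm {..<n} (kern (\<phi> c)) u u = of_real (norm a) * frm {..<n} unitk u u" for u
    unfolding frm_kernel_scale[symmetric] by (rule frm_cong) (simp_all add: \<phi>c)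
  then have imc: "Im (frm {..<n} (kern (\<phi> c)) u u) = 0" for u
    using psdD(2)[OF psd_unitk[of "{..<n}"], of u] by simp
  define X where "X = \<phi> (adj a) $$ (i, j)"
  define Y where "Y = \<phi> a $$ (j, i)"
  let ?e = "\<lambda>s k. if k = s then 1 else (0 :: complex)"
  have "Im (cnj t * X + t * Y) = 0" for t
  proof -
    have "Im (frm {..<n} (kern (\<phi> (adj a))) (?e j) (\<lambda>k. t * ?e i k) + frm {..<n} (kern (\<phi> a)) (\<lambda>k. t * ?e i k) (?e j)) = 0"
      using pos[of "\<lambda>p. if p = 0 then (\<lambda>k. t * ?e i k) else ?e j"] imc
      unfolding two_sum complex_nonneg_Reals_iff by (simp add: x_def)
    moreover have "frm {..<n} (kern (\<phi> (adj a))) (?e j) (\<lambda>k. t * ?e i k) = cnj t * X"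
      using ij by (simp add: frm_scale_right frm_unit X_def del: mult_cancel_left1)
    moreover have "frm {..<n} (kern (\<phi> a)) (\<lambda>k. t * ?e i k) (?e j) = t * Y"
      using ij by (simp add: frm_scale_left frm_unit Y_def)
    ultimately show ?thesis by simp
  qed
  from this[of 1] this[of \<i>] show ?thesis
    unfolding X_def[symmetric] Y_def[symmetric] by (intro complex_eqI) simp_all
qed

lemma cstar_hull: "cstar_subalgebra (cstar x)" "x \<in> cstar x" "1 \<in> cstar x"
proof -
  show 1: "cstar_subalgebra (cstar x)"
    unfolding cstar_def
  proof (rule hull_in)
    fix T assume T: "\<forall>A\<in>T. cstar_subalgebra A"
    show "cstar_subalgebra (\<Inter> T)"
      unfolding cstar_subalgebra_def using closed_subalgebra_mem[of _] T by (auto intro!: closed_Inter)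
  qed
  have "x \<in> opsys x"
    unfolding opsys_def
    by (rule CollectI, rule exI[of _ 0], rule exI[of _ 1], rule exI[of _ 0]) (auto intro!: bop_eqI ell2_eqI)
  then show "x \<in> cstar x" unfolding cstar_def by (rule hull_inc)
  show "1 \<in> cstar x" using closed_subalgebra_mem(1)[OF 1] .
qed

text \<open>A test says that \<open>z = p y + cnj q (adj y)\<close> is a contraction, hence that the
  block with 1 on the diagonal and \<open>z\<close>, \<open>adj z\<close> off it is positive.
  Complete positivity carries this block over to matrices, where it reads as the test for
  \<open>a\<close>.\<close>

lemma matrix_range_passes:
  assumes y: "passes_bop T 1 0 y" and a: "a \<in> matrix_range_level n y"
  shows "passes_mat T n (kern a)" "a \<in> carrier_mat n n"
proof -
  obtain \<phi> where \<phi>: "ucp_map n (cstar y) \<phi>" "a = \<phi> y" using a unfolding matrix_range_level_def by auto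
  note A = cstar_hull(1)[of y] and yA = cstar_hull(2)[of y]
  note mem = closed_subalgebra_mem[OF A]
  show carr: "a \<in> carrier_mat n n" using ucp_mapD(1)[OF \<phi>(1) yA] \<phi>(2) by simp
  show "passes_mat T n (kern a)"
    unfolding passes_mat_def
  proof clarify
    fix p q u v assume pq: "(p, q) \<in> T"
    define z where "z = scaleC_bop p y + scaleC_bop (cnj q) (adj y)"
    have z: "z \<in> cstar y" unfolding z_def by (intro mem yA)
    define x where "x i j = (if i = j then 1 else if i = 0 then adj z else z)" for i j :: nat
    have x: "x i j \<in> cstar y" for i j using z mem(1,5) by (simp add: x_def)
    have "block_positive_bop 2 x"
      unfolding block_positive_bop_def
    proof
      fix \<xi> :: "nat \<Rightarrow> ell2"
      define t where "t = cinner (bop_apply z (\<xi> 0)) (\<xi> (Suc 0))"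
      have "cinner (bop_apply (adj z) (\<xi> (Suc 0))) (\<xi> 0) = cnj t"
        unfolding t_def cinner_adj2 by (rule cinner_commute)
      then have eq: "(\<Sum>i<2. \<Sum>j<2. cinner (bop_apply (x i j) (\<xi> j)) (\<xi> i))
          = of_real (1 * ((norm (\<xi> 0))\<^sup>2 + (norm (\<xi> (Suc 0)))\<^sup>2) + 2 * Re t)"
        unfolding two_sum by (simp add: x_def cinner_self t_def[symmetric] complex_eq_iff algebra_simps)
      have "cinner (bop_apply (adj y) (\<xi> 0)) (\<xi> (Suc 0)) = cnj (cinner (bop_apply y (\<xi> (Suc 0))) (\<xi> 0))"
        unfolding cinner_adj2 by (rule cinner_commute)
      then have "Re t = Re (p * cinner (bop_apply y (\<xi> 0)) (\<xi> (Suc 0)) + q * cinner (bop_apply y (\<xi> (Suc 0))) (\<xi> 0))"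
        by (simp add: t_def z_def cinner_simps)
      then have "0 \<le> 1 * ((norm (\<xi> 0))\<^sup>2 + (norm (\<xi> (Suc 0)))\<^sup>2) + 2 * Re t"
        using passes_bopD[OF y pq, of "\<xi> 0" "\<xi> (Suc 0)"] by simp
      then show "(\<Sum>i<2. \<Sum>j<2. cinner (bop_apply (x i j) (\<xi> j)) (\<xi> i)) \<in> \<real>\<^sub>\<ge>\<^sub>0"
        unfolding eq by (simp only: nonneg_Reals_of_real_iff)
    qed
    from ucp_map_block_form[OF \<phi>(1) x this]
    have pos: "(\<Sum>i<2. \<Sum>j<2. frm {..<n} (kern (\<phi> (x i j))) (\<eta> j) (\<eta> i)) \<in> \<real>\<^sub>\<ge>\<^sub>0" for \<eta> .
    have one: "frm {..<n} (kern (\<phi> 1)) w w = frm {..<n} unitk w w" for w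
      by (rule frm_cong) (simp_all add: ucp_mapD(4)[OF \<phi>(1)])
    have \<phi>z: "frm {..<n} (kern (\<phi> z)) w w' = p * frm {..<n} (kern a) w w' + cnj q * cnj (frm {..<n} (kern a) w' w)" for w w'
    proof -
      have "frm {..<n} (kern (\<phi> z)) w w' = frm {..<n} (\<lambda>i j. p * kern a i j + cnj q * cnj (kern a j i)) w w'"
      proof (rule frm_cong)
        fix i j assume "i \<in> {..<n}" "j \<in> {..<n}"
        then show "kern (\<phi> z) i j = p * kern a i j + cnj q * cnj (kern a j i)"
          using carr ucp_mapD(1)[OF \<phi>(1) mem(5)[OF yA]] ucp_map_adj[OF \<phi>(1) A yA, of i j] \<phi>(2)
          by (simp add: z_def ucp_mapD(2,3)[OF \<phi>(1)] mem yA)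
      qed simp_all
      then show ?thesis unfolding frm_kernel_add frm_kernel_scale frm_kernel_adj .
    qed
    have \<phi>z': "frm {..<n} (kern (\<phi> (adj z))) w' w = cnj (frm {..<n} (kern (\<phi> z)) w w')" for w w'
      unfolding frm_kernel_adj[symmetric]
      by (rule frm_cong) (use ucp_map_adj[OF \<phi>(1) A z] in auto)
    have "0 \<le> Re (\<Sum>i<2. \<Sum>j<2. frm {..<n} (kern (\<phi> (x i j))) ((\<lambda>i. if i = 0 then u else v) j) ((\<lambda>i. if i = 0 then u else v) i))"
      using pos[of "\<lambda>i. if i = 0 then u else v"] unfolding complex_nonneg_Reals_iff by simp
    also have "\<dots> = Re (frm {..<n} unitk u u) + Re (frm {..<n} unitk v v) + 2 * Re (frm {..<n} (kern (\<phi> z)) u v)"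
      unfolding two_sum by (simp add: x_def one \<phi>z')
    also have "Re (frm {..<n} (kern (\<phi> z)) u v) = Re (p * frm {..<n} (kern a) u v + q * frm {..<n} (kern a) v u)"
      by (simp add: \<phi>z)
    finally show "0 \<le> Re (frm {..<n} unitk u u) + Re (frm {..<n} unitk v v) + 2 * Re (p * frm {..<n} (kern a) u v + q * frm {..<n} (kern a) v u)" .
  qed
qed

section \<open>The essential matrix range\<close>

text \<open>Compressions to orthonormal frames that move out along the tails. A cluster point over
  all operators at once is completely positive on the whole algebra, not just on
  \<open>cstar x\<close>, and it kills a compact \<open>k\<close> because \<open>k * tail m\<close>
  tends to 0.\<close>

lemma ucp_cluster_point:
  fixes \<xi> :: "nat \<Rightarrow> nat \<Rightarrow> ell2"
  assumes tl: "\<And>m i. i < n \<Longrightarrow> bop_apply (tail m) (\<xi> m i) = \<xi> m i"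
    and orth: "\<And>m i j. i < n \<Longrightarrow> j < n \<Longrightarrow> cinner (\<xi> m i) (\<xi> m j) = unitk i j"
  shows "\<exists>F \<Phi>. F \<noteq> bot \<and> F \<le> sequentially \<and> ucp_map n UNIV \<Phi> \<and> (\<forall>k. compact_op k \<longrightarrow> \<Phi> k = 0\<^sub>m n n) \<and>
    (\<forall>a i j. i < n \<longrightarrow> j < n \<longrightarrow> ((\<lambda>m. cinner (bop_apply a (\<xi> m j)) (\<xi> m i)) \<longlongrightarrow> \<Phi> a $$ (i, j)) F)"
proof -
  have norm1: "norm (\<xi> m i) = 1" if "i < n" for m i
  proof -
    have "complex_of_real ((norm (\<xi> m i))\<^sup>2) = 1" unfolding cinner_self[symmetric] using orth that by simp
    then have "(norm (\<xi> m i))\<^sup>2 = 1" by (simp only: of_real_eq_1_iff)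
    then show ?thesis using norm_ge_zero[of "\<xi> m i"] by (auto simp: power2_eq_1_iff)
  qed
  define f where "f m t = (case t of (a, i, j) \<Rightarrow> if i < n \<and> j < n then cinner (bop_apply a (\<xi> m j)) (\<xi> m i) else 0)" for m t
  have bd: "cmod (f m t) \<le> norm (fst t)" for m t
  proof -
    obtain a i j where t: "t = (a, i, j)" by (cases t)
    show ?thesis
    proof (cases "i < n \<and> j < n")
      case True
      then show ?thesis using cinner_apply_le[of a "\<xi> m j" "\<xi> m i"] norm1[of i m] norm1[of j m] by (simp add: f_def t)
    next
      case False
      then show ?thesis by (auto simp: f_def t)
    qed
  qed
  obtain F L where F: "F \<noteq> bot" "F \<le> sequentially" "\<And>t. ((\<lambda>m. f m t) \<longlongrightarrow> L t) F"
    by (rule bounded_family_cluster[OF bd]) (rule that)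
  define \<Phi> where "\<Phi> a = Matrix.mat n n (\<lambda>(i, j). L (a, i, j))" for a
  have lim: "((\<lambda>m. cinner (bop_apply a (\<xi> m j)) (\<xi> m i)) \<longlongrightarrow> \<Phi> a $$ (i, j)) F" if "i < n" "j < n" for a i j
    using F(3)[of "(a, i, j)"] that by (simp add: f_def \<Phi>_def)
  have carr: "\<Phi> a \<in> carrier_mat n n" for a by (simp add: \<Phi>_def)
  have eqI: "\<Phi> a = A" if "A \<in> carrier_mat n n"
    "\<And>i j. i < n \<Longrightarrow> j < n \<Longrightarrow> ((\<lambda>m. cinner (bop_apply a (\<xi> m j)) (\<xi> m i)) \<longlongrightarrow> A $$ (i, j)) F" for a A
  proof (rule eq_matI)
    fix i j assume "i < dim_row A" "j < dim_col A"
    then have ij: "i < n" "j < n" using that(1) by auto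
    show "\<Phi> a $$ (i, j) = A $$ (i, j)"
      by (rule tendsto_unique[OF F(1) lim[OF ij] that(2)[OF ij]])
  qed (use that(1) carr[of a] in auto)
  have "ucp_map n UNIV \<Phi>"
    unfolding ucp_map_def
  proof (intro conjI ballI allI impI)
    fix a b c
    show "\<Phi> a \<in> carrier_mat n n" by (rule carr)
    show "\<Phi> (a + b) = \<Phi> a + \<Phi> b"
    proof (rule eqI)
      fix i j assume ij: "i < n" "j < n"
      show "((\<lambda>m. cinner (bop_apply (a + b) (\<xi> m j)) (\<xi> m i)) \<longlongrightarrow> (\<Phi> a + \<Phi> b) $$ (i, j)) F"
        using tendsto_add[OF lim[OF ij, of a] lim[OF ij, of b]] ij carr[of a] carr[of b] by (simp add: cinner_add_left)
    qed (use carr[of a] carr[of b] in simp)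
    show "\<Phi> (scaleC_bop c a) = c \<cdot>\<^sub>m \<Phi> a"
    proof (rule eqI)
      fix i j assume ij: "i < n" "j < n"
      show "((\<lambda>m. cinner (bop_apply (scaleC_bop c a) (\<xi> m j)) (\<xi> m i)) \<longlongrightarrow> (c \<cdot>\<^sub>m \<Phi> a) $$ (i, j)) F"
        using tendsto_mult[OF tendsto_const[of c] lim[OF ij, of a]] ij carr[of a] by (simp add: cinner_scaleC_left)
    qed (use carr[of a] in simp)
    show "\<Phi> 1 = 1\<^sub>m n"
    proof (rule eqI)
      fix i j assume ij: "i < n" "j < n"
      have "cinner (bop_apply 1 (\<xi> m j)) (\<xi> m i) = 1\<^sub>m n $$ (i, j)" for m
        using ij orth[of j i m] by auto
      then show "((\<lambda>m. cinner (bop_apply 1 (\<xi> m j)) (\<xi> m i)) \<longlongrightarrow> 1\<^sub>m n $$ (i, j)) F"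
        by (simp only: tendsto_const)
    qed simp
  next
    fix k x assume x: "(\<forall>i<k. \<forall>j<k. x i j \<in> (UNIV :: bop set)) \<and> block_positive_bop k x"
    show "block_positive_mat n k (\<lambda>i j. \<Phi> (x i j))"
    proof (subst block_positive_mat_iff)
      show "\<forall>\<eta>. (\<Sum>p<k. \<Sum>q<k. frm {..<n} (kern (\<Phi> (x p q))) (\<eta> q) (\<eta> p)) \<in> \<real>\<^sub>\<ge>\<^sub>0"
      proof
        fix \<eta> :: "nat \<Rightarrow> nat \<Rightarrow> complex"
        define V where "V m p = (\<Sum>i<n. scaleC_ell2 (\<eta> p i) (\<xi> m i))" for m p
        have "((\<lambda>m. \<Sum>p<k. \<Sum>q<k. cinner (bop_apply (x p q) (V m q)) (V m p))
          \<longlongrightarrow> (\<Sum>p<k. \<Sum>q<k. frm {..<n} (kern (\<Phi> (x p q))) (\<eta> q) (\<eta> p))) F"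
          unfolding V_def cinner_frame by (intro tendsto_sum frm_tendsto lim) auto
        moreover have "(\<Sum>p<k. \<Sum>q<k. cinner (bop_apply (x p q) (V m q)) (V m p)) \<in> \<real>\<^sub>\<ge>\<^sub>0" for m
          using x unfolding block_positive_bop_def by blast
        ultimately show "(\<Sum>p<k. \<Sum>q<k. frm {..<n} (kern (\<Phi> (x p q))) (\<eta> q) (\<eta> p)) \<in> \<real>\<^sub>\<ge>\<^sub>0"
          by (intro Lim_in_closed_set[OF closed_nonneg_Reals_complex _ F(1)]) auto
      qed
    qed (rule carr)
  qed
  moreover have "\<Phi> k = 0\<^sub>m n n" if k: "compact_op k" for k
  proof (rule eqI)
    fix i j assume ij: "i < n" "j < n"
    have "(\<lambda>m. cinner (bop_apply k (\<xi> m j)) (\<xi> m i)) \<longlonglongrightarrow> 0"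
    proof (rule Lim_null_comparison)
      have "norm (cinner (bop_apply k (\<xi> m j)) (\<xi> m i)) \<le> norm (k * tail m)" for m
        using cinner_apply_le[of "k * tail m" "\<xi> m j" "\<xi> m i"] tl[OF ij(2)] norm1 ij by simp
      then show "\<forall>\<^sub>F m in sequentially. norm (cinner (bop_apply k (\<xi> m j)) (\<xi> m i)) \<le> norm (k * tail m)" by simp
    qed (rule compact_op_tail[OF k])
    then show "((\<lambda>m. cinner (bop_apply k (\<xi> m j)) (\<xi> m i)) \<longlongrightarrow> 0\<^sub>m n n $$ (i, j)) F"
      using ij F(2) by (auto intro: tendsto_mono)
  qed simp
  ultimately show ?thesis using F(1,2) lim by (intro exI[of _ F] exI[of _ \<Phi>]) auto
qed

text \<open>If \<open>w\<close> is a multiple of \<open>e0\<close>, a second direction must come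
  from elsewhere: \<open>ebasis N\<close> and \<open>ebasis (Suc N)\<close> are orthogonal, so they
  cannot both be multiples of \<open>e0\<close>. A full 2-frame is wanted even then, since the
  compressions are to have size 2.\<close>

lemma orthonormal_completion:
  assumes w: "bop_apply (tail N) w = w" and e0: "bop_apply (tail N) e0 = e0" "norm e0 = 1"
  shows "\<exists>e1 c. bop_apply (tail N) e1 = e1 \<and> norm e1 = 1 \<and> cinner e1 e0 = 0 \<and>
    w = scaleC_ell2 (cinner w e0) e0 + scaleC_ell2 c e1"
proof -
  define res where "res v = v - scaleC_ell2 (cinner v e0) e0" for v
  have r0: "cinner (res v) e0 = 0" for v
    using e0(2) by (simp add: res_def cinner_simps cinner_self)
  have rt: "bop_apply (tail N) (res v) = res v" if "bop_apply (tail N) v = v" for v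
    using that e0(1) by (simp add: res_def bop_linear bop_scaleC)
  have unit: "\<exists>e1. bop_apply (tail N) e1 = e1 \<and> norm e1 = 1 \<and> cinner e1 e0 = 0 \<and> v = scaleC_ell2 (cinner v e0) e0 + scaleC_ell2 (of_real (norm (res v))) e1"
    if v: "bop_apply (tail N) v = v" "res v \<noteq> 0" for v
  proof (intro exI[of _ "inverse (norm (res v)) *\<^sub>R res v"] conjI)
    have "scaleC_ell2 (of_real (norm (res v))) (inverse (norm (res v)) *\<^sub>R res v) = res v"
      using v(2) by (simp add: scaleC_ell2_of_real)
    then show "v = scaleC_ell2 (cinner v e0) e0 + scaleC_ell2 (of_real (norm (res v))) (inverse (norm (res v)) *\<^sub>R res v)"
      by (simp add: res_def)
  qed (use v rt r0 in \<open>simp_all add: bop_linear cinner_scaleR_left\<close>)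
  show ?thesis
  proof (cases "res w = 0")
    case False
    from unit[OF w this] show ?thesis by (elim exE conjE) (intro exI conjI)
  next
    case True
    have eb: "bop_apply (tail N) (ebasis i) = ebasis i" if "N \<le> i" for i
      by (rule ell2_eqI) (use that in auto)
    have "res (ebasis N) \<noteq> 0 \<or> res (ebasis (Suc N)) \<noteq> 0"
    proof (rule ccontr)
      assume "\<not> ?thesis"
      then have "res (ebasis N) = 0" "res (ebasis (Suc N)) = 0" by simp_all
      then have 0: "ebasis N = scaleC_ell2 (cinner (ebasis N) e0) e0"
        "ebasis (Suc N) = scaleC_ell2 (cinner (ebasis (Suc N)) e0) e0"
        unfolding res_def right_minus_eq .
      obtain a where a: "ebasis N = scaleC_ell2 a e0" by (rule that[OF 0(1)])
      obtain b where b: "ebasis (Suc N) = scaleC_ell2 b e0" by (rule that[OF 0(2)])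
      note ab = a b
      have "a * cnj b = cinner (ebasis N) (ebasis (Suc N))"
        unfolding ab using e0(2) by (simp add: cinner_simps cinner_self)
      then have "a * cnj b = 0" by (simp add: cinner_ebasis_right)
      moreover have "cmod a = 1" "cmod b = 1"
        using norm_ebasis[of N] norm_ebasis[of "Suc N"] e0(2) unfolding ab by (simp_all add: norm_scaleC_ell2)
      ultimately show False by auto
    qed
    then have "\<exists>e1. bop_apply (tail N) e1 = e1 \<and> norm e1 = 1 \<and> cinner e1 e0 = 0"
    proof
      assume "res (ebasis N) \<noteq> 0"
      from unit[OF eb[OF order_refl] this] show ?thesis by (elim exE conjE) (intro exI conjI)
    next
      assume "res (ebasis (Suc N)) \<noteq> 0"
      from unit[OF eb[OF le_SucI[OF order_refl]] this] show ?thesis by (elim exE conjE) (intro exI conjI)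
    qed
    then obtain e1 where "bop_apply (tail N) e1 = e1" "norm e1 = 1" "cinner e1 e0 = 0"
      by (elim exE conjE)
    moreover have "w = scaleC_ell2 (cinner w e0) e0 + scaleC_ell2 0 e1"
    proof -
      have "scaleC_ell2 0 e1 = 0" by (rule ell2_eqI) simp
      then show ?thesis using True by (simp add: res_def)
    qed
    ultimately show ?thesis by (intro exI[of _ e1] exI[of _ 0] conjI)
  qed
qed

lemma orthonormal_pair:
  assumes u: "bop_apply (tail N) u = u" and v: "bop_apply (tail N) v = v"
  shows "\<exists>e \<alpha> \<beta>. (\<forall>i<2. bop_apply (tail N) (e i) = e i) \<and> (\<forall>i<2. \<forall>j<2. cinner (e i) (e j) = unitk i j) \<and>
    u = (\<Sum>i<2. scaleC_ell2 (\<alpha> i) (e i)) \<and> v = (\<Sum>i<(2::nat). scaleC_ell2 (\<beta> i) (e i))"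
proof -
  have "\<exists>e0 c. bop_apply (tail N) e0 = e0 \<and> norm e0 = 1 \<and> u = scaleC_ell2 c e0"
  proof (cases "u = 0")
    case True
    have "bop_apply (tail N) (ebasis N) = ebasis N" by (rule ell2_eqI) auto
    moreover have "u = scaleC_ell2 0 (ebasis N)" using True by (intro ell2_eqI) simp
    ultimately show ?thesis using norm_ebasis[of N] by (intro exI[of _ "ebasis N"] exI[of _ 0] conjI)
  next
    case False
    then show ?thesis using u
      by (intro exI[of _ "inverse (norm u) *\<^sub>R u"] exI[of _ "of_real (norm u)"])
        (simp add: bop_linear scaleC_ell2_of_real)
  qed
  then obtain e0 c where e0: "bop_apply (tail N) e0 = e0" "norm e0 = 1" "u = scaleC_ell2 c e0" by (elim exE conjE)
  from orthonormal_completion[OF v e0(1,2)] obtain e1 d where e1: "bop_apply (tail N) e1 = e1" "norm e1 = 1"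
    "cinner e1 e0 = 0" "v = scaleC_ell2 (cinner v e0) e0 + scaleC_ell2 d e1" by (elim exE conjE)
  define e where "e i = (if i = 0 then e0 else e1)" for i :: nat
  have sum2: "(\<Sum>i<2. g i) = g 0 + g (Suc 0)" for g :: "nat \<Rightarrow> ell2" by (simp add: numeral_2_eq_2)
  have z: "scaleC_ell2 0 w = 0" for w by (rule ell2_eqI) simp
  have "cinner e0 e1 = 0" using cinner_commute[of e0 e1] e1(3) by simp
  then have "\<forall>i<2. \<forall>j<2. cinner (e i) (e j) = unitk i j"
    using e0(2) e1(2,3) by (auto simp: e_def less_2_cases_iff cinner_self)
  moreover have "\<forall>i<2. bop_apply (tail N) (e i) = e i" using e0(1) e1(1) by (simp add: e_def)
  moreover have "u = (\<Sum>i<2. scaleC_ell2 ((\<lambda>i. if i = 0 then c else 0) i) (e i))"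
    unfolding sum2 using e0(3) by (simp add: e_def z)
  moreover have "v = (\<Sum>i<2. scaleC_ell2 ((\<lambda>i. if i = 0 then cinner v e0 else d) i) (e i))"
    unfolding sum2 e_def by (simp del: One_nat_def) (rule e1(4))
  ultimately show ?thesis
    by (intro exI[of _ e] exI[of _ "\<lambda>i. if i = 0 then c else 0"] exI[of _ "\<lambda>i. if i = 0 then cinner v e0 else d"] conjI)
qed

text \<open>Two vectors span at most a plane, so the second level of the essential matrix range controls
  the tests on the tail.\<close>

lemma ess_range_tail_tests:
  assumes T: "\<And>p q. (p, q) \<in> T \<Longrightarrow> cmod p \<le> B \<and> cmod q \<le> B"
    and ess: "\<And>a. a \<in> ess_matrix_range_level 2 x \<Longrightarrow> passes_mat T 2 (kern a)"
    and e: "0 < e"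
  shows "\<exists>N. passes_bop T (1 + e) N x"
proof (rule ccontr)
  assume "\<nexists>N. passes_bop T (1 + e) N x"
  then have viol: "\<not> (\<forall>p q u v. (p, q) \<in> T \<longrightarrow> bop_apply (tail N) u = u \<longrightarrow> bop_apply (tail N) v = v \<longrightarrow>
    0 \<le> (1 + e) * ((norm u)\<^sup>2 + (norm v)\<^sup>2) + 2 * Re (p * cinner (bop_apply x u) v + q * cinner (bop_apply x v) u))" for N
    using passes_bopI[of T N "1 + e" x] by blast
  \<comment> \<open>Only the frame is chosen for every \<open>N\<close>, because the cluster point
    depends on nothing else; coefficients and test are recovered later for a single index.\<close>
  define bad where "bad N ex \<longleftrightarrow> (\<exists>\<alpha> \<beta> p q. (\<forall>i<2. bop_apply (tail N) (ex i) = ex i) \<and> (\<forall>i<2. \<forall>j<2. cinner (ex i) (ex j) = unitk i j) \<and>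
    (p, q) \<in> T \<and> (1 + e) * ((norm (\<Sum>i<2. scaleC_ell2 (\<alpha> i) (ex i)))\<^sup>2 + (norm (\<Sum>i<(2::nat). scaleC_ell2 (\<beta> i) (ex i)))\<^sup>2)
      + 2 * Re (p * cinner (bop_apply x (\<Sum>i<2. scaleC_ell2 (\<alpha> i) (ex i))) (\<Sum>i<2. scaleC_ell2 (\<beta> i) (ex i))
      + q * cinner (bop_apply x (\<Sum>i<2. scaleC_ell2 (\<beta> i) (ex i))) (\<Sum>i<2. scaleC_ell2 (\<alpha> i) (ex i))) < 0)"
    for N and ex :: "nat \<Rightarrow> ell2"
  have "\<exists>ex. bad N ex" for N
  proof -
    obtain p q u v where *: "(p, q) \<in> T" "bop_apply (tail N) u = u" "bop_apply (tail N) v = v"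
      "\<not> 0 \<le> (1 + e) * ((norm u)\<^sup>2 + (norm v)\<^sup>2) + 2 * Re (p * cinner (bop_apply x u) v + q * cinner (bop_apply x v) u)"
      using viol[of N] by (simp only: not_all not_imp) (elim exE conjE)
    from orthonormal_pair[OF *(2,3)] obtain ex \<alpha> \<beta> where ex: "\<forall>i<2. bop_apply (tail N) (ex i) = ex i"
      "\<forall>i<2. \<forall>j<2. cinner (ex i) (ex j) = unitk i j" "u = (\<Sum>i<2. scaleC_ell2 (\<alpha> i) (ex i))"
      "v = (\<Sum>i<(2::nat). scaleC_ell2 (\<beta> i) (ex i))" by (elim exE conjE)
    have "bad N ex" unfolding bad_def
      by (intro exI[of _ \<alpha>] exI[of _ \<beta>] exI[of _ p] exI[of _ q] conjI)
        (rule ex(1), rule ex(2), rule *(1), rule *(4)[unfolded not_le, unfolded ex(3,4)])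
    then show ?thesis by (intro exI[where x=ex])
  qed
  then have "\<forall>N. \<exists>ex. bad N ex" by (rule allI)
  from choice[OF this] obtain ex where ex: "\<forall>N. bad N (ex N)" by (elim exE)
  have badD: "(\<forall>i<2. bop_apply (tail N) (ex N i) = ex N i) \<and> (\<forall>i<2. \<forall>j<2. cinner (ex N i) (ex N j) = unitk i j)" for N
    using ex[rule_format, of N] unfolding bad_def by (elim exE conjE) (intro conjI, assumption+)
  have tl: "bop_apply (tail N) (ex N i) = ex N i" if "i < 2" for N i
    using badD[of N] that by blast
  have orth: "cinner (ex N i) (ex N j) = unitk i j" if "i < 2" "j < 2" for N i j
    using badD[of N] that by blast
  have "\<exists>F \<Phi>. F \<noteq> bot \<and> F \<le> sequentially \<and> ucp_map 2 UNIV \<Phi> \<and> (\<forall>k. compact_op k \<longrightarrow> \<Phi> k = 0\<^sub>m 2 2) \<and>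
    (\<forall>a i j. i < 2 \<longrightarrow> j < 2 \<longrightarrow> ((\<lambda>m. cinner (bop_apply a (ex m j)) (ex m i)) \<longlongrightarrow> \<Phi> a $$ (i, j)) F)"
    by (rule ucp_cluster_point) (simp_all only: tl orth)
  then obtain F \<Phi> where F: "F \<noteq> bot" "F \<le> sequentially" "ucp_map 2 UNIV \<Phi>" "\<forall>k. compact_op k \<longrightarrow> \<Phi> k = 0\<^sub>m 2 2"
    "\<forall>a i j. i < 2 \<longrightarrow> j < 2 \<longrightarrow> ((\<lambda>m. cinner (bop_apply a (ex m j)) (ex m i)) \<longlongrightarrow> \<Phi> a $$ (i, j)) F"
    by (elim exE conjE)
  have "\<Phi> x \<in> ess_matrix_range_level 2 x"
    unfolding ess_matrix_range_level_def using ucp_map_subset[OF F(3)] F(4) by blast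
  then have pass: "passes_mat T 2 (kern (\<Phi> x))" by (rule ess)
  define B' where "B' = \<bar>B\<bar> + 1"
  have T': "cmod p \<le> B'" "cmod q \<le> B'" if "(p, q) \<in> T" for p q using T[OF that] by (auto simp: B'_def)
  have B': "0 < B'" by (simp add: B'_def)
  \<comment> \<open>Entry errors below \<open>\<delta>\<close> change the test by at most
    \<open>e * (S \<alpha> + S \<beta>)\<close>, exactly the margin contained in
    \<open>1 + e\<close>.\<close>
  define \<delta> where "\<delta> = e / (4 * B')"
  have \<delta>: "0 < \<delta>" using e B' by (simp add: \<delta>_def)
  have "\<forall>\<^sub>F m in F. dist (cinner (bop_apply x (ex m j)) (ex m i)) (\<Phi> x $$ (i, j)) < \<delta>" if "i < 2" "j < 2" for i j
    using tendstoD[OF F(5)[rule_format, OF that] \<delta>] .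
  then have "\<forall>\<^sub>F m in F. \<forall>i\<in>{..<2}. \<forall>j\<in>{..<2}. dist (cinner (bop_apply x (ex m j)) (ex m i)) (\<Phi> x $$ (i, j)) < \<delta>"
    by (intro eventually_ball_finite ballI) auto
  then obtain m where m: "\<forall>i\<in>{..<2}. \<forall>j\<in>{..<2}. dist (cinner (bop_apply x (ex m j)) (ex m i)) (\<Phi> x $$ (i, j)) < \<delta>"
    using eventually_happens'[OF F(1)] by blast
  obtain \<alpha> \<beta> p q where pq: "(p, q) \<in> T" and neg: "(1 + e) * ((norm (\<Sum>i<2. scaleC_ell2 (\<alpha> i) (ex m i)))\<^sup>2 + (norm (\<Sum>i<(2::nat). scaleC_ell2 (\<beta> i) (ex m i)))\<^sup>2)
      + 2 * Re (p * cinner (bop_apply x (\<Sum>i<2. scaleC_ell2 (\<alpha> i) (ex m i))) (\<Sum>i<2. scaleC_ell2 (\<beta> i) (ex m i))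
      + q * cinner (bop_apply x (\<Sum>i<2. scaleC_ell2 (\<beta> i) (ex m i))) (\<Sum>i<2. scaleC_ell2 (\<alpha> i) (ex m i))) < 0"
    using ex[rule_format, of m] unfolding bad_def by (elim exE conjE)
  define A where "A = (\<lambda>i j. cinner (bop_apply x (ex m j)) (ex m i))"
  define D where "D = (\<lambda>i j. A i j - kern (\<Phi> x) i j)"
  define S where "S \<gamma> = (\<Sum>i<(2::nat). (cmod (\<gamma> i))\<^sup>2)" for \<gamma> :: "nat \<Rightarrow> complex"
  have nS: "(norm (\<Sum>i<2. scaleC_ell2 (\<gamma> i) (ex m i)))\<^sup>2 = S \<gamma>" for \<gamma>
  proof -
    have "complex_of_real ((norm (\<Sum>i<2. scaleC_ell2 (\<gamma> i) (ex m i)))\<^sup>2) = frm {..<2} (\<lambda>i j. cinner (ex m j) (ex m i)) \<gamma> \<gamma>"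
      unfolding cinner_self[symmetric] using cinner_frame[where y=1 and n=2 and x=\<gamma> and x'=\<gamma> and e="ex m"] by simp
    also have "\<dots> = frm {..<2} unitk \<gamma> \<gamma>" by (rule frm_cong) (auto simp: orth)
    also have "\<dots> = of_real (S \<gamma>)" by (simp add: frm_unitk_self S_def)
    finally show ?thesis by (simp only: of_real_eq_iff)
  qed
  have uS: "Re (frm {..<2} unitk \<gamma> \<gamma>) = S \<gamma>" for \<gamma> by (simp add: frm_unitk_self S_def)
  have AD: "frm {..<2} A \<gamma> \<gamma>' = frm {..<2} (kern (\<Phi> x)) \<gamma> \<gamma>' + frm {..<2} D \<gamma> \<gamma>'" for \<gamma> \<gamma>'
    unfolding frm_kernel_add[symmetric] by (rule frm_cong) (auto simp: D_def)
  have Db: "cmod (frm {..<2} D \<gamma> \<gamma>') \<le> \<delta> * (S \<gamma> + S \<gamma>')" for \<gamma> \<gamma>'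
  proof -
    have "cmod (frm {..<2} D \<gamma> \<gamma>') \<le> (\<Sum>i<2. \<Sum>j<2. cmod (D i j * \<gamma> j * cnj (\<gamma>' i)))"
      unfolding frm_def by (intro order_trans[OF norm_sum] sum_mono norm_sum)
    also have "\<dots> \<le> (\<Sum>i<2. \<Sum>j<2. \<delta> * (((cmod (\<gamma> j))\<^sup>2 + (cmod (\<gamma>' i))\<^sup>2) / 2))"
    proof (intro sum_mono)
      fix i j :: nat assume "i \<in> {..<2}" "j \<in> {..<2}"
      then have "cmod (D i j) \<le> \<delta>" using m by (auto simp: D_def A_def dist_norm less_imp_le)
      moreover have "cmod (\<gamma> j) * cmod (\<gamma>' i) \<le> ((cmod (\<gamma> j))\<^sup>2 + (cmod (\<gamma>' i))\<^sup>2) / 2"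
        using zero_le_power2[of "cmod (\<gamma> j) - cmod (\<gamma>' i)"] by (simp add: power2_diff)
      ultimately have "cmod (D i j) * (cmod (\<gamma> j) * cmod (\<gamma>' i)) \<le> \<delta> * (((cmod (\<gamma> j))\<^sup>2 + (cmod (\<gamma>' i))\<^sup>2) / 2)"
        using \<delta> by (intro mult_mono) auto
      then show "cmod (D i j * \<gamma> j * cnj (\<gamma>' i)) \<le> \<delta> * (((cmod (\<gamma> j))\<^sup>2 + (cmod (\<gamma>' i))\<^sup>2) / 2)"
        by (simp add: norm_mult mult.assoc)
    qed
    also have "\<dots> = \<delta> * (S \<gamma> + S \<gamma>')" unfolding two_sum by (simp add: S_def numeral_2_eq_2 field_simps)
    finally show ?thesis .
  qed
  have "cmod (p * frm {..<2} D \<alpha> \<beta> + q * frm {..<2} D \<beta> \<alpha>) \<le> B' * (\<delta> * (S \<alpha> + S \<beta>)) + B' * (\<delta> * (S \<beta> + S \<alpha>))"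
    using B' by (intro order_trans[OF norm_triangle_ineq] add_mono order_trans[OF eq_refl[OF norm_mult]] mult_mono T'[OF pq] Db) auto
  also have "\<dots> = e / 2 * (S \<alpha> + S \<beta>)" using B' by (simp add: \<delta>_def field_simps)
  finally have err: "- Re (p * frm {..<2} D \<alpha> \<beta> + q * frm {..<2} D \<beta> \<alpha>) \<le> e / 2 * (S \<alpha> + S \<beta>)"
    using abs_Re_le_cmod[of "p * frm {..<2} D \<alpha> \<beta> + q * frm {..<2} D \<beta> \<alpha>"] by linarith
  have "0 \<le> S \<alpha> + S \<beta> + 2 * Re (p * frm {..<2} (kern (\<Phi> x)) \<alpha> \<beta> + q * frm {..<2} (kern (\<Phi> x)) \<beta> \<alpha>)"
    using pass pq unfolding passes_mat_def uS[symmetric] by blast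
  moreover have "Re (p * frm {..<2} A \<alpha> \<beta> + q * frm {..<2} A \<beta> \<alpha>) = Re (p * frm {..<2} (kern (\<Phi> x)) \<alpha> \<beta> + q * frm {..<2} (kern (\<Phi> x)) \<beta> \<alpha>)
      + Re (p * frm {..<2} D \<alpha> \<beta> + q * frm {..<2} D \<beta> \<alpha>)"
    unfolding AD by (simp add: algebra_simps)
  moreover have "(1 + e) * (S \<alpha> + S \<beta>) + 2 * Re (p * frm {..<2} A \<alpha> \<beta> + q * frm {..<2} A \<beta> \<alpha>) < 0"
    using neg unfolding nS cinner_frame A_def .
  moreover have "(1 + e) * (S \<alpha> + S \<beta>) = S \<alpha> + S \<beta> + 2 * (e / 2 * (S \<alpha> + S \<beta>))" by (simp add: algebra_simps)
  ultimately show False using err by linarith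
qed

text \<open>Here only compact operators inside the algebra generated by \<open>x\<close> are known to be killed, so
  the compact positive part has to be constructed within that algebra.\<close>

lemma ess_numerical_range_bound:
  assumes \<phi>: "ucp_map 1 (cstar x) \<phi>" and kill: "\<And>k. k \<in> cstar x \<Longrightarrow> compact_op k \<Longrightarrow> \<phi> k = 0\<^sub>m 1 1"
    and tl: "\<And>u. bop_apply (tail N) u = u \<Longrightarrow> Re (c * cinner (bop_apply x u) u) \<le> \<beta> * (norm u)\<^sup>2"
  shows "Re (c * \<phi> x $$ (0, 0)) \<le> \<beta>"
proof -
  note A = cstar_hull(1)[of x] and xA = cstar_hull(2)[of x]
  note mem = closed_subalgebra_mem[OF A]
  \<comment> \<open>The real part of \<open>c x\<close> minus \<open>\<beta>\<close>, nonpositive on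
    the tail by hypothesis; it is normalised below because the absolute value was built for
    contractions.\<close>
  define b0 where "b0 = (1/2) *\<^sub>R (scaleC_bop c x + scaleC_bop (cnj c) (adj x)) - \<beta> *\<^sub>R 1"
  define M where "M = norm b0 + 1"
  have M: "0 < M" by (simp add: M_def add_nonneg_pos)
  define b where "b = (1 / M) *\<^sub>R b0"
  have bA: "b \<in> cstar x" unfolding b_def b0_def by (intro mem xA)
  have sa: "adj b = b"
    by (simp add: b_def b0_def adj_scaleR adj_diff adj_add adj_scaleC add.commute)
  have nb: "norm b \<le> 1" using M by (simp add: b_def M_def)
  have bform: "Re (cinner (bop_apply b u) u) = (1 / M) * (Re (c * cinner (bop_apply x u) u) - \<beta> * (norm u)\<^sup>2)" for u
  proof -
    have "cinner (bop_apply (adj x) u) u = cnj (cinner (bop_apply x u) u)"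
      unfolding cinner_adj2 by (rule cinner_commute)
    then show ?thesis by (simp add: b_def b0_def cinner_simps cinner_self)
  qed
  obtain s where s: "s * s = b * b" "s * b = b * s" "adj s = s" "\<And>u. 0 \<le> Re (cinner (bop_apply s u) u)"
    and sA': "\<And>A. cstar_subalgebra A \<Longrightarrow> b \<in> A \<Longrightarrow> s \<in> A"
    by (rule exists_absolute_value[OF sa nb]) (rule that)
  have sA: "s \<in> cstar x" by (rule sA'[OF A bA])
  have "compact_op ((1/2) *\<^sub>R (s + b))"
  proof (rule compact_positive_part[OF sa s(1-4)])
    fix u assume "bop_apply (tail N) u = u"
    then show "Re (cinner (bop_apply b u) u) \<le> 0" unfolding bform using tl[of u] M by (simp add: divide_le_0_iff)
  qed
  moreover have "(1/2) *\<^sub>R (s + b) \<in> cstar x" by (intro mem sA bA)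
  ultimately have z: "\<phi> ((1/2) *\<^sub>R (s + b)) = 0\<^sub>m 1 1" using kill by blast
  define ev where "ev a = \<phi> a $$ (0, 0)" for a
  have carr: "\<phi> a \<in> carrier_mat 1 1" if "a \<in> cstar x" for a using ucp_mapD(1)[OF \<phi> that] .
  have ev_add: "ev (a + a') = ev a + ev a'" if "a \<in> cstar x" "a' \<in> cstar x" for a a'
    using carr[OF that(1)] carr[OF that(2)] by (simp add: ev_def ucp_mapD(2)[OF \<phi> that])
  have ev_scale: "ev (scaleC_bop d a) = d * ev a" if "a \<in> cstar x" for a d
    using carr[OF that] by (simp add: ev_def ucp_mapD(3)[OF \<phi> that])
  have ev_scaleR: "ev (r *\<^sub>R a) = of_real r * ev a" if "a \<in> cstar x" for a r
    using ev_scale[OF that, of "of_real r"] by (simp add: scaleC_bop_of_real)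
  have ev1: "ev 1 = 1" by (simp add: ev_def ucp_mapD(4)[OF \<phi>])
  have "ev ((1/2) *\<^sub>R (s + b)) = 0" using z by (simp add: ev_def)
  \<comment> \<open>Twice the positive part of \<open>b\<close> is killed; since the value at
    \<open>s\<close> is nonnegative, the value at \<open>b\<close> has nonpositive real
    part.\<close>
  then have sb: "ev s + ev b = 0"
    using ev_scaleR[OF mem(2)[OF sA bA], of "1/2"] ev_add[OF sA bA] by simp
  have "block_positive_bop 1 (\<lambda>_ _. s)"
    unfolding block_positive_bop_def
  proof
    fix \<xi> :: "nat \<Rightarrow> ell2"
    have "cinner (bop_apply s (\<xi> 0)) (\<xi> 0) = cinner (\<xi> 0) (bop_apply s (\<xi> 0))"
      using cinner_adj[of s "\<xi> 0" "\<xi> 0"] unfolding s(3) .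
    then have c: "cinner (bop_apply s (\<xi> 0)) (\<xi> 0) = cnj (cinner (bop_apply s (\<xi> 0)) (\<xi> 0))"
      unfolding cinner_commute[of "\<xi> 0" "bop_apply s (\<xi> 0)"] .
    have "Im (cinner (bop_apply s (\<xi> 0)) (\<xi> 0)) = 0"
      using arg_cong[OF c, of Im] by simp
    then show "(\<Sum>i<1. \<Sum>j<1. cinner (bop_apply s (\<xi> j)) (\<xi> i)) \<in> \<real>\<^sub>\<ge>\<^sub>0"
      using s(4)[of "\<xi> 0"] by (simp add: complex_nonneg_Reals_iff)
  qed
  from ucp_map_block_form[OF \<phi> _ this, of "\<lambda>_ _. 1"] have "0 \<le> Re (ev s)"
    using sA by (simp add: frm_def ev_def complex_nonneg_Reals_iff)
  then have "Re (ev b) \<le> 0" using arg_cong[OF sb, of Re] by simp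
  moreover have "ev b = of_real (1 / M) * (of_real (1/2) * (c * ev x + cnj c * ev (adj x)) + of_real (- \<beta>))"
  proof -
    have "b = (1 / M) *\<^sub>R ((1/2) *\<^sub>R (scaleC_bop c x + scaleC_bop (cnj c) (adj x)) + (- \<beta>) *\<^sub>R 1)"
      by (simp add: b_def b0_def)
    then show ?thesis
      by (simp only: ev_scaleR ev_add ev_scale ev1 mem xA mult_1_right)
  qed
  moreover have "ev (adj x) = cnj (ev x)"
    unfolding ev_def by (rule ucp_map_adj[OF \<phi> A xA]) simp_all
  ultimately have "(1 / M) * (Re (c * ev x) - \<beta>) \<le> 0" by (simp add: diff_divide_distrib)
  then show ?thesis using M by (simp add: mult_le_0_iff ev_def divide_le_0_iff)
qed

section \<open>States that kill the compact operators\<close>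

lemma frm_rank_one:
  "frm A (\<lambda>i k. w i * cnj (w k)) y z = (\<Sum>k\<in>A. y k * cnj (w k)) * cnj (\<Sum>k\<in>A. z k * cnj (w k))"
  by (simp add: frm_def sum_product cnj_sum ac_simps)

text \<open>A Gram decomposition of \<open>h\<close> into rank one terms turns the tensor form into
  a sum of forms of \<open>G\<close>.\<close>

lemma psd_tensor_form:
  fixes h :: "nat \<Rightarrow> nat \<Rightarrow> complex" and G :: "nat \<Rightarrow> nat \<Rightarrow> complex"
  assumes h: "psd {..<n} h" and G: "psd {..<m} G"
  shows "(\<Sum>p<m. \<Sum>q<m. G p q * frm {..<n} h (\<eta> q) (\<eta> p)) \<in> \<real>\<^sub>\<ge>\<^sub>0"
proof -
  obtain w where w: "\<And>p q. p \<in> {..<n} \<Longrightarrow> q \<in> {..<n} \<Longrightarrow> h p q = (\<Sum>r\<in>{..<n}. w r p * cnj (w r q))"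
    by (rule psd_Gram[OF h]) auto
  define g where "g r q = (\<Sum>k\<in>{..<n}. \<eta> q k * cnj (w r k))" for r q
  have h_g: "frm {..<n} h (\<eta> q) (\<eta> p) = (\<Sum>r\<in>{..<n}. g r q * cnj (g r p))" for p q
  proof -
    have "frm {..<n} h (\<eta> q) (\<eta> p) = frm {..<n} (\<lambda>i k. \<Sum>r\<in>{..<n}. w r i * cnj (w r k)) (\<eta> q) (\<eta> p)"
      by (rule frm_cong) (use w in auto)
    then show ?thesis unfolding frm_kernel_sum frm_rank_one g_def .
  qed
  have "(\<Sum>p<m. \<Sum>q<m. G p q * frm {..<n} h (\<eta> q) (\<eta> p)) = (\<Sum>p<m. \<Sum>q<m. \<Sum>r\<in>{..<n}. G p q * g r q * cnj (g r p))"
    by (simp add: h_g sum_distrib_left mult.assoc)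
  also have "\<dots> = (\<Sum>p<m. \<Sum>r\<in>{..<n}. \<Sum>q<m. G p q * g r q * cnj (g r p))"
    by (intro sum.cong refl sum.swap)
  also have "\<dots> = (\<Sum>r\<in>{..<n}. frm {..<m} G (g r) (g r))"
    unfolding frm_def by (rule sum.swap)
  finally show ?thesis using psdD[OF G] by (simp add: complex_nonneg_Reals_iff sum_nonneg)
qed

text \<open>The states live on all operators and not on \<open>cstar x\<close>, because they are to
  be evaluated at \<open>x + k\<close>. Positivity is stated for blocks, the form in which
  \<open>ucp_map_of_states\<close> tensors it with the weights.\<close>

definition ess_state :: "(bop \<Rightarrow> complex) \<Rightarrow> bool" where
  "ess_state f \<longleftrightarrow> (\<forall>a b. f (a + b) = f a + f b) \<and> (\<forall>c a. f (scaleC_bop c a) = c * f a) \<and> f 1 = 1 \<and>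
    (\<forall>k. compact_op k \<longrightarrow> f k = 0) \<and> (\<forall>n x. block_positive_bop n x \<longrightarrow> psd {..<n} (\<lambda>i j. f (x i j)))"

lemma ess_stateD:
  assumes "ess_state f"
  shows "f (a + b) = f a + f b" "f (scaleC_bop c a) = c * f a" "f 1 = 1" "compact_op k \<Longrightarrow> f k = 0"
    "block_positive_bop n x \<Longrightarrow> psd {..<n} (\<lambda>i j. f (x i j))"
  using assms unfolding ess_state_def by simp_all

lemma ess_state_of_ucp_map:
  assumes \<Phi>: "ucp_map 1 UNIV \<Phi>" and kill: "\<And>k. compact_op k \<Longrightarrow> \<Phi> k = 0\<^sub>m 1 1"
  shows "ess_state (\<lambda>a. \<Phi> a $$ (0, 0))"
  unfolding ess_state_def
proof (intro conjI allI impI)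
  fix a b c n x
  have carr: "\<Phi> a \<in> carrier_mat 1 1" for a using ucp_mapD(1)[OF \<Phi>] by simp
  show "\<Phi> (a + b) $$ (0, 0) = \<Phi> a $$ (0, 0) + \<Phi> b $$ (0, 0)"
    using carr[of a] carr[of b] by (simp add: ucp_mapD(2)[OF \<Phi>])
  show "\<Phi> (scaleC_bop c a) $$ (0, 0) = c * \<Phi> a $$ (0, 0)"
    using carr[of a] by (simp add: ucp_mapD(3)[OF \<Phi>])
  show "\<Phi> 1 $$ (0, 0) = 1" by (simp add: ucp_mapD(4)[OF \<Phi>])
  show "\<Phi> a $$ (0, 0) = 0" if "compact_op a" by (simp add: kill[OF that])
  assume "block_positive_bop n x"
  from ucp_map_block_form[OF \<Phi> _ this, of "\<lambda>i _. z i" for z]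
  show "psd {..<n} (\<lambda>i j. \<Phi> (x i j) $$ (0, 0))" by (simp add: psd_def frm_def)
qed

lemma convex_ess_state_values: "convex {f x | f. ess_state f}"
proof (rule convexI)
  fix y z :: complex and s t :: real
  assume "y \<in> {f x | f. ess_state f}" "z \<in> {f x | f. ess_state f}" and st: "0 \<le> s" "0 \<le> t" "s + t = 1"
  then obtain f g where f: "ess_state f" "y = f x" and g: "ess_state g" "z = g x" by blast
  have "ess_state (\<lambda>a. of_real s * f a + of_real t * g a)"
    unfolding ess_state_def
  proof (intro conjI allI impI)
    show "of_real s * f 1 + of_real t * g 1 = 1"
      using arg_cong[OF st(3), of complex_of_real] by (simp add: ess_stateD(3)[OF f(1)] ess_stateD(3)[OF g(1)])
    fix n x assume x: "block_positive_bop n x"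
    show "psd {..<n} (\<lambda>i j. of_real s * f (x i j) + of_real t * g (x i j))"
      by (intro psd_add psd_scale st) (rule ess_stateD(5)[OF f(1) x] ess_stateD(5)[OF g(1) x])+
  qed (simp_all add: ess_stateD[OF f(1)] ess_stateD[OF g(1)] algebra_simps)
  then show "s *\<^sub>R y + t *\<^sub>R z \<in> {f x | f. ess_state f}"
    unfolding f(2) g(2) scaleR_conv_of_real
    by (intro CollectI exI[of _ "\<lambda>a. of_real s * f a + of_real t * g a"] conjI refl)
qed

text \<open>The map is the sum of the tensor products of \<open>f j\<close> and \<open>h j\<close>,
  so a positive block is sent to a sum of tensor forms of positive matrices.\<close>

lemma ucp_map_of_states:
  fixes J :: "nat set"
  assumes J: "finite J" and h: "\<And>j. j \<in> J \<Longrightarrow> psd {..<n} (h j)"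
    and unit: "\<And>i k. i < n \<Longrightarrow> k < n \<Longrightarrow> (\<Sum>j\<in>J. h j i k) = unitk i k"
    and f: "\<And>j. j \<in> J \<Longrightarrow> ess_state (f j)"
  shows "ucp_map n UNIV (\<lambda>b. Matrix.mat n n (\<lambda>(i, k). \<Sum>j\<in>J. f j b * h j i k))"
  unfolding ucp_map_def
proof (intro conjI ballI allI impI)
  let ?\<Phi> = "\<lambda>b. Matrix.mat n n (\<lambda>(i, k). \<Sum>j\<in>J. f j b * h j i k)"
  fix a b c m x
  show "?\<Phi> a \<in> carrier_mat n n" by simp
  show "?\<Phi> (a + b) = ?\<Phi> a + ?\<Phi> b"
    by (rule eq_matI) (simp_all add: ess_stateD(1)[OF f] distrib_right sum.distrib)
  show "?\<Phi> (scaleC_bop c a) = c \<cdot>\<^sub>m ?\<Phi> a"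
    by (rule eq_matI) (simp_all add: ess_stateD(2)[OF f] sum_distrib_left mult.assoc)
  show "?\<Phi> 1 = 1\<^sub>m n"
  proof (rule eq_matI)
    fix i k assume "i < dim_row (1\<^sub>m n :: complex mat)" "k < dim_col (1\<^sub>m n :: complex mat)"
    then have ik: "i < n" "k < n" by simp_all
    have "(\<Sum>j\<in>J. f j 1 * h j i k) = (\<Sum>j\<in>J. h j i k)"
      by (simp add: ess_stateD(3)[OF f])
    then show "?\<Phi> 1 $$ (i, k) = 1\<^sub>m n $$ (i, k)" using unit[OF ik] ik by simp
  qed simp_all
  assume x: "(\<forall>i<m. \<forall>j<m. x i j \<in> (UNIV :: bop set)) \<and> block_positive_bop m x"
  show "block_positive_mat n m (\<lambda>i j. ?\<Phi> (x i j))"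
  proof (subst block_positive_mat_iff)
    show "\<forall>\<eta>. (\<Sum>p<m. \<Sum>q<m. frm {..<n} (kern (?\<Phi> (x p q))) (\<eta> q) (\<eta> p)) \<in> \<real>\<^sub>\<ge>\<^sub>0"
    proof
      fix \<eta> :: "nat \<Rightarrow> nat \<Rightarrow> complex"
      have k: "frm {..<n} (kern (?\<Phi> (x p q))) y z = (\<Sum>j\<in>J. f j (x p q) * frm {..<n} (h j) y z)" for p q y z
      proof -
        have "frm {..<n} (kern (?\<Phi> (x p q))) y z = frm {..<n} (\<lambda>i k. \<Sum>j\<in>J. f j (x p q) * h j i k) y z"
          by (rule frm_cong) auto
        then show ?thesis unfolding frm_kernel_sum frm_kernel_scale .
      qed
      have "(\<Sum>p<m. \<Sum>q<m. frm {..<n} (kern (?\<Phi> (x p q))) (\<eta> q) (\<eta> p))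
        = (\<Sum>p<m. \<Sum>j\<in>J. \<Sum>q<m. f j (x p q) * frm {..<n} (h j) (\<eta> q) (\<eta> p))"
        unfolding k by (intro sum.cong refl sum.swap)
      also have "\<dots> = (\<Sum>j\<in>J. \<Sum>p<m. \<Sum>q<m. f j (x p q) * frm {..<n} (h j) (\<eta> q) (\<eta> p))"
        by (rule sum.swap)
      finally have eq: "(\<Sum>p<m. \<Sum>q<m. frm {..<n} (kern (?\<Phi> (x p q))) (\<eta> q) (\<eta> p))
        = (\<Sum>j\<in>J. \<Sum>p<m. \<Sum>q<m. f j (x p q) * frm {..<n} (h j) (\<eta> q) (\<eta> p))" .
      have "(\<Sum>p<m. \<Sum>q<m. f j (x p q) * frm {..<n} (h j) (\<eta> q) (\<eta> p)) \<in> \<real>\<^sub>\<ge>\<^sub>0" if "j \<in> J" for j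
        using x by (intro psd_tensor_form[OF h[OF that]] ess_stateD(5)[OF f[OF that]]) simp
      then have "(\<Sum>j\<in>J. \<Sum>p<m. \<Sum>q<m. f j (x p q) * frm {..<n} (h j) (\<eta> q) (\<eta> p)) \<in> \<real>\<^sub>\<ge>\<^sub>0"
        by (induction J rule: infinite_finite_induct) (simp_all add: nonneg_Reals_add_I)
      then show "(\<Sum>p<m. \<Sum>q<m. frm {..<n} (kern (?\<Phi> (x p q))) (\<eta> q) (\<eta> p)) \<in> \<real>\<^sub>\<ge>\<^sub>0" unfolding eq .
    qed
  qed simp
qed

text \<open>The states kill \<open>k\<close>, so their values at \<open>x + k\<close> and at
  \<open>x\<close> agree and are the prescribed \<open>l j\<close>.\<close>

lemma min_level_subset_matrix_range:
  assumes K: "K \<subseteq> {f x | f. ess_state f}" and k: "compact_op k" and a: "a \<in> min_level n K"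
  shows "a \<in> matrix_range_level n (x + k)"
proof -
  from a have carr: "a \<in> carrier_mat n n" and "kmin n K (kern a)" by (simp_all add: min_level_iff)
  then obtain J :: "nat set" and h l where J: "finite J" "\<forall>j\<in>J. psd {..<n} (h j) \<and> l j \<in> K"
    "\<forall>i<n. \<forall>k<n. (\<Sum>j\<in>J. h j i k) = unitk i k \<and> (\<Sum>j\<in>J. l j * h j i k) = kern a i k"
    unfolding kmin_def by (elim exE conjE)
  have "\<exists>f. ess_state f \<and> f x = l j" if "j \<in> J" for j
  proof -
    have "l j \<in> {f x | f. ess_state f}" using J(2) K that by (blast intro: subsetD)
    then show ?thesis by (elim CollectE exE conjE) (intro exI conjI, assumption, rule sym)
  qed
  then have "\<forall>j\<in>J. \<exists>f. ess_state f \<and> f x = l j" by (rule ballI)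
  from bchoice[OF this] obtain f where f: "\<And>j. j \<in> J \<Longrightarrow> ess_state (f j)" "\<And>j. j \<in> J \<Longrightarrow> f j x = l j" by fast
  define \<Phi> where "\<Phi> b = Matrix.mat n n (\<lambda>(i, k). \<Sum>j\<in>J. f j b * h j i k)" for b
  have "ucp_map n UNIV \<Phi>"
    unfolding \<Phi>_def by (rule ucp_map_of_states) (use J f in auto)
  then have "ucp_map n (cstar (x + k)) \<Phi>" by (rule ucp_map_subset)
  moreover have "a = \<Phi> (x + k)"
  proof (rule eq_matI)
    fix i r assume "i < dim_row (\<Phi> (x + k))" "r < dim_col (\<Phi> (x + k))"
    then have ir: "i < n" "r < n" by (simp_all add: \<Phi>_def)
    have "(\<Sum>j\<in>J. f j (x + k) * h j i r) = (\<Sum>j\<in>J. l j * h j i r)"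
      by (simp add: ess_stateD(1)[OF f(1)] ess_stateD(4)[OF f(1) k] f(2))
    then show "a $$ (i, r) = \<Phi> (x + k) $$ (i, r)" using J(3) ir by (simp add: \<Phi>_def)
  qed (use carr in \<open>auto simp: \<Phi>_def\<close>)
  ultimately show ?thesis unfolding matrix_range_level_def by blast
qed

text \<open>An entry of a positive weight is at most the mean of the two diagonal entries, and the
  diagonals of the weights add up to 1.\<close>

lemma kmin_entry_bound:
  assumes a: "kmin n K a" and K: "K \<subseteq> cball 0 R" and ik: "i < n" "k < n"
  shows "cmod (a i k) \<le> R"
proof -
  obtain J :: "nat set" and h l where J: "finite J" "\<forall>j\<in>J. psd {..<n} (h j) \<and> l j \<in> K"
    "\<forall>i<n. \<forall>k<n. (\<Sum>j\<in>J. h j i k) = unitk i k \<and> (\<Sum>j\<in>J. l j * h j i k) = a i k"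
    using a unfolding kmin_def by (elim exE conjE)
  have diag: "(\<Sum>j\<in>J. Re (h j i i)) = 1" if "i < n" for i
    using J(3) that by (simp flip: Re_sum)
  have "cmod (a i k) = cmod (\<Sum>j\<in>J. l j * h j i k)" using J(3) ik by simp
  also have "\<dots> \<le> (\<Sum>j\<in>J. R * ((Re (h j i i) + Re (h j k k)) / 2))"
  proof (rule sum_norm_le)
    fix j assume j: "j \<in> J"
    have "cmod (l j) \<le> R" using J(2) j K by auto
    moreover have "cmod (h j i k) \<le> (Re (h j i i) + Re (h j k k)) / 2"
      using psd_entry_bound[of "{..<n}" "h j" i k] J(2) j ik by simp
    ultimately show "cmod (l j * h j i k) \<le> R * ((Re (h j i i) + Re (h j k k)) / 2)"
      unfolding norm_mult by (intro mult_mono) (auto intro: order_trans[OF norm_ge_zero])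
  qed
  also have "\<dots> = R * ((\<Sum>j\<in>J. Re (h j i i)) + (\<Sum>j\<in>J. Re (h j k k))) / 2"
    by (simp add: sum_distrib_left sum_divide_distrib sum.distrib algebra_simps add_divide_distrib)
  also have "\<dots> = R" using diag ik by simp
  finally show ?thesis .
qed

lemma kmin_cong:
  assumes "\<And>i k. i < n \<Longrightarrow> k < n \<Longrightarrow> a i k = a' i k"
  shows "kmin n K a = kmin n K a'"
  unfolding kmin_def using assms by (simp cong: conj_cong)

lemma kmin_passes:
  assumes a: "kmin n K a" and T: "\<And>p q l. (p, q) \<in> T \<Longrightarrow> l \<in> K \<Longrightarrow> cmod (p * l + cnj (q * l)) \<le> 1"
  shows "passes_mat T n a"
  unfolding passes_mat_def
proof (clarify)
  fix p q x y assume pq: "(p, q) \<in> T"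
  obtain J :: "nat set" and h l where J: "finite J" "\<forall>j\<in>J. psd {..<n} (h j) \<and> l j \<in> K"
    "\<forall>i<n. \<forall>k<n. (\<Sum>j\<in>J. h j i k) = unitk i k \<and> (\<Sum>j\<in>J. l j * h j i k) = a i k"
    using a unfolding kmin_def by (elim exE conjE)
  have "frm {..<n} a x y = frm {..<n} (\<lambda>i k. \<Sum>j\<in>J. l j * h j i k) x y" for x y
    by (rule frm_cong) (use J(3) in auto)
  then have fa: "frm {..<n} a x y = (\<Sum>j\<in>J. l j * frm {..<n} (h j) x y)" for x y
    unfolding frm_kernel_sum frm_kernel_scale .
  have "frm {..<n} unitk x y = frm {..<n} (\<lambda>i k. \<Sum>j\<in>J. h j i k) x y" for x y
    by (rule frm_cong) (use J(3) in auto)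
  then have fu: "frm {..<n} unitk x y = (\<Sum>j\<in>J. frm {..<n} (h j) x y)" for x y
    unfolding frm_kernel_sum .
  have "0 \<le> Re (frm {..<n} (h j) x x) + Re (frm {..<n} (h j) y y)
    + 2 * Re (p * (l j * frm {..<n} (h j) x y) + q * (l j * frm {..<n} (h j) y x))" if j: "j \<in> J" for j
  proof -
    have h: "psd {..<n} (h j)" using J(2) j by blast
    \<comment> \<open>Soundness of the test at the scalar \<open>l j\<close> is the bound on the
      multiplier in \<open>psd_Cauchy_Schwarz\<close> for the weight \<open>h j\<close>.\<close>
    have "cmod (- (p * l j + cnj (q * l j))) \<le> 1" unfolding norm_minus_cancel using T[OF pq] J(2) j by blast
    from psd_Cauchy_Schwarz[OF h this, of x y]
    show ?thesis unfolding frm_hermitian[OF h, of y x] by (simp add: algebra_simps)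
  qed
  then have "0 \<le> (\<Sum>j\<in>J. Re (frm {..<n} (h j) x x) + Re (frm {..<n} (h j) y y)
    + 2 * Re (p * (l j * frm {..<n} (h j) x y) + q * (l j * frm {..<n} (h j) y x)))"
    by (rule sum_nonneg)
  also have "\<dots> = Re (frm {..<n} unitk x x) + Re (frm {..<n} unitk y y) + 2 * Re (p * frm {..<n} a x y + q * frm {..<n} a y x)"
    unfolding fa fu by (simp add: sum.distrib sum_distrib_left sum_subtractf algebra_simps)
  finally show "0 \<le> Re (frm {..<n} unitk x x) + Re (frm {..<n} unitk y y) + 2 * Re (p * frm {..<n} a x y + q * frm {..<n} a y x)" .
qed

lemma level_of_graded_set:
  assumes L: "\<And>m. L m \<subseteq> carrier_mat m m" and n: "1 \<le> n"
  shows "(\<Union>m\<in>{1..}. L m) \<inter> carrier_mat n n = L n"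
proof (intro equalityI subsetI)
  fix a assume a: "a \<in> (\<Union>m\<in>{1..}. L m) \<inter> carrier_mat n n"
  then obtain m where m: "a \<in> L m" by blast
  then have "m = n" using L[of m] a by auto
  then show "a \<in> L n" using m by simp
next
  fix a assume "a \<in> L n"
  then show "a \<in> (\<Union>m\<in>{1..}. L m) \<inter> carrier_mat n n" using L[of n] n by auto
qed

lemma min_set_level: "1 \<le> n \<Longrightarrow> min_set K \<inter> carrier_mat n n = min_level n K"
  unfolding min_set_def by (rule level_of_graded_set) (auto simp: min_level_def)

lemma ess_matrix_range_level_eq:
  assumes "ess_matrix_range x = min_set K" "1 \<le> n"
  shows "ess_matrix_range_level n x = min_level n K"
proof -
  have "ess_matrix_range_level m x \<subseteq> carrier_mat m m" for m
    unfolding ess_matrix_range_level_def using ucp_mapD(1) cstar_hull(2) by blast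
  then have "ess_matrix_range x \<inter> carrier_mat n n = ess_matrix_range_level n x"
    using assms(2) unfolding ess_matrix_range_def by (rule level_of_graded_set)
  then show ?thesis using min_set_level[OF assms(2), of K] assms(1) by simp
qed

text \<open>A point of \<open>K\<close> of maximal modulus is exposed, so a cluster point of vector states that
  comes close to it in the direction of \<open>l\<close> must attain it.\<close>

lemma exists_ess_state_at_extreme_point:
  assumes K: "K \<subseteq> cball 0 R" and l: "l \<in> K" "cmod l = R" and ess: "ess_matrix_range x = min_set K"
  shows "\<exists>f. ess_state f \<and> f x = l"
proof -
  define a where "a = Matrix.mat 1 1 (\<lambda>_. l)"
  have "kmin 1 K (kern a)"
    unfolding kmin_def by (rule exI[of _ "{0}"], rule exI[of _ "\<lambda>_. unitk"], rule exI[of _ "\<lambda>_. l"])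
      (simp add: psd_unitk l(1) a_def)
  then have "a \<in> min_level 1 K" by (simp add: min_level_iff a_def)
  then have "a \<in> ess_matrix_range_level 1 x" using ess_matrix_range_level_eq[OF ess, of 1] by simp
  then obtain \<phi> where \<phi>: "a = \<phi> x" "ucp_map 1 (cstar x) \<phi>" "\<forall>k\<in>cstar x. compact_op k \<longrightarrow> \<phi> k = 0\<^sub>m 1 1"
    unfolding ess_matrix_range_level_def by blast
  have ll: "cnj l * l = of_real (R\<^sup>2)" using complex_norm_square[of l] l(2) by (simp add: mult.commute)
  \<comment> \<open>If the tail \<open>m\<close> contained no such unit vector,
    \<open>ess_numerical_range_bound\<close> would push the value \<open>l\<close> of
    \<open>\<phi>\<close> strictly below its own modulus.\<close>
  have "\<exists>\<xi>. bop_apply (tail m) \<xi> = \<xi> \<and> norm \<xi> = 1 \<and> R\<^sup>2 - 1 / real (Suc m) < Re (cnj l * cinner (bop_apply x \<xi>) \<xi>)" for m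
  proof (rule ccontr)
    assume contra: "\<nexists>\<xi>. bop_apply (tail m) \<xi> = \<xi> \<and> norm \<xi> = 1 \<and> R\<^sup>2 - 1 / real (Suc m) < Re (cnj l * cinner (bop_apply x \<xi>) \<xi>)"
    have "Re (cnj l * \<phi> x $$ (0, 0)) \<le> R\<^sup>2 - 1 / real (Suc m)"
    proof (rule ess_numerical_range_bound[OF \<phi>(2)])
      fix u assume u: "bop_apply (tail m) u = u"
      show "Re (cnj l * cinner (bop_apply x u) u) \<le> (R\<^sup>2 - 1 / real (Suc m)) * (norm u)\<^sup>2"
      proof (cases "u = 0")
        case False
        define \<xi> where "\<xi> = inverse (norm u) *\<^sub>R u"
        have "bop_apply (tail m) \<xi> = \<xi>" "norm \<xi> = 1" using u False by (simp_all add: \<xi>_def bop_linear)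
        then have le: "Re (cnj l * cinner (bop_apply x \<xi>) \<xi>) \<le> R\<^sup>2 - 1 / real (Suc m)"
          using contra not_less by blast
        have "cinner (bop_apply x u) u = of_real ((norm u)\<^sup>2) * cinner (bop_apply x \<xi>) \<xi>"
          using False by (simp add: \<xi>_def bop_linear cinner_simps power2_eq_square field_simps)
        then have "Re (cnj l * cinner (bop_apply x u) u) = (norm u)\<^sup>2 * Re (cnj l * cinner (bop_apply x \<xi>) \<xi>)"
          by (simp add: algebra_simps)
        also have "\<dots> \<le> (norm u)\<^sup>2 * (R\<^sup>2 - 1 / real (Suc m))" by (intro mult_left_mono le) simp
        finally show ?thesis by (simp only: mult.commute)
      qed simp
    qed (use \<phi>(3) in blast)
    moreover have "cnj l * \<phi> x $$ (0, 0) = of_real (R\<^sup>2)"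
      using ll unfolding \<phi>(1)[symmetric] a_def by simp
    ultimately show False by simp
  qed
  then have "\<forall>m. \<exists>\<xi>. bop_apply (tail m) \<xi> = \<xi> \<and> norm \<xi> = 1 \<and> R\<^sup>2 - 1 / real (Suc m) < Re (cnj l * cinner (bop_apply x \<xi>) \<xi>)"
    by (rule allI)
  from choice[OF this] obtain \<xi> where \<xi>: "\<And>m. bop_apply (tail m) (\<xi> m) = \<xi> m" "\<And>m. norm (\<xi> m) = 1"
    "\<And>m. R\<^sup>2 - 1 / real (Suc m) < Re (cnj l * cinner (bop_apply x (\<xi> m)) (\<xi> m))" by blast
  have "\<exists>F \<Phi>. F \<noteq> bot \<and> F \<le> sequentially \<and> ucp_map 1 UNIV \<Phi> \<and> (\<forall>k. compact_op k \<longrightarrow> \<Phi> k = 0\<^sub>m 1 1) \<and>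
    (\<forall>a i j. i < 1 \<longrightarrow> j < 1 \<longrightarrow> ((\<lambda>m. cinner (bop_apply a (\<xi> m)) (\<xi> m)) \<longlongrightarrow> \<Phi> a $$ (i, j)) F)"
    by (rule ucp_cluster_point) (simp_all add: \<xi> cinner_self)
  then obtain F \<Phi> where F: "F \<noteq> bot" "F \<le> sequentially" "ucp_map 1 UNIV \<Phi>" "\<forall>k. compact_op k \<longrightarrow> \<Phi> k = 0\<^sub>m 1 1"
    "\<forall>a i j. i < 1 \<longrightarrow> j < 1 \<longrightarrow> ((\<lambda>m. cinner (bop_apply a (\<xi> m)) (\<xi> m)) \<longlongrightarrow> \<Phi> a $$ (i, j)) F"
    by (elim exE conjE)
  define \<mu> where "\<mu> = \<Phi> x $$ (0, 0)"
  have lim: "((\<lambda>m. cinner (bop_apply x (\<xi> m)) (\<xi> m)) \<longlongrightarrow> \<mu>) F" unfolding \<mu>_def by (rule F(5)[rule_format]) simp_all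
  have "R\<^sup>2 - 0 \<le> Re (cnj l * \<mu>)"
  proof (rule tendsto_le[OF F(1)])
    show "((\<lambda>m. Re (cnj l * cinner (bop_apply x (\<xi> m)) (\<xi> m))) \<longlongrightarrow> Re (cnj l * \<mu>)) F"
      by (intro tendsto_intros lim)
    show "((\<lambda>m. R\<^sup>2 - 1 / real (Suc m)) \<longlongrightarrow> R\<^sup>2 - 0) F"
      by (rule tendsto_mono[OF F(2)]) (intro tendsto_intros LIMSEQ_inverse_real_of_nat[unfolded inverse_eq_divide])
    show "\<forall>\<^sub>F m in F. R\<^sup>2 - 1 / real (Suc m) \<le> Re (cnj l * cinner (bop_apply x (\<xi> m)) (\<xi> m))"
      using \<xi>(3) less_imp_le by (intro always_eventually allI) blast
  qed
  \<comment> \<open>The limit \<open>\<mu>\<close> belongs to the essential range again, so its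
    modulus is at most \<open>R\<close>; with \<open>Re (cnj l * \<mu>) \<ge> R\<^sup>2\<close> this
    leaves only \<open>\<mu> = l\<close>.\<close>
  moreover have "cmod \<mu> \<le> R"
  proof -
    have "\<Phi> x \<in> ess_matrix_range_level 1 x"
      unfolding ess_matrix_range_level_def using ucp_map_subset[OF F(3)] F(4) by blast
    then have "\<Phi> x \<in> min_level 1 K" using ess_matrix_range_level_eq[OF ess, of 1] by simp
    then show ?thesis
      unfolding \<mu>_def min_level_iff using kmin_entry_bound[of 1 K "kern (\<Phi> x)" R 0 0] K by simp
  qed
  then have "(cmod \<mu>)\<^sup>2 \<le> R\<^sup>2" by (intro power_mono) simp_all
  moreover have "(cmod (\<mu> - l))\<^sup>2 = (cmod \<mu>)\<^sup>2 + (cmod l)\<^sup>2 - 2 * Re (cnj l * \<mu>)"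
    unfolding cmod_power2 by (simp add: power2_eq_square algebra_simps)
  ultimately have "(cmod (\<mu> - l))\<^sup>2 \<le> 0" using l(2) by simp
  then have "\<mu> = l" by simp
  moreover have "ess_state (\<lambda>a. \<Phi> a $$ (0, 0))"
    by (rule ess_state_of_ucp_map[OF F(3)]) (use F(4) in blast)
  ultimately show ?thesis unfolding \<mu>_def by blast
qed

section \<open>Sets described by tests\<close>

lemma mat_adjoint_index:
  fixes A :: "complex mat"
  assumes "i < dim_col A" "r < dim_row A"
  shows "mat_adjoint A $$ (i, r) = cnj (A $$ (r, i))"
  using assms by (simp add: mat_adjoint_def mat_of_rows_index)

lemma mat_adjoint_carrier: "A \<in> carrier_mat d n \<Longrightarrow> mat_adjoint A \<in> carrier_mat n d"
  by (auto simp: mat_adjoint_def)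

lemma frm_compression:
  fixes A C :: "complex mat"
  assumes A: "A \<in> carrier_mat d d" and C: "C \<in> carrier_mat d n"
  shows "frm {..<n} (kern (mat_adjoint C * A * C)) x y
    = frm {..<d} (kern A) (\<lambda>r. \<Sum>k<n. x k * C $$ (r, k)) (\<lambda>r. \<Sum>k<n. y k * C $$ (r, k))"
proof -
  note ad = mat_adjoint_carrier[OF C]
  have entry: "(mat_adjoint C * A * C) $$ (i, k) = frm {..<d} (kern A) (\<lambda>s. C $$ (s, k)) (\<lambda>r. C $$ (r, i))"
    if ik: "i < n" "k < n" for i k
  proof -
    define M where "M = mat_adjoint C * A"
    have M: "M \<in> carrier_mat n d" using ad A by (simp add: M_def)
    have "M $$ (i, s) = (\<Sum>r<d. cnj (C $$ (r, i)) * A $$ (r, s))" if s: "s < d" for s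
      using ad A C ik s by (simp add: M_def scalar_prod_def mat_adjoint_index lessThan_atLeast0)
    then have "(M * C) $$ (i, k) = (\<Sum>s<d. (\<Sum>r<d. cnj (C $$ (r, i)) * A $$ (r, s)) * C $$ (s, k))"
      using M C ik by (simp add: scalar_prod_def lessThan_atLeast0)
    also have "\<dots> = (\<Sum>s<d. \<Sum>r<d. A $$ (r, s) * C $$ (s, k) * cnj (C $$ (r, i)))"
      unfolding sum_distrib_right by (intro sum.cong refl) simp
    also have "\<dots> = frm {..<d} (kern A) (\<lambda>s. C $$ (s, k)) (\<lambda>r. C $$ (r, i))"
      unfolding frm_def by (rule sum.swap)
    finally show ?thesis unfolding M_def .
  qed
  have "frm {..<n} (kern (mat_adjoint C * A * C)) x y
    = (\<Sum>i<n. \<Sum>k<n. x k * cnj (y i) * frm {..<d} (kern A) (\<lambda>s. C $$ (s, k)) (\<lambda>r. C $$ (r, i)))"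
    unfolding frm_def[of "{..<n}"] by (intro sum.cong refl) (simp add: entry ac_simps)
  also have "\<dots> = (\<Sum>k<n. \<Sum>i<n. x k * cnj (y i) * frm {..<d} (kern A) (\<lambda>s. C $$ (s, k)) (\<lambda>r. C $$ (r, i)))"
    by (rule sum.swap)
  also have "\<dots> = frm {..<d} (kern A) (\<lambda>r. \<Sum>k<n. x k * C $$ (r, k)) (\<lambda>r. \<Sum>k<n. y k * C $$ (r, k))"
    by (rule frm_double_sum[symmetric])
  finally show ?thesis .
qed

lemma frm_gram:
  fixes C :: "complex mat"
  assumes C: "C \<in> carrier_mat d n"
  shows "frm {..<n} (kern (mat_adjoint C * C)) x y
    = frm {..<d} unitk (\<lambda>r. \<Sum>k<n. x k * C $$ (r, k)) (\<lambda>r. \<Sum>k<n. y k * C $$ (r, k))"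
proof -
  have "mat_adjoint C * 1\<^sub>m d = mat_adjoint C"
    using mat_adjoint_carrier[OF C] by simp
  then have "frm {..<n} (kern (mat_adjoint C * C)) x y = frm {..<n} (kern (mat_adjoint C * 1\<^sub>m d * C)) x y" by simp
  also have "\<dots> = frm {..<d} (kern (1\<^sub>m d)) (\<lambda>r. \<Sum>k<n. x k * C $$ (r, k)) (\<lambda>r. \<Sum>k<n. y k * C $$ (r, k))"
    by (rule frm_compression[OF one_carrier_mat C])
  also have "\<dots> = frm {..<d} unitk (\<lambda>r. \<Sum>k<n. x k * C $$ (r, k)) (\<lambda>r. \<Sum>k<n. y k * C $$ (r, k))"
    by (rule frm_cong) auto
  finally show ?thesis .
qed

lemma frm_msum: "frm {..<n} (kern (msum n m f)) x y = (\<Sum>j<m. frm {..<n} (kern (f j)) x y)"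
proof -
  have "frm {..<n} (kern (msum n m f)) x y = frm {..<n} (\<lambda>i k. \<Sum>j<m. f j $$ (i, k)) x y"
    by (rule frm_cong) (auto simp: msum_def)
  then show ?thesis unfolding frm_kernel_sum .
qed

text \<open>What the argument asks of \<open>K\<close>: \<open>sound\<close> and
  \<open>complete\<close> identify the minimal set with the tests, \<open>bounded\<close> makes the
  effect of a compact operator uniform over \<open>T\<close>, and the hull condition reduces the
  search for states to points of maximal modulus, where the limit is forced.\<close>

locale testable_compact_set =
  fixes K :: "complex set" and T :: "(complex \<times> complex) set" and R :: real
  assumes K: "compact K" "K \<subseteq> cball 0 R" "K \<subseteq> convex hull {l \<in> K. cmod l = R}"
    and bounded: "(p, q) \<in> T \<Longrightarrow> cmod p \<le> 1 \<and> cmod q \<le> 1"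
    and sound: "(p, q) \<in> T \<Longrightarrow> l \<in> K \<Longrightarrow> cmod (p * l + cnj (q * l)) \<le> 1"
    and complete: "passes_mat T n a \<Longrightarrow> kmin n K a"
begin

lemma kmin_iff: "kmin n K a \<longleftrightarrow> passes_mat T n a"
  using kmin_passes[OF _ sound] complete by blast

text \<open>The tests are closed conditions and the entries are bounded by \<open>R\<close>, so the
  level is a closed subset of a product of discs.\<close>

lemma compact_min_level: "compact_mats n (min_level n K)"
proof -
  define B :: "nat \<times> nat \<Rightarrow> complex set" where "B ij = (if ij \<in> {..<n} \<times> {..<n} then cball 0 R else {0})" for ij
  define P where "P = {g :: nat \<times> nat \<Rightarrow> complex. passes_mat T n (\<lambda>i k. g (i, k))}"
  have "compactin (product_topology (\<lambda>_ :: nat \<times> nat. euclidean :: complex topology) UNIV) (PiE UNIV B)"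
    by (subst compactin_PiE) (auto simp: B_def)
  then have "compact (PiE UNIV B)" by (simp add: euclidean_product_topology)
  moreover have "closed P"
  proof -
    have "P = (\<Inter>t\<in>T. \<Inter>x. \<Inter>y. {g. 0 \<le> Re (frm {..<n} unitk x x) + Re (frm {..<n} unitk y y)
      + 2 * Re (fst t * frm {..<n} (\<lambda>i k. g (i, k)) x y + snd t * frm {..<n} (\<lambda>i k. g (i, k)) y x)})"
      by (simp add: P_def passes_mat_def case_prod_beta set_eq_iff)
    also have "closed \<dots>"
    proof (intro closed_INT ballI closed_Collect_le continuous_intros)
      have coord: "continuous_on UNIV (\<lambda>g :: nat \<times> nat \<Rightarrow> complex. g ik)" for ik
        by (rule continuous_on_product_coordinates)
      show "continuous_on UNIV (\<lambda>g :: nat \<times> nat \<Rightarrow> complex. frm {..<n} (\<lambda>i k. g (i, k)) x y)" for x y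
        unfolding frm_def by (intro continuous_intros coord)
      then show "continuous_on UNIV (\<lambda>g :: nat \<times> nat \<Rightarrow> complex. frm {..<n} (\<lambda>i k. g (i, k)) x y)" for x y .
    qed
    finally show ?thesis .
  qed
  ultimately have "compact (PiE UNIV B \<inter> P)" by (rule compact_Int_closed)
  moreover have "(\<lambda>a ij. if ij \<in> {..<n} \<times> {..<n} then a $$ ij else 0) ` min_level n K = PiE UNIV B \<inter> P"
  proof (intro equalityI subsetI)
    fix g assume "g \<in> (\<lambda>a ij. if ij \<in> {..<n} \<times> {..<n} then a $$ ij else 0) ` min_level n K"
    then obtain a where a: "a \<in> min_level n K" and g: "g = (\<lambda>ij. if ij \<in> {..<n} \<times> {..<n} then a $$ ij else 0)" by blast
    have ka: "kmin n K (kern a)" using a by (simp add: min_level_iff)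
    have "kmin n K (\<lambda>i k. g (i, k))" using ka by (subst kmin_cong[of n _ "kern a"]) (simp_all add: g)
    moreover have "g ij \<in> B ij" for ij
      using kmin_entry_bound[OF ka K(2), of "fst ij" "snd ij"] by (auto simp: g B_def)
    ultimately show "g \<in> PiE UNIV B \<inter> P" by (simp add: P_def kmin_iff PiE_iff)
  next
    fix g assume g: "g \<in> PiE UNIV B \<inter> P"
    define a where "a = Matrix.mat n n g"
    have "kmin n K (kern a)"
      using g by (subst kmin_cong[of n _ "\<lambda>i k. g (i, k)"]) (simp_all add: a_def P_def kmin_iff)
    then have "a \<in> min_level n K" by (simp add: min_level_iff a_def)
    moreover have "g = (\<lambda>ij. if ij \<in> {..<n} \<times> {..<n} then a $$ ij else 0)"
    proof
      fix ij
      have "g ij \<in> B ij" using g by (cases ij) (simp add: PiE_iff)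
      then show "g ij = (if ij \<in> {..<n} \<times> {..<n} then a $$ ij else 0)"
        by (cases ij) (auto simp: a_def B_def split: if_splits)
    qed
    ultimately show "g \<in> (\<lambda>a ij. if ij \<in> {..<n} \<times> {..<n} then a $$ ij else 0) ` min_level n K" by (rule image_eqI[rotated])
  qed
  ultimately show ?thesis unfolding compact_mats_def by simp
qed

text \<open>Tests survive compression: the form of a compressed matrix is the original form at
  transformed vectors, and the normalisation lets the norms of these vectors add up to those of
  \<open>x\<close> and \<open>y\<close>.\<close>

lemma min_level_msum:
  assumes a: "\<And>j. j < m \<Longrightarrow> a j \<in> min_level (d j) K" and C: "\<And>j. j < m \<Longrightarrow> C j \<in> carrier_mat (d j) n"
    and unit: "msum n m (\<lambda>j. mat_adjoint (C j) * C j) = 1\<^sub>m n"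
  shows "msum n m (\<lambda>j. mat_adjoint (C j) * a j * C j) \<in> min_level n K"
proof -
  let ?s = "msum n m (\<lambda>j. mat_adjoint (C j) * a j * C j)"
  have carr: "a j \<in> carrier_mat (d j) (d j)" and pass: "passes_mat T (d j) (kern (a j))" if "j < m" for j
    using a[OF that] by (simp_all add: min_level_iff kmin_iff)
  have "passes_mat T n (kern ?s)"
    unfolding passes_mat_def
  proof clarify
    fix p q x y assume pq: "(p, q) \<in> T"
    define X where "X z j = (\<lambda>r. \<Sum>k<n. z k * C j $$ (r, k))" for z j
    have s: "frm {..<n} (kern ?s) z z' = (\<Sum>j<m. frm {..<d j} (kern (a j)) (X z j) (X z' j))" for z z'
      unfolding frm_msum X_def by (intro sum.cong refl frm_compression carr C) simp_all
    have "frm {..<n} unitk z z = frm {..<n} (kern (msum n m (\<lambda>j. mat_adjoint (C j) * C j))) z z" for z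
      unfolding unit by (rule frm_cong) auto
    also have "\<dots> z = (\<Sum>j<m. frm {..<d j} unitk (X z j) (X z j))" for z
      unfolding frm_msum X_def by (intro sum.cong refl frm_gram C) simp_all
    finally have u: "frm {..<n} unitk z z = (\<Sum>j<m. frm {..<d j} unitk (X z j) (X z j))" for z .
    have "0 \<le> (\<Sum>j<m. Re (frm {..<d j} unitk (X x j) (X x j)) + Re (frm {..<d j} unitk (X y j) (X y j))
      + 2 * Re (p * frm {..<d j} (kern (a j)) (X x j) (X y j) + q * frm {..<d j} (kern (a j)) (X y j) (X x j)))"
      using pass pq unfolding passes_mat_def by (intro sum_nonneg) fast
    also have "\<dots> = Re (frm {..<n} unitk x x) + Re (frm {..<n} unitk y y) + 2 * Re (p * frm {..<n} (kern ?s) x y + q * frm {..<n} (kern ?s) y x)"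
      unfolding s u by (simp add: sum.distrib sum_distrib_left sum_subtractf algebra_simps)
    finally show "0 \<le> Re (frm {..<n} unitk x x) + Re (frm {..<n} unitk y y) + 2 * Re (p * frm {..<n} (kern ?s) x y + q * frm {..<n} (kern ?s) y x)" .
  qed
  then show ?thesis by (simp add: min_level_iff kmin_iff msum_def)
qed

lemma compact_matrix_convex_min_set: "compact_matrix_convex (min_set K)"
  unfolding compact_matrix_convex_def
proof (intro conjI allI impI)
  show "min_set K \<subseteq> (\<Union>n\<in>{1..}. carrier_mat n n)"
    unfolding min_set_def min_level_def by blast
  show "compact_mats n (min_set K \<inter> carrier_mat n n)" if "1 \<le> n" for n
    unfolding min_set_level[OF that] by (rule compact_min_level)
next
  fix n m d and a \<gamma> :: "nat \<Rightarrow> complex mat"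
  assume n: "1 \<le> n" and *: "(\<forall>j<m. 1 \<le> d j \<and> a j \<in> min_set K \<inter> carrier_mat (d j) (d j) \<and> \<gamma> j \<in> carrier_mat (d j) n) \<and>
    msum n m (\<lambda>j. mat_adjoint (\<gamma> j) * \<gamma> j) = 1\<^sub>m n"
  have "msum n m (\<lambda>j. mat_adjoint (\<gamma> j) * a j * \<gamma> j) \<in> min_level n K"
  proof (rule min_level_msum[of m a d \<gamma> n])
    show "a j \<in> min_level (d j) K" if "j < m" for j
      using * that min_set_level[of "d j" K] by blast
  qed (use * in auto)
  then show "msum n m (\<lambda>j. mat_adjoint (\<gamma> j) * a j * \<gamma> j) \<in> min_set K"
    unfolding min_set_def using n by blast
qed

lemma smith_ward_property_min_set:
  assumes ess: "ess_matrix_range x = min_set K"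
  shows "smith_ward_property x"
proof -
  have "\<exists>N. passes_bop T (1 + e) N x" if "0 < e" for e
  proof (rule ess_range_tail_tests[OF _ _ that])
    show "(p, q) \<in> T \<Longrightarrow> cmod p \<le> 1 \<and> cmod q \<le> 1" for p q by (rule bounded)
    show "passes_mat T 2 (kern a)" if "a \<in> ess_matrix_range_level 2 x" for a
      using that ess_matrix_range_level_eq[OF ess, of 2] by (simp add: min_level_iff kmin_iff)
  qed
  from exists_compact_perturbation_passes[OF bounded this]
  obtain k where k: "compact_op k" "passes_bop T 1 0 (x + k)" by blast
  have "{l \<in> K. cmod l = R} \<subseteq> {f x | f. ess_state f}"
  proof
    fix l assume "l \<in> {l \<in> K. cmod l = R}"
    then obtain f where "ess_state f" "f x = l"
      using exists_ess_state_at_extreme_point[OF K(2) _ _ ess] by blast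
    then show "l \<in> {f x | f. ess_state f}" by blast
  qed
  then have "convex hull {l \<in> K. cmod l = R} \<subseteq> {f x | f. ess_state f}"
    by (rule hull_minimal) (rule convex_ess_state_values)
  then have states: "K \<subseteq> {f x | f. ess_state f}" using K(3) by (rule order_trans[rotated])
  have "matrix_range_level n (x + k) = min_level n K" for n
  proof (intro equalityI subsetI)
    fix a assume "a \<in> matrix_range_level n (x + k)"
    from matrix_range_passes[OF k(2) this] show "a \<in> min_level n K" by (simp add: min_level_iff kmin_iff)
  qed (rule min_level_subset_matrix_range[OF states k(1)])
  then have "ess_matrix_range x = matrix_range (x + k)"
    unfolding ess matrix_range_def min_set_def by simp
  then show ?thesis unfolding smith_ward_property_def using k(1) by blast
qed

lemma smith_ward_geometry_min_set: "smith_ward_geometry (min_set K)"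
  unfolding smith_ward_geometry_def
  using compact_matrix_convex_min_set smith_ward_property_min_set by blast

end

section \<open>The disc and the square\<close>

lemma testable_disc: "testable_compact_set (cball 0 1) disc_tests 1"
proof
  have eq: "{l \<in> cball 0 1. cmod l = 1} = frontier (cball 0 1 :: complex set)" by auto
  show "cball 0 1 \<subseteq> convex hull {l \<in> cball 0 1. cmod l = 1}"
    unfolding eq by (rule eq_refl[OF Krein_Milman_frontier[OF convex_cball compact_cball]])
qed (auto simp: disc_tests_def intro: kmin_disc[unfolded disc_tests_def])

definition unit_square :: "complex set" where
  "unit_square = {Complex s t | s t. s \<in> {-1..1} \<and> t \<in> {-1..1}}"

lemma testable_square: "testable_compact_set unit_square square_tests (sqrt 2)"
proof
  have box: "unit_square = cbox (Complex (-1) (-1)) (Complex 1 1)"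
    by (auto simp: unit_square_def in_cbox_complex_iff) (metis complex.collapse)
  show comp: "compact unit_square" unfolding box by (rule compact_cbox)
  show "unit_square \<subseteq> cball 0 (sqrt 2)"
    unfolding unit_square_def
  proof clarify
    fix s t :: real assume "s \<in> {-1..1}" "t \<in> {-1..1}"
    then have "s\<^sup>2 \<le> 1" "t\<^sup>2 \<le> 1" by (auto simp: abs_square_le_1 abs_le_iff)
    then show "Complex s t \<in> cball 0 (sqrt 2)" by (simp add: complex_norm)
  qed
  \<comment> \<open>Only the corners have modulus \<open>sqrt 2\<close>. Segments between corners
    give the horizontal edges, and segments between these edges fill the square.\<close>
  let ?H = "convex hull {l \<in> unit_square. cmod l = sqrt 2}"
  have corner: "Complex s t \<in> ?H" if "s = 1 \<or> s = -1" "t = 1 \<or> t = -1" for s t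
    by (rule hull_inc) (use that in \<open>auto simp: unit_square_def complex_norm\<close>)
  have mix: "Complex ((1 - r) * s + r * s') ((1 - r) * t + r * t') \<in> ?H"
    if "Complex s t \<in> ?H" "Complex s' t' \<in> ?H" "0 \<le> r" "r \<le> 1" for s t s' t' r
    using convexD_alt[OF convex_convex_hull that(1,2), of r] that(3,4) by (simp add: scaleR_conv_of_real complex_eq_iff Complex_eq algebra_simps)
  have edge: "Complex s t \<in> ?H" if "s \<in> {-1..1}" "t = 1 \<or> t = -1" for s t
    using mix[OF corner[of "-1" t] corner[of 1 t], of "(1 + s) / 2"] that by (simp add: field_simps)
  show "unit_square \<subseteq> ?H"
  proof
    fix l assume "l \<in> unit_square"
    then obtain s t where l: "l = Complex s t" and "s \<in> {-1..1}" "t \<in> {-1..1}" by (auto simp: unit_square_def)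
    then have "Complex s t \<in> ?H"
      using mix[OF edge[of s "-1"] edge[of s 1], of "(1 + t) / 2"] by (simp add: field_simps)
    then show "l \<in> ?H" unfolding l .
  qed
  show "kmin n unit_square a" if "passes_mat square_tests n a" for n a
    by (rule kmin_square[OF _ _ _ _ _ comp that]) (auto intro: exI[of _ 0] simp: unit_square_def complex_eq_iff)
next
  fix p q :: complex assume "(p, q) \<in> square_tests"
  then obtain \<omega> where \<omega>: "cmod \<omega> = 1" and p: "p = ((1 - \<i>) + \<omega> * (1 + \<i>)) / 4"
    and q: "q = cnj (((1 + \<i>) + \<omega> * (1 - \<i>)) / 4)" unfolding square_tests_def by blast
  have two: "cmod (1 - \<i>) \<le> 2" "cmod (1 + \<i>) \<le> 2"
    using norm_triangle_ineq4[of 1 \<i>] norm_triangle_ineq[of 1 \<i>] by simp_all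
  have "cmod ((1 - \<i>) + \<omega> * (1 + \<i>)) \<le> 4" "cmod ((1 + \<i>) + \<omega> * (1 - \<i>)) \<le> 4"
    using norm_triangle_ineq[of "1 - \<i>" "\<omega> * (1 + \<i>)"] norm_triangle_ineq[of "1 + \<i>" "\<omega> * (1 - \<i>)"] two
    by (simp_all add: norm_mult \<omega>)
  then show "cmod p \<le> 1 \<and> cmod q \<le> 1" unfolding p q complex_mod_cnj norm_divide by simp
  fix l assume "l \<in> unit_square"
  then obtain s t where l: "l = Complex s t" and st: "\<bar>s\<bar> \<le> 1" "\<bar>t\<bar> \<le> 1"
    by (auto simp: unit_square_def abs_le_iff)
  \<comment> \<open>For a scalar the halves of the sum and of the difference play the roles of
    \<open>u\<close> and \<open>v\<close>, and the sum of their moduli is the maximum of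
    \<open>\<bar>s\<bar>\<close> and \<open>\<bar>t\<bar>\<close>.\<close>
  have "p * l + cnj (q * l) = of_real ((s + t) / 2) + \<omega> * of_real ((s - t) / 2)"
    unfolding p q l by (simp add: Complex_eq field_simps)
  also have "cmod \<dots> \<le> \<bar>(s + t) / 2\<bar> + \<bar>(s - t) / 2\<bar>"
    by (rule order_trans[OF norm_triangle_ineq]) (simp add: norm_mult \<omega> del: of_real_divide)
  also have "\<dots> = (\<bar>s + t\<bar> + \<bar>s - t\<bar>) / 2" unfolding abs_divide by simp
  also have "\<dots> \<le> 1" using st by (auto simp: abs_if split: if_splits)
  finally show "cmod (p * l + cnj (q * l)) \<le> 1" .
qed

theorem proposition3p7:
  shows "smith_ward_geometry (min_set {Complex s t | s t. s \<in> {-1..1} \<and> t \<in> {-1..1}}) \<and>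
    smith_ward_geometry (min_set (cball 0 1))"
  using testable_compact_set.smith_ward_geometry_min_set[OF testable_square, unfolded unit_square_def]
    testable_compact_set.smith_ward_geometry_min_set[OF testable_disc] by (rule conjI)

end
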